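(* Let $\alpha>0$. There exist constants $C_1,C_2,c_3>0$ depending only on $\alpha$ such that the following holds. Let $\mathbf X_1,\dots,\mathbf X_n\in\mathbb R^p$ be drawn from the $K$-component Gaussian mixture model with true partition $G_1^*,\dots,G_K^*$ of $[n]$, centers $\boldsymbol\mu_1,\dots,\boldsymbol\mu_K\in\mathbb R^p$ and noise variance $\sigma^2>0$. Suppose that the cluster sizes are equal, i.e. $|G_1^*|=\dots=|G_K^*|=n/K$, and that $K\le C_1\log(n)/\log\log(n)$. Let $\Delta^2=\min_{1\le k\ne l\le K}\|\boldsymbol\mu_k-\boldsymbol\mu_l\|_2^2$ and $$\overline\Delta^2=4\sigma^2\left(1+\sqrt{1+\frac{Kp}{n\log n}}\right)\log n.$$ If $\Delta^2\ge(1+\alpha)\overline\Delta^2$, then the SDP estimator $\hat Z$ achieves exact recovery with probability at least $1-C_2(\log n)^{-c_3}$.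
   Context: Notation: $[n]=\{1,\dots,n\}$, $\mathbf 1_n$ is the all-ones vector in $\mathbb R^n$, $\langle A,B\rangle=\operatorname{tr}(A^TB)$. The number of clusters satisfies $2\le K\le n$, and $n\ge 3$ so that $\log\log n>0$. Gaussian mixture model: there is a fixed (deterministic, unknown) partition $G_1^*,\dots,G_K^*$ of $[n]$ into nonempty sets and fixed unknown centers $\boldsymbol\mu_1,\dots,\boldsymbol\mu_K\in\mathbb R^p$ such that $\mathbf X_i=\boldsymbol\mu_k+\boldsymbol\varepsilon_i$ whenever $i\in G_k^*$, where $\boldsymbol\varepsilon_1,\dots,\boldsymbol\varepsilon_n$ are i.i.d. $N(\mathbf 0,\sigma^2I_p)$. SDP: let $X=(\mathbf X_1,\dots,\mathbf X_n)\in\mathbb R^{p\times n}$, $A=X^TX$, and $$\hat Z=\operatorname{argmax}_{Z\in\mathscr C_K}\langle A,Z\rangle,\qquad \mathscr C_K=\{Z\in\mathbb R^{n\times n}: Z\succeq0,\ Z^T=Z,\ \operatorname{tr}(Z)=K,\ Z\mathbf 1_n=\mathbf 1_n,\ Z\ge0\ \text{entrywise}\}.$$ True membership matrix: $Z^*_{ij}=1/|G_k^*|$ if $i,j\in G_k^*$ for some $k$, and $Z^*_{ij}=0$ otherwise. "Exact recovery" is the event that $\hat Z=Z^*$, i.e. that $Z^*$ is the unique solution of the SDP. *)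

theory Defs
  imports "HOL-Probability.Probability" "Jordan_Normal_Form.Matrix"
begin

(* Index sets are zero-based: [n] is {..<n} and clusters are numbered by k < K.
   Both imports declare the infix \<bullet> and $; only the ones for Jordan_Normal_Form
   vectors are kept. *)

unbundle no inner_syntax
unbundle no vec_syntax

hide_const (open) Finite_Cartesian_Product.vec Finite_Cartesian_Product.mat
  Finite_Cartesian_Product.row Finite_Cartesian_Product.column Determinants.trace

section \<open>Matrices\<close>

definition mat_trace :: "real mat \<Rightarrow> real" where
  "mat_trace A = (\<Sum>i<dim_row A. A $$ (i, i))"

definition mat_inner :: "real mat \<Rightarrow> real mat \<Rightarrow> real" where
  "mat_inner A B = mat_trace (transpose_mat A * B)"

definition pos_semidef :: "nat \<Rightarrow> real mat \<Rightarrow> bool" where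
  "pos_semidef n Z \<longleftrightarrow> (\<forall>v \<in> carrier_vec n. 0 \<le> v \<bullet> (Z *\<^sub>v v))"

definition all_ones :: "nat \<Rightarrow> real vec" where
  "all_ones n = vec n (\<lambda>_. 1)"

section \<open>The Gaussian mixture model\<close>

definition is_partition :: "nat \<Rightarrow> nat \<Rightarrow> (nat \<Rightarrow> nat set) \<Rightarrow> bool" where
  "is_partition n K G \<longleftrightarrow>
     (\<Union>k<K. G k) = {..<n} \<and> disjoint_family_on G {..<K} \<and> (\<forall>k<K. G k \<noteq> {})"

definition cluster_of :: "nat \<Rightarrow> (nat \<Rightarrow> nat set) \<Rightarrow> nat \<Rightarrow> nat" where
  "cluster_of K G i = (THE k. k < K \<and> i \<in> G k)"

(* N(0, \<sigma>^2 I_p), as the law of the tuple of its p coordinates *)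
definition gaussian_vector :: "nat \<Rightarrow> real \<Rightarrow> (nat \<Rightarrow> real) measure" where
  "gaussian_vector p \<sigma> = (\<Pi>\<^sub>M j\<in>{..<p}. density lborel (normal_density 0 \<sigma>))"

(* The joint law of n i.i.d. N(0, \<sigma>^2 I_p) vectors; an outcome \<epsilon> has \<epsilon> i j as the
   j-th coordinate of the i-th noise vector. *)
definition gaussian_noise :: "nat \<Rightarrow> nat \<Rightarrow> real \<Rightarrow> (nat \<Rightarrow> nat \<Rightarrow> real) measure" where
  "gaussian_noise n p \<sigma> = (\<Pi>\<^sub>M i\<in>{..<n}. gaussian_vector p \<sigma>)"

(* The p \<times> n data matrix X, whose i-th column is \<mu>_k + \<epsilon>_i for i in the k-th cluster *)
definition gmm_data ::
    "nat \<Rightarrow> nat \<Rightarrow> nat \<Rightarrow> (nat \<Rightarrow> nat set) \<Rightarrow> (nat \<Rightarrow> real vec) \<Rightarrow> (nat \<Rightarrow> nat \<Rightarrow> real) \<Rightarrow> real mat" where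
  "gmm_data n p K G \<mu> \<epsilon> =
     mat_of_cols p (map (\<lambda>i. \<mu> (cluster_of K G i) + vec p (\<epsilon> i)) [0..<n])"

definition min_sq_separation :: "nat \<Rightarrow> (nat \<Rightarrow> real vec) \<Rightarrow> real" where
  "min_sq_separation K \<mu> =
     Min {(\<mu> k - \<mu> l) \<bullet> (\<mu> k - \<mu> l) | k l. k < K \<and> l < K \<and> k \<noteq> l}"

definition sq_threshold :: "nat \<Rightarrow> nat \<Rightarrow> nat \<Rightarrow> real \<Rightarrow> real" where
  "sq_threshold n p K \<sigma> =
     4 * \<sigma>\<^sup>2 * (1 + sqrt (1 + real K * real p / (real n * ln (real n)))) * ln (real n)"

section \<open>The semidefinite program\<close>

definition sdp_feasible :: "nat \<Rightarrow> nat \<Rightarrow> real mat set" where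
  "sdp_feasible n K =
     {Z \<in> carrier_mat n n. pos_semidef n Z \<and> transpose_mat Z = Z \<and> mat_trace Z = real K \<and>
        Z *\<^sub>v all_ones n = all_ones n \<and> (\<forall>i<n. \<forall>j<n. 0 \<le> Z $$ (i, j))}"

definition sdp_solutions :: "nat \<Rightarrow> nat \<Rightarrow> real mat \<Rightarrow> real mat set" where
  "sdp_solutions n K X =
     {Z. is_arg_max (mat_inner (transpose_mat X * X)) (\<lambda>Z. Z \<in> sdp_feasible n K) Z}"

definition true_membership :: "nat \<Rightarrow> nat \<Rightarrow> (nat \<Rightarrow> nat set) \<Rightarrow> real mat" where
  "true_membership n K G =
     mat n n (\<lambda>(i, j). if \<exists>k<K. i \<in> G k \<and> j \<in> G k
                       then 1 / real (card (G (cluster_of K G i))) else 0)"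

definition exact_recovery :: "nat \<Rightarrow> nat \<Rightarrow> (nat \<Rightarrow> nat set) \<Rightarrow> real mat \<Rightarrow> bool" where
  "exact_recovery n K G X \<longleftrightarrow> sdp_solutions n K X = {true_membership n K G}"

section \<open>Arbitrary probability spaces\<close>

(* Stating a probability bound for the product space gaussian_noise loses no generality:
   i.i.d. N(0, \<sigma>^2 I_p) vectors on any probability space have it as their joint law. *)
lemma (in prob_space) distr_iid_gaussian_vectors:
  assumes "indep_vars (\<lambda>_. \<Pi>\<^sub>M j\<in>{..<p}. borel) \<epsilon> {..<n}"
    and "\<And>i. i < n \<Longrightarrow> distr M (\<Pi>\<^sub>M j\<in>{..<p}. borel) (\<epsilon> i) = gaussian_vector p \<sigma>"
    and "0 < n"
  shows "distr M (\<Pi>\<^sub>M i\<in>{..<n}. \<Pi>\<^sub>M j\<in>{..<p}. borel) (\<lambda>\<omega>. \<lambda>i\<in>{..<n}. \<epsilon> i \<omega>) = gaussian_noise n p \<sigma>"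
proof -
  have "random_variable (\<Pi>\<^sub>M j\<in>{..<p}. borel) (\<epsilon> i)" if "i \<in> {..<n}" for i
    using assms(1) that by (auto simp: indep_vars_def)
  with assms(1,3) have "distr M (\<Pi>\<^sub>M i\<in>{..<n}. \<Pi>\<^sub>M j\<in>{..<p}. borel) (\<lambda>\<omega>. \<lambda>i\<in>{..<n}. \<epsilon> i \<omega>)
      = (\<Pi>\<^sub>M i\<in>{..<n}. distr M (\<Pi>\<^sub>M j\<in>{..<p}. borel) (\<epsilon> i))"
    by (subst indep_vars_iff_distr_eq_PiM'[symmetric]) auto
  also have "\<dots> = gaussian_noise n p \<sigma>"
    unfolding gaussian_noise_def using assms(2) by (intro PiM_cong) auto
  finally show ?thesis .
qed

end

(*
  Call the cluster size m = n / K. Weak duality with a matrix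
  W = \<rho> I + (1 \<alpha>^T + \<alpha> 1^T) / 2 - A - B, where B is nonnegative, vanishes inside clusters and is
  positive and rank one on every other block, shows that the true membership matrix is the
  only optimum as soon as W is positive semidefinite and annihilates the cluster indicators.
  The latter condition determines \<alpha> and the row sums of B, which must be positive:
    m / 2 * (|X_i - Xbar_l|^2 - |X_i - Xbar_k|^2) > \<rho>    (i in cluster k, l \<noteq> k),
  and \<rho> only has to dominate the Gram matrix of the noise plus B on vectors that sum to zero
  over each cluster. That Gram matrix is \<sigma>^2 p I up to an error of order \<sigma>^2 (n + sqrt (n p)),
  which is negligible because K is small compared to ln n; so \<rho> = \<sigma>^2 p + O(\<sigma>^2 (n + sqrt (n p))).
  The term \<sigma>^2 p in \<rho> is cancelled by the contribution of |\<epsilon>_i|^2 / m to the row sums, and what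
  remains is a one-dimensional Gaussian tail for the inner product of \<epsilon>_i with a vector, independent of
  it, of squared norm about \<Delta>^2 + 2 \<sigma>^2 p / m. A union bound over the n K
  pairs (i, l) needs \<Delta>^4 > 8 \<sigma>^2 ln n (\<Delta>^2 + 2 \<sigma>^2 p / m), which is the stated threshold.
*)

theory Submission
  imports Defs
begin

text \<open>Put L = ln n and q = p / m. The separation of two centers is at least of order
  \<sigma>^2 (L + sqrt (L q)), while the Gram error on all of [n], divided by m, is of order
  \<sigma>^2 (K + sqrt (K q)). Their quotient is O(\<theta>) once K \<le> \<theta>^2 L, and this is
  the origin of C_1 = \<theta>^2. For two clusters the Gram error is only \<sigma>^2 (1 + sqrt q).
  Spectral bounds may therefore lose any absolute factor; the one estimate that must be sharp is the
  Gaussian tail of the inner product. Its slack, the factor 1 + \<alpha>, is divided among the union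
  bound, the error in the squared norm of the independent vector, and the remaining linear errors. A
  block of B has prescribed row sums and prescribed column sums with the same total. Their outer
  product divided by the total is a positive matrix with these sums, and its quadratic form is a
  product of two linear functionals, which are small on vectors with zero cluster sums. All failure
  probabilities turn out to be O(1 / ln n), so c_3 = 1.\<close>

section \<open>Gaussian quadratic forms\<close>

text \<open>The image under \<open>T\<close> behaves like $N(0, s I_q)$. Only the Laplace transform of squared
  distances is recorded, for both signs of \<open>\<theta>\<close>: it is closed under independent linear combinations.\<close>

definition isotropic_gaussian :: "'a measure \<Rightarrow> nat \<Rightarrow> ('a \<Rightarrow> nat \<Rightarrow> real) \<Rightarrow> real \<Rightarrow> bool" where
  "isotropic_gaussian N q T s \<longleftrightarrow> prob_space N \<and> 0 \<le> s \<and>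
     (\<forall>j<q. (\<lambda>x. T x j) \<in> borel_measurable N) \<and>
     (\<forall>\<theta> v a. 0 < 1 + 2 * \<theta> * v\<^sup>2 * s \<longrightarrow>
        (\<integral>\<^sup>+x. ennreal (exp (- \<theta> * (\<Sum>j<q. (a j + v * T x j)\<^sup>2))) \<partial>N) =
        ennreal ((1 + 2 * \<theta> * v\<^sup>2 * s) powr (- real q / 2) *
          exp (- \<theta> * (\<Sum>j<q. (a j)\<^sup>2) / (1 + 2 * \<theta> * v\<^sup>2 * s))))"

section \<open>One-dimensional Gaussian integrals and their products\<close>

abbreviation normal_measure :: "real \<Rightarrow> real measure" where
  "normal_measure \<sigma> \<equiv> density lborel (normal_density 0 \<sigma>)"

text \<open>Completing the square shows that a normal density times the exponential of a suitable
  quadratic polynomial is a multiple of another normal density. The integral is that multiple,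
  because the new density has total mass 1; both transforms below are computed in this way.\<close>

lemma nn_integral_normal_measure:
  assumes "0 < \<tau>" and c: "0 \<le> c" and [measurable]: "f \<in> borel_measurable borel"
    and "\<And>x. 0 \<le> f x"
    and eq: "\<And>x. normal_density 0 \<sigma> x * f x = c * normal_density m \<tau> x"
  shows "(\<integral>\<^sup>+x. ennreal (f x) \<partial>normal_measure \<sigma>) = ennreal c"
proof -
  interpret P: prob_space "density lborel (normal_density m \<tau>)"
    by (rule prob_space_normal_density) fact
  have "(\<integral>\<^sup>+x. ennreal (f x) \<partial>normal_measure \<sigma>)
      = (\<integral>\<^sup>+x. ennreal (normal_density 0 \<sigma> x) * ennreal (f x) \<partial>lborel)"
    by (subst nn_integral_density) auto
  also have "\<dots> = (\<integral>\<^sup>+x. ennreal c * ennreal (normal_density m \<tau> x) \<partial>lborel)"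
    by (intro nn_integral_cong) (simp add: eq c assms(4) flip: ennreal_mult)
  also have "\<dots> = ennreal c * (\<integral>\<^sup>+x. ennreal (normal_density m \<tau> x) \<partial>lborel)"
    by (rule nn_integral_cmult) auto
  also have "(\<integral>\<^sup>+x. ennreal (normal_density m \<tau> x) \<partial>lborel) = 1"
    using P.emeasure_space_1 by (simp add: emeasure_density)
  finally show ?thesis by simp
qed

text \<open>The tilted density has variance \<open>\<sigma>\<^sup>2 / c\<close>, which makes sense
  as long as \<open>c\<close> is positive. Negative \<open>\<theta>\<close>, needed for upper tails,
  is thus included.\<close>

lemma normal_quadratic_mgf:
  fixes \<theta> v a \<sigma> :: real
  assumes "0 < \<sigma>" "0 < 1 + 2 * \<theta> * v\<^sup>2 * \<sigma>\<^sup>2"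
  defines "c \<equiv> 1 + 2 * \<theta> * v\<^sup>2 * \<sigma>\<^sup>2"
  shows "(\<integral>\<^sup>+x. ennreal (exp (- \<theta> * (a + v * x)\<^sup>2)) \<partial>normal_measure \<sigma>)
    = ennreal (c powr (- 1 / 2) * exp (- \<theta> * a\<^sup>2 / c))"
proof (rule nn_integral_normal_measure)
  have c: "0 < c" using assms by simp
  show "0 < \<sigma> / sqrt c" using assms c by simp
  \<comment> \<open>The center of the completed square.\<close>
  define m where "m = - 2 * \<theta> * a * v * \<sigma>\<^sup>2 / c"
  fix x
  have e: "- x\<^sup>2 / (2 * \<sigma>\<^sup>2) + - \<theta> * (a + v * x)\<^sup>2
      = - \<theta> * a\<^sup>2 / c + - (x - m)\<^sup>2 / (2 * (\<sigma> / sqrt c)\<^sup>2)"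
  proof -
    have cm: "c * m = - 2 * \<theta> * a * v * \<sigma>\<^sup>2" using c by (simp add: m_def)
    have "c * (- x\<^sup>2 + - 2 * \<sigma>\<^sup>2 * \<theta> * (a + v * x)\<^sup>2) = - 2 * \<sigma>\<^sup>2 * \<theta> * a\<^sup>2 - (c * x - c * m)\<^sup>2"
      unfolding cm unfolding c_def power2_eq_square by (simp add: algebra_simps)
    then have "- x\<^sup>2 + - 2 * \<sigma>\<^sup>2 * \<theta> * (a + v * x)\<^sup>2 = (- 2 * \<sigma>\<^sup>2 * \<theta> * a\<^sup>2 - (c * x - c * m)\<^sup>2) / c"
      using c by (simp add: field_simps)
    also have "\<dots> = - 2 * \<sigma>\<^sup>2 * \<theta> * a\<^sup>2 / c - c * (x - m)\<^sup>2"
      using c by (simp add: diff_divide_distrib right_diff_distrib[symmetric] power_mult_distrib)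
        (simp add: power2_eq_square)
    finally have *: "- x\<^sup>2 + - 2 * \<sigma>\<^sup>2 * \<theta> * (a + v * x)\<^sup>2 = - 2 * \<sigma>\<^sup>2 * \<theta> * a\<^sup>2 / c - c * (x - m)\<^sup>2" .
    have "- x\<^sup>2 / (2 * \<sigma>\<^sup>2) + - \<theta> * (a + v * x)\<^sup>2 = (- x\<^sup>2 + - 2 * \<sigma>\<^sup>2 * \<theta> * (a + v * x)\<^sup>2) / (2 * \<sigma>\<^sup>2)"
      using \<open>0 < \<sigma>\<close> by (simp add: field_simps)
    also have "\<dots> = - \<theta> * a\<^sup>2 / c - c * (x - m)\<^sup>2 / (2 * \<sigma>\<^sup>2)"
      unfolding * using \<open>0 < \<sigma>\<close> c by (simp add: field_simps)
    finally show ?thesis using c by (simp add: power_divide)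
  qed
  have "sqrt (2 * pi * (\<sigma> / sqrt c)\<^sup>2) = sqrt (2 * pi * \<sigma>\<^sup>2) / sqrt c"
    using c by (simp add: power_divide real_sqrt_divide)
  moreover have "c powr (- 1 / 2) = 1 / sqrt c"
    using c by (simp add: powr_minus_divide powr_half_sqrt)
  ultimately show "normal_density 0 \<sigma> x * exp (- \<theta> * (a + v * x)\<^sup>2) =
      (c powr (- 1 / 2) * exp (- \<theta> * a\<^sup>2 / c)) * normal_density m (\<sigma> / sqrt c) x"
    unfolding normal_density_def using e c by (simp add: exp_add[symmetric])
qed auto

lemma normal_exp_linear:
  assumes "0 < \<sigma>"
  shows "(\<integral>\<^sup>+x. ennreal (exp (t * x)) \<partial>normal_measure \<sigma>) = ennreal (exp (t\<^sup>2 * \<sigma>\<^sup>2 / 2))"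
proof (rule nn_integral_normal_measure)
  fix x
  have "- x\<^sup>2 / (2 * \<sigma>\<^sup>2) + t * x = t\<^sup>2 * \<sigma>\<^sup>2 / 2 + - (x - t * \<sigma>\<^sup>2)\<^sup>2 / (2 * \<sigma>\<^sup>2)"
    using assms by (simp add: field_simps power2_eq_square)
  then show "normal_density 0 \<sigma> x * exp (t * x)
      = exp (t\<^sup>2 * \<sigma>\<^sup>2 / 2) * normal_density (t * \<sigma>\<^sup>2) \<sigma> x"
    unfolding normal_density_def by (simp add: exp_add[symmetric])
qed (use assms in auto)

lemma isotropic_gaussian_mgf:
  assumes "isotropic_gaussian N q T s" "0 < 1 + 2 * \<theta> * v\<^sup>2 * s"
  shows "(\<integral>\<^sup>+x. ennreal (exp (- \<theta> * (\<Sum>j<q. (a j + v * T x j)\<^sup>2))) \<partial>N) =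
        ennreal ((1 + 2 * \<theta> * v\<^sup>2 * s) powr (- real q / 2) *
          exp (- \<theta> * (\<Sum>j<q. (a j)\<^sup>2) / (1 + 2 * \<theta> * v\<^sup>2 * s)))"
  using assms unfolding isotropic_gaussian_def by blast

lemma isotropic_gaussian_normal_measure:
  assumes "0 < \<sigma>"
  shows "isotropic_gaussian (normal_measure \<sigma>) 1 (\<lambda>x _. x) (\<sigma>\<^sup>2)"
  unfolding isotropic_gaussian_def
  using normal_quadratic_mgf[OF assms] prob_space_normal_density[OF assms]
  by (auto simp: lessThan_Suc)

lemma isotropic_gaussian_gaussian_vector:
  assumes "0 < \<sigma>"
  shows "isotropic_gaussian (gaussian_vector p \<sigma>) p (\<lambda>x. x) (\<sigma>\<^sup>2)"
  unfolding isotropic_gaussian_def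
proof (intro conjI allI impI)
  interpret N: prob_space "normal_measure \<sigma>" by (rule prob_space_normal_density) fact
  interpret product_prob_space "\<lambda>_. normal_measure \<sigma>" "{..<p}" ..
  show "prob_space (gaussian_vector p \<sigma>)"
    unfolding gaussian_vector_def by (rule prob_space_axioms)
  show "(\<lambda>x. x j) \<in> borel_measurable (gaussian_vector p \<sigma>)" if "j < p" for j
    unfolding gaussian_vector_def
    using measurable_component_singleton[of j "{..<p}" "\<lambda>_. normal_measure \<sigma>"] that by simp
  fix \<theta> v :: real and a :: "nat \<Rightarrow> real"
  assume c: "0 < 1 + 2 * \<theta> * v\<^sup>2 * \<sigma>\<^sup>2"
  define c where "c = 1 + 2 * \<theta> * v\<^sup>2 * \<sigma>\<^sup>2"
  have "(\<integral>\<^sup>+x. ennreal (exp (- \<theta> * (\<Sum>j<p. (a j + v * x j)\<^sup>2))) \<partial>gaussian_vector p \<sigma>)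
     = (\<integral>\<^sup>+x. (\<Prod>j<p. ennreal (exp (- \<theta> * (a j + v * x j)\<^sup>2))) \<partial>gaussian_vector p \<sigma>)"
    by (intro nn_integral_cong) (simp add: sum_distrib_left exp_sum prod_ennreal flip: sum_negf)
  also have "\<dots> = (\<Prod>j<p. \<integral>\<^sup>+x. ennreal (exp (- \<theta> * (a j + v * x)\<^sup>2)) \<partial>normal_measure \<sigma>)"
    unfolding gaussian_vector_def by (rule product_nn_integral_prod) auto
  also have "\<dots> = (\<Prod>j<p. ennreal (c powr (- 1 / 2) * exp (- \<theta> * (a j)\<^sup>2 / c)))"
    using normal_quadratic_mgf[OF assms c] by (simp add: c_def)
  also have "\<dots> = ennreal ((\<Prod>j<p. c powr (- 1 / 2)) * (\<Prod>j<p. exp (- \<theta> * (a j)\<^sup>2 / c)))"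
    by (simp add: prod_ennreal prod.distrib)
  also have "(\<Prod>j<p. c powr (- 1 / 2)) = c powr (- real p / 2)"
    using c by (simp add: c_def powr_powr flip: powr_realpow)
  also have "(\<Prod>j<p. exp (- \<theta> * (a j)\<^sup>2 / c)) = exp (- \<theta> * (\<Sum>j<p. (a j)\<^sup>2) / c)"
    by (simp add: exp_sum[symmetric] sum_distrib_left sum_divide_distrib sum_negf)
  finally show "(\<integral>\<^sup>+x. ennreal (exp (- \<theta> * (\<Sum>j<p. (a j + v * x j)\<^sup>2))) \<partial>gaussian_vector p \<sigma>)
      = ennreal ((1 + 2 * \<theta> * v\<^sup>2 * \<sigma>\<^sup>2) powr (- real p / 2) *
          exp (- \<theta> * (\<Sum>j<p. (a j)\<^sup>2) / (1 + 2 * \<theta> * v\<^sup>2 * \<sigma>\<^sup>2)))"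
    unfolding c_def .
qed simp

text \<open>Integrating out one summand, with the partial sum in the role of the shift
  \<open>a\<close>, leaves the same integral over the other coordinates with \<open>\<theta>\<close>
  replaced by \<open>\<theta> / c1\<close>. This is why the definition carries an arbitrary shift
  and why the induction generalizes \<open>\<theta>\<close>.\<close>

lemma isotropic_gaussian_sum:
  fixes w :: "'i \<Rightarrow> real"
  assumes "finite I" and N: "isotropic_gaussian N q T s"
  shows "isotropic_gaussian (\<Pi>\<^sub>M i\<in>I. N) q (\<lambda>x j. \<Sum>i\<in>I. w i * T (x i) j) (s * (\<Sum>i\<in>I. (w i)\<^sup>2))"
proof -
  have "prob_space N" and s: "0 \<le> s" and
    T: "\<And>j. j < q \<Longrightarrow> (\<lambda>x. T x j) \<in> borel_measurable N"
    using N unfolding isotropic_gaussian_def by blast+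
  note mgf = isotropic_gaussian_mgf[OF N]
  interpret N: prob_space N by fact
  interpret product_prob_space "\<lambda>_. N" I ..
  have T': "(\<lambda>x. T (x i) j) \<in> borel_measurable (\<Pi>\<^sub>M i\<in>J. N)" if "j < q" "i \<in> J" for i j and J :: "'i set"
    using T[OF that(1)] that(2) by measurable
  have *: "(\<integral>\<^sup>+x. ennreal (exp (- \<theta> * (\<Sum>j<q. (a j + (\<Sum>i\<in>J. w i * T (x i) j))\<^sup>2))) \<partial>(\<Pi>\<^sub>M i\<in>J. N)) =
        ennreal ((1 + 2 * \<theta> * (s * (\<Sum>i\<in>J. (w i)\<^sup>2))) powr (- real q / 2) *
          exp (- \<theta> * (\<Sum>j<q. (a j)\<^sup>2) / (1 + 2 * \<theta> * (s * (\<Sum>i\<in>J. (w i)\<^sup>2)))))"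
    if "finite J" "0 < 1 + 2 * \<theta> * (s * (\<Sum>i\<in>J. (w i)\<^sup>2))" for \<theta> a J and w :: "'i \<Rightarrow> real"
    using that
  proof (induction J arbitrary: \<theta> rule: finite_induct)
    case empty
    then show ?case by (simp add: PiM_empty)
  next
    case (insert i J)
    define S where "S = s * (\<Sum>i\<in>J. (w i)\<^sup>2)"
    define c1 where "c1 = 1 + 2 * \<theta> * (w i)\<^sup>2 * s"
    define c where "c = 1 + 2 * \<theta> * (s * (\<Sum>i\<in>insert i J. (w i)\<^sup>2))"
    have S: "0 \<le> S" using s by (simp add: S_def sum_nonneg)
    have c_eq: "c = c1 + 2 * \<theta> * S"
      using insert by (simp add: c_def c1_def S_def algebra_simps)
    have c: "0 < c" using insert by (simp add: c_def)
    \<comment> \<open>For negative \<open>\<theta>\<close> the factor \<open>c1\<close> of one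
      summand is at least the factor \<open>c\<close> of the whole sum.\<close>
    have c1: "0 < c1"
    proof (cases "\<theta> \<ge> 0")
      case True
      then show ?thesis using s by (simp add: c1_def add_pos_nonneg)
    next
      case False
      then have "\<theta> * S \<le> 0" using S by (simp add: mult_nonpos_nonneg)
      then show ?thesis using c c_eq by linarith
    qed
    \<comment> \<open>The factors \<open>c1\<close> and \<open>c / c1\<close> of the two
      integrations multiply to \<open>c\<close>.\<close>
    have quot: "1 + 2 * (\<theta> / c1) * S = c / c1"
      using c1 by (simp add: c_eq field_simps)
    note T'[measurable]
    have "(\<integral>\<^sup>+x. ennreal (exp (- \<theta> * (\<Sum>j<q. (a j + (\<Sum>i\<in>insert i J. w i * T (x i) j))\<^sup>2))) \<partial>(\<Pi>\<^sub>M i\<in>insert i J. N))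
      = (\<integral>\<^sup>+x. (\<integral>\<^sup>+y. ennreal (exp (- \<theta> * (\<Sum>j<q. (a j + (\<Sum>i'\<in>insert i J. w i' * T ((x(i := y)) i') j))\<^sup>2))) \<partial>N) \<partial>(\<Pi>\<^sub>M i\<in>J. N))"
      using insert by (intro product_nn_integral_insert) measurable
    also have "\<dots> = (\<integral>\<^sup>+x. (\<integral>\<^sup>+y. ennreal (exp (- \<theta> * (\<Sum>j<q. ((a j + (\<Sum>i'\<in>J. w i' * T (x i') j)) + w i * T y j)\<^sup>2))) \<partial>N) \<partial>(\<Pi>\<^sub>M i\<in>J. N))"
    proof (intro nn_integral_cong arg_cong[where f=ennreal] arg_cong[where f=exp]
        arg_cong2[where f="(*)"] refl sum.cong arg_cong[where f="\<lambda>x. x\<^sup>2"])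
      fix x y j
      have "(\<Sum>i'\<in>J. w i' * T ((x(i := y)) i') j) = (\<Sum>i'\<in>J. w i' * T (x i') j)"
        using insert by (intro sum.cong) auto
      then show "a j + (\<Sum>i'\<in>insert i J. w i' * T ((x(i := y)) i') j)
          = a j + (\<Sum>i'\<in>J. w i' * T (x i') j) + w i * T y j"
        using insert by simp
    qed
    also have "\<dots> = (\<integral>\<^sup>+x. ennreal (c1 powr (- real q / 2)) *
       ennreal (exp (- (\<theta> / c1) * (\<Sum>j<q. (a j + (\<Sum>i'\<in>J. w i' * T (x i') j))\<^sup>2))) \<partial>(\<Pi>\<^sub>M i\<in>J. N))"
      by (intro nn_integral_cong, subst mgf) (use c1 in \<open>simp_all add: c1_def ennreal_mult\<close>)
    also have "\<dots> = ennreal (c1 powr (- real q / 2)) * (\<integral>\<^sup>+x.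
       ennreal (exp (- (\<theta> / c1) * (\<Sum>j<q. (a j + (\<Sum>i'\<in>J. w i' * T (x i') j))\<^sup>2))) \<partial>(\<Pi>\<^sub>M i\<in>J. N))"
      by (intro nn_integral_cmult) measurable
    also have "\<dots> = ennreal (c1 powr (- real q / 2)) *
        ennreal ((c / c1) powr (- real q / 2) * exp (- (\<theta> / c1) * (\<Sum>j<q. (a j)\<^sup>2) / (c / c1)))"
      using insert.IH[of "\<theta> / c1"] c c1 quot by (simp add: S_def)
    also have "\<dots> = ennreal (c powr (- real q / 2) * exp (- \<theta> * (\<Sum>j<q. (a j)\<^sup>2) / c))"
      using c c1 by (simp add: powr_divide flip: ennreal_mult)
    finally show ?case unfolding c_def .
  qed
  show ?thesis
    unfolding isotropic_gaussian_def
  proof (intro conjI allI impI)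
    show "prob_space (\<Pi>\<^sub>M i\<in>I. N)" by (rule prob_space_axioms)
    show "0 \<le> s * (\<Sum>i\<in>I. (w i)\<^sup>2)" using s by (simp add: sum_nonneg)
    show "(\<lambda>x. \<Sum>i\<in>I. w i * T (x i) j) \<in> borel_measurable (\<Pi>\<^sub>M i\<in>I. N)" if "j < q" for j
      using T'[OF that] by measurable
    fix \<theta> v a
    assume c: "0 < 1 + 2 * \<theta> * v\<^sup>2 * (s * (\<Sum>i\<in>I. (w i)\<^sup>2))"
    have "2 * \<theta> * (s * (\<Sum>i\<in>I. (v * w i)\<^sup>2)) = 2 * \<theta> * v\<^sup>2 * (s * (\<Sum>i\<in>I. (w i)\<^sup>2))"
      by (simp add: power_mult_distrib sum_distrib_left[symmetric])
    with *[OF \<open>finite I\<close>, of \<theta> "\<lambda>i. v * w i" a] c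
    show "(\<integral>\<^sup>+x. ennreal (exp (- \<theta> * (\<Sum>j<q. (a j + v * (\<Sum>i\<in>I. w i * T (x i) j))\<^sup>2))) \<partial>(\<Pi>\<^sub>M i\<in>I. N)) =
        ennreal ((1 + 2 * \<theta> * v\<^sup>2 * (s * (\<Sum>i\<in>I. (w i)\<^sup>2))) powr (- real q / 2) *
          exp (- \<theta> * (\<Sum>j<q. (a j)\<^sup>2) / (1 + 2 * \<theta> * v\<^sup>2 * (s * (\<Sum>i\<in>I. (w i)\<^sup>2)))))"
      by (simp add: sum_distrib_left mult.assoc)
  qed
qed

section \<open>Exponential tail bounds\<close>

lemma (in prob_space) exp_markov:
  assumes [measurable]: "Y \<in> borel_measurable M"
    and b: "(\<integral>\<^sup>+x. ennreal (exp (Y x)) \<partial>M) \<le> ennreal b" "0 \<le> b"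
  shows "prob {x\<in>space M. y < Y x} \<le> b * exp (- y)"
proof -
  have "emeasure M {x\<in>space M. y < Y x} \<le> emeasure M {x\<in>space M. 1 \<le> ennreal (exp (- y)) * ennreal (exp (Y x))}"
    by (intro emeasure_mono) (auto simp flip: ennreal_mult exp_add)
  also have "\<dots> \<le> ennreal (exp (- y)) * (\<integral>\<^sup>+x. ennreal (exp (Y x)) * indicator (space M) x \<partial>M)"
    using nn_integral_Markov_inequality[of "\<lambda>x. ennreal (exp (Y x))" "space M" M "ennreal (exp (- y))"]
    by simp
  also have "(\<integral>\<^sup>+x. ennreal (exp (Y x)) * indicator (space M) x \<partial>M) = (\<integral>\<^sup>+x. ennreal (exp (Y x)) \<partial>M)"
    by (intro nn_integral_cong) auto
  also have "ennreal (exp (- y)) * (\<integral>\<^sup>+x. ennreal (exp (Y x)) \<partial>M) \<le> ennreal (b * exp (- y))"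
    using mult_left_mono[OF b(1), of "ennreal (exp (- y))"] b(2)
    by (simp add: mult.commute flip: ennreal_mult)
  finally show ?thesis
    using b(2) by (simp add: emeasure_eq_measure)
qed

text \<open>Second-order bound for the chi-square transform: the linear term will cancel against the
  mean, and \<open>x\<^sup>2\<close> is the price of the deviation.\<close>

lemma powr_half_le_exp:
  fixes x :: real
  assumes "\<bar>x\<bar> \<le> 1 / 2"
  shows "(1 + x) powr (- real q / 2) \<le> exp (real q * (- x / 2 + x\<^sup>2))"
proof -
  have x: "0 < 1 + x" using assms by (simp add: abs_le_iff)
  have "\<bar>ln (1 + x) - x\<bar> \<le> 2 * x\<^sup>2"
    using assms by (rule abs_ln_one_plus_x_minus_x_bound)
  then have "- ln (1 + x) \<le> 2 * (- x / 2 + x\<^sup>2)" by (simp add: abs_le_iff)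
  then have "real q / 2 * - ln (1 + x) \<le> real q / 2 * (2 * (- x / 2 + x\<^sup>2))"
    by (intro mult_left_mono) auto
  then have "- real q / 2 * ln (1 + x) \<le> real q * (- x / 2 + x\<^sup>2)"
    by (simp add: algebra_simps)
  then show ?thesis using x by (simp add: powr_def)
qed

text \<open>Chernoff bounds for both tails with the same parameter \<open>u / s\<close>. The choice
  of \<open>u\<close> keeps it below 1 / 4, the range of the second-order bound; the quadratic cost
  is 4 q u^2 \<le> t / 4, the gain is 5 u y \<ge> 5 t / 4, and the difference is the required
  t.\<close>

lemma isotropic_gaussian_sq_norm_tail:
  assumes "isotropic_gaussian N q T s" "0 < s" "0 < t"
  shows "measure N {x\<in>space N. 5 * s * (t + sqrt (real q * t)) < \<bar>(\<Sum>j<q. (T x j)\<^sup>2) - real q * s\<bar>}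
    \<le> 2 * exp (- t)"
proof -
  interpret prob_space N using assms(1) by (simp add: isotropic_gaussian_def)
  define Y where "Y = (\<lambda>x. \<Sum>j<q. (T x j)\<^sup>2)"
  define y where "y = t + sqrt (real q * t)"
  define u where "u = sqrt (t / (t + real q)) / 4"
  have T: "(\<lambda>x. T x j) \<in> borel_measurable N" if "j < q" for j
    using assms(1) that by (simp add: isotropic_gaussian_def)
  have [measurable]: "Y \<in> borel_measurable N"
    unfolding Y_def using T by measurable
  have u: "0 \<le> u" "u \<le> 1 / 4" using \<open>0 < t\<close> by (auto simp: u_def)
  have "u * y \<ge> t / 4"
  proof -
    have "t * (t + real q) \<le> y\<^sup>2"
      using \<open>0 < t\<close> by (simp add: y_def power2_sum) (simp add: power2_eq_square algebra_simps)
    then have "t / (t + real q) * (t * (t + real q)) \<le> t / (t + real q) * y\<^sup>2"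
      using \<open>0 < t\<close> by (intro mult_left_mono) auto
    then have "t\<^sup>2 \<le> t / (t + real q) * y\<^sup>2"
      using \<open>0 < t\<close> by (simp add: power2_eq_square)
    then have "sqrt (t\<^sup>2) \<le> sqrt (t / (t + real q) * y\<^sup>2)" by (rule real_sqrt_le_mono)
    also have "\<dots> = sqrt (t / (t + real q)) * y"
      using \<open>0 < t\<close> by (simp only: real_sqrt_mult) (simp add: y_def)
    finally show ?thesis using \<open>0 < t\<close> by (simp add: u_def)
  qed
  moreover have "real q * (4 * u\<^sup>2) \<le> t / 4"
  proof -
    define e where "e = t / (t + real q)"
    have "(4 * u)\<^sup>2 = e"
      using \<open>0 < t\<close> by (simp add: u_def e_def)
    then have "e = 16 * u\<^sup>2"
      by (simp add: power_mult_distrib)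
    moreover have "real q * e \<le> t"
      using \<open>0 < t\<close> by (simp add: e_def field_simps)
    ultimately show ?thesis by simp
  qed
  ultimately have ut: "real q * (4 * u\<^sup>2) - 5 * (u * y) \<le> - t" by simp
  have mgf: "(\<integral>\<^sup>+x. ennreal (exp (- \<theta> * Y x)) \<partial>N) = ennreal ((1 + 2 * \<theta> * s) powr (- real q / 2))"
    if "0 < 1 + 2 * \<theta> * s" for \<theta>
  proof -
    from isotropic_gaussian_mgf[OF assms(1), of \<theta> 1 "\<lambda>_. 0"] that show ?thesis
      by (simp add: Y_def)
  qed
  \<comment> \<open>\<open>\<epsilon> = -1\<close> is the upper tail and
    \<open>\<epsilon> = 1\<close> the lower one.\<close>
  have side: "prob {x\<in>space N. real q * (- \<epsilon> * u) + 5 * (u * y) < - \<epsilon> * (u / s) * Y x} \<le> exp (- t)"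
    if "\<bar>\<epsilon>\<bar> = 1" for \<epsilon> :: real
  proof -
    have \<epsilon>: "\<epsilon>\<^sup>2 = 1" using that by (metis power2_abs one_power2)
    have sm: "\<bar>2 * \<epsilon> * u\<bar> \<le> 1 / 2" using u that by (simp add: abs_mult)
    have "0 < 1 + 2 * (\<epsilon> * (u / s)) * s" using sm \<open>0 < s\<close> by (simp add: abs_le_iff)
    from mgf[OF this] have "(\<integral>\<^sup>+x. ennreal (exp (- \<epsilon> * (u / s) * Y x)) \<partial>N)
        = ennreal ((1 + 2 * \<epsilon> * u) powr (- real q / 2))"
      using \<open>0 < s\<close> by (simp add: mult.assoc)
    also have "\<dots> \<le> ennreal (exp (real q * (- (2 * \<epsilon> * u) / 2 + (2 * \<epsilon> * u)\<^sup>2)))"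
      using powr_half_le_exp[OF sm] by (rule ennreal_leI)
    also have "real q * (- (2 * \<epsilon> * u) / 2 + (2 * \<epsilon> * u)\<^sup>2) = real q * (- \<epsilon> * u) + real q * (4 * u\<^sup>2)"
      using \<epsilon> by (simp add: power_mult_distrib algebra_simps)
    finally have "prob {x\<in>space N. real q * (- \<epsilon> * u) + 5 * (u * y) < - \<epsilon> * (u / s) * Y x}
        \<le> exp (real q * (- \<epsilon> * u) + real q * (4 * u\<^sup>2)) * exp (- (real q * (- \<epsilon> * u) + 5 * (u * y)))"
      by (intro exp_markov) auto
    also have "\<dots> \<le> exp (- t)"
      using ut by (simp flip: exp_add)
    finally show ?thesis .
  qed
  have "0 < u" using \<open>0 < t\<close> by (simp add: u_def add_pos_nonneg)
  have "{x\<in>space N. 5 * s * y < \<bar>Y x - real q * s\<bar>} \<subseteq>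
      {x\<in>space N. real q * (- (-1) * u) + 5 * (u * y) < - (-1) * (u / s) * Y x} \<union>
      {x\<in>space N. real q * (- 1 * u) + 5 * (u * y) < - 1 * (u / s) * Y x}"
  proof
    fix x assume x: "x \<in> {x\<in>space N. 5 * s * y < \<bar>Y x - real q * s\<bar>}"
    then consider "5 * s * y < Y x - real q * s" | "5 * s * y < real q * s - Y x" by (auto simp: abs_less_iff less_le_not_le abs_if split: if_splits)
    then show "x \<in> {x\<in>space N. real q * (- (-1) * u) + 5 * (u * y) < - (-1) * (u / s) * Y x} \<union>
      {x\<in>space N. real q * (- 1 * u) + 5 * (u * y) < - 1 * (u / s) * Y x}"
    proof cases
      case 1
      then have "u / s * (5 * s * y) < u / s * (Y x - real q * s)"
        using \<open>0 < u\<close> \<open>0 < s\<close> by (intro mult_strict_left_mono) auto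
      then show ?thesis using x \<open>0 < s\<close> by (simp add: algebra_simps)
    next
      case 2
      then have "u / s * (5 * s * y) < u / s * (real q * s - Y x)"
        using \<open>0 < u\<close> \<open>0 < s\<close> by (intro mult_strict_left_mono) auto
      then show ?thesis using x \<open>0 < s\<close> by (simp add: algebra_simps)
    qed
  qed
  then have "prob {x\<in>space N. 5 * s * y < \<bar>Y x - real q * s\<bar>} \<le>
      prob ({x\<in>space N. real q * (- (-1) * u) + 5 * (u * y) < - (-1) * (u / s) * Y x} \<union>
      {x\<in>space N. real q * (- 1 * u) + 5 * (u * y) < - 1 * (u / s) * Y x})"
    by (intro finite_measure_mono) auto
  also have "\<dots> \<le> prob {x\<in>space N. real q * (- (-1) * u) + 5 * (u * y) < - (-1) * (u / s) * Y x} +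
      prob {x\<in>space N. real q * (- 1 * u) + 5 * (u * y) < - 1 * (u / s) * Y x}"
    by (intro measure_Un_le) auto
  also have "\<dots> \<le> exp (- t) + exp (- t)"
    by (intro add_mono side) auto
  finally show ?thesis by (simp add: Y_def y_def)
qed

text \<open>At parameter 1 / (4 s) each square contributes the factor sqrt 2, which is below e. In
  units of 4 s the threshold is \<open>2 * card J\<close>, so at most e^|J| e^(-2 |J|)
  remains.\<close>

lemma isotropic_gaussian_sum_squares_tail:
  assumes "finite I" "J \<subseteq> I" and N: "isotropic_gaussian N 1 T s" and "0 < s"
  shows "measure (\<Pi>\<^sub>M i\<in>I. N) {x\<in>space (\<Pi>\<^sub>M i\<in>I. N). 8 * s * real (card J) < (\<Sum>i\<in>J. (T (x i) 0)\<^sup>2)}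
    \<le> exp (- real (card J))"
proof -
  interpret N: prob_space N using N by (simp add: isotropic_gaussian_def)
  interpret product_sigma_finite "\<lambda>_. N" by unfold_locales
  interpret P: prob_space "\<Pi>\<^sub>M i\<in>I. N" by (rule prob_space_PiM) unfold_locales
  have [measurable]: "(\<lambda>x. T x 0) \<in> borel_measurable N"
    using N by (simp add: isotropic_gaussian_def)
  from isotropic_gaussian_mgf[OF N, of "- 1 / (4 * s)" 1 "\<lambda>_. 0"] \<open>0 < s\<close>
  have mgf: "(\<integral>\<^sup>+x. ennreal (exp ((T x 0)\<^sup>2 / (4 * s))) \<partial>N) = ennreal ((1 / 2) powr (- 1 / 2))"
    by (simp add: lessThan_Suc)
  have "(1 / 2 :: real) powr (- 1 / 2) \<le> 2 powr 1"
    by (simp add: powr_minus powr_half_sqrt real_sqrt_divide real_le_lsqrt)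
  also have "\<dots> \<le> exp (1 :: real)" using exp_ge_add_one_self[of 1] by simp
  finally have e: "(1 / 2 :: real) powr (- 1 / 2) \<le> exp 1" .
  have I: "(\<integral>\<^sup>+x. ennreal (exp ((\<Sum>i\<in>J. (T (x i) 0)\<^sup>2) / (4 * s))) \<partial>(\<Pi>\<^sub>M i\<in>I. N)) \<le> ennreal (exp (real (card J)))"
  proof -
    have "(\<integral>\<^sup>+x. ennreal (exp ((\<Sum>i\<in>J. (T (x i) 0)\<^sup>2) / (4 * s))) \<partial>(\<Pi>\<^sub>M i\<in>I. N))
      = (\<integral>\<^sup>+x. (\<Prod>i\<in>I. if i \<in> J then ennreal (exp ((T (x i) 0)\<^sup>2 / (4 * s))) else 1) \<partial>(\<Pi>\<^sub>M i\<in>I. N))"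
      using assms(1,2) finite_subset[OF assms(2,1)]
      by (intro nn_integral_cong)
        (simp add: sum_divide_distrib exp_sum prod_ennreal prod.If_cases Int_absorb1)
    also have "\<dots> = (\<Prod>i\<in>I. \<integral>\<^sup>+x. (if i \<in> J then ennreal (exp ((T x 0)\<^sup>2 / (4 * s))) else 1) \<partial>N)"
      using assms(1) by (intro product_nn_integral_prod) auto
    also have "\<dots> = (\<Prod>i\<in>I. if i \<in> J then ennreal ((1 / 2) powr (- 1 / 2)) else 1)"
      by (intro prod.cong refl) (auto simp: mgf N.emeasure_space_1)
    also have "\<dots> \<le> (\<Prod>i\<in>I. if i \<in> J then ennreal (exp 1) else 1)"
      using e by (intro prod_mono_ennreal) (auto intro: ennreal_leI)
    also have "\<dots> = ennreal (exp (real (card J)))"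
      using assms(1,2) by (simp add: prod.If_cases Int_absorb1 ennreal_power flip: exp_of_nat_mult)
    finally show ?thesis .
  qed
  have "P.prob {x\<in>space (\<Pi>\<^sub>M i\<in>I. N). 2 * real (card J) < (\<Sum>i\<in>J. (T (x i) 0)\<^sup>2) / (4 * s)}
      \<le> exp (real (card J)) * exp (- (2 * real (card J)))"
  proof (intro P.exp_markov I)
    have [measurable]: "(\<lambda>x. T (x i) 0) \<in> borel_measurable (\<Pi>\<^sub>M i\<in>I. N)" if "i \<in> J" for i
      using assms(2) that by (intro measurable_compose[OF measurable_component_singleton]) auto
    show "(\<lambda>x. (\<Sum>i\<in>J. (T (x i) 0)\<^sup>2) / (4 * s)) \<in> borel_measurable (\<Pi>\<^sub>M i\<in>I. N)"
      by measurable
  qed auto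
  also have "\<dots> = exp (- real (card J))" by (simp flip: exp_add)
  also have "{x\<in>space (\<Pi>\<^sub>M i\<in>I. N). 2 * real (card J) < (\<Sum>i\<in>J. (T (x i) 0)\<^sup>2) / (4 * s)}
      = {x\<in>space (\<Pi>\<^sub>M i\<in>I. N). 8 * s * real (card J) < (\<Sum>i\<in>J. (T (x i) 0)\<^sup>2)}"
    using \<open>0 < s\<close> by (simp add: field_simps)
  finally show ?thesis .
qed

lemma gaussian_vector_inner_tail:
  assumes "0 < \<sigma>" "0 \<le> \<tau>"
  shows "measure (gaussian_vector p \<sigma>)
      {x\<in>space (gaussian_vector p \<sigma>). (\<Sum>j<p. x j * w j) < - \<sigma> * sqrt (\<Sum>j<p. (w j)\<^sup>2) * \<tau>}
    \<le> exp (- (\<tau>\<^sup>2 / 2))"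
proof -
  interpret N: prob_space "normal_measure \<sigma>" by (rule prob_space_normal_density) fact
  interpret product_sigma_finite "\<lambda>_. normal_measure \<sigma>" by unfold_locales
  interpret P: prob_space "gaussian_vector p \<sigma>"
    using isotropic_gaussian_gaussian_vector[OF \<open>0 < \<sigma>\<close>] by (auto simp: isotropic_gaussian_def)
  define W where "W = sqrt (\<Sum>j<p. (w j)\<^sup>2)"
  have [measurable]: "(\<lambda>x. x j) \<in> borel_measurable (gaussian_vector p \<sigma>)" if "j < p" for j
    unfolding gaussian_vector_def
    using measurable_component_singleton[of j "{..<p}" "\<lambda>_. normal_measure \<sigma>"] that by simp
  show ?thesis
  proof (cases "W = 0")
    case True
    then have "w j = 0" if "j < p" for j
      using that by (simp add: W_def sum_nonneg_eq_0_iff)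
    then show ?thesis by simp
  next
    case False
    then have W: "0 < W" using real_sqrt_ge_zero[OF sum_nonneg, of "{..<p}" "\<lambda>j. (w j)\<^sup>2"]
      unfolding W_def by simp
    have W2: "W\<^sup>2 = (\<Sum>j<p. (w j)\<^sup>2)" unfolding W_def by (simp add: sum_nonneg)
    \<comment> \<open>The optimal Chernoff parameter; the exponent becomes \<tau>^2 / 2 -
      \<tau>^2.\<close>
    define t where "t = \<tau> / (\<sigma> * W)"
    have "(\<integral>\<^sup>+x. ennreal (exp (- t * (\<Sum>j<p. x j * w j))) \<partial>gaussian_vector p \<sigma>)
      = (\<integral>\<^sup>+x. (\<Prod>j<p. ennreal (exp (- t * w j * x j))) \<partial>gaussian_vector p \<sigma>)"
      by (intro nn_integral_cong) (simp add: sum_distrib_left exp_sum prod_ennreal mult_ac flip: sum_negf)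
    also have "\<dots> = (\<Prod>j<p. \<integral>\<^sup>+x. ennreal (exp (- t * w j * x)) \<partial>normal_measure \<sigma>)"
      unfolding gaussian_vector_def by (rule product_nn_integral_prod) auto
    also have "\<dots> = (\<Prod>j<p. ennreal (exp ((- t * w j)\<^sup>2 * \<sigma>\<^sup>2 / 2)))"
      by (subst normal_exp_linear[OF \<open>0 < \<sigma>\<close>]) simp
    also have "\<dots> = ennreal (exp (t\<^sup>2 * \<sigma>\<^sup>2 * W\<^sup>2 / 2))"
      by (simp add: prod_ennreal W2 power_mult_distrib sum_distrib_left sum_divide_distrib mult_ac flip: exp_sum)
    also have "t\<^sup>2 * \<sigma>\<^sup>2 * W\<^sup>2 = \<tau>\<^sup>2"
      using W \<open>0 < \<sigma>\<close> by (simp add: t_def power_mult_distrib power_divide)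
    finally have "P.prob {x\<in>space (gaussian_vector p \<sigma>). \<tau>\<^sup>2 < - t * (\<Sum>j<p. x j * w j)} \<le> exp (\<tau>\<^sup>2 / 2) * exp (- \<tau>\<^sup>2)"
      by (intro P.exp_markov) auto
    also have "\<dots> = exp (- (\<tau>\<^sup>2 / 2))" by (simp flip: exp_add)
    finally have *: "P.prob {x\<in>space (gaussian_vector p \<sigma>). \<tau>\<^sup>2 < - t * (\<Sum>j<p. x j * w j)} \<le> exp (- (\<tau>\<^sup>2 / 2))" .
    show ?thesis
    proof (cases "\<tau> = 0")
      case True
      then show ?thesis by simp
    next
      case False
      with \<open>0 \<le> \<tau>\<close> W \<open>0 < \<sigma>\<close> have t: "0 < t" by (simp add: t_def)
      have "{x\<in>space (gaussian_vector p \<sigma>). (\<Sum>j<p. x j * w j) < - \<sigma> * W * \<tau>}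
        \<subseteq> {x\<in>space (gaussian_vector p \<sigma>). \<tau>\<^sup>2 < - t * (\<Sum>j<p. x j * w j)}"
      proof safe
        fix x assume "(\<Sum>j<p. x j * w j) < - \<sigma> * W * \<tau>"
        then have "t * (\<Sum>j<p. x j * w j) < t * (- \<sigma> * W * \<tau>)"
          using t by (rule mult_strict_left_mono)
        also have "t * (- \<sigma> * W * \<tau>) = - \<tau>\<^sup>2"
          using W \<open>0 < \<sigma>\<close> by (simp add: t_def power2_eq_square)
        finally show "\<tau>\<^sup>2 < - t * (\<Sum>j<p. x j * w j)" by simp
      qed
      then have "P.prob {x\<in>space (gaussian_vector p \<sigma>). (\<Sum>j<p. x j * w j) < - \<sigma> * W * \<tau>}
        \<le> P.prob {x\<in>space (gaussian_vector p \<sigma>). \<tau>\<^sup>2 < - t * (\<Sum>j<p. x j * w j)}"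
        by (intro P.finite_measure_mono) auto
      then show ?thesis using * unfolding W_def by linarith
    qed
  qed
qed

text \<open>Conditional form of the preceding bound: with the other vectors fixed,
  \<open>F x\<close> is a constant vector because it ignores coordinate \<open>i\<close>. The
  threshold scales with the norm of \<open>F x\<close>, so the bound is the same for all values of
  the other vectors and survives integration over them.\<close>

lemma PiM_gaussian_vector_inner_tail:
  assumes "0 < \<sigma>" "0 \<le> \<tau>" "finite I" "i \<in> I"
    and F: "\<And>j. j < p \<Longrightarrow> (\<lambda>x. F x j) \<in> borel_measurable (\<Pi>\<^sub>M i\<in>I. gaussian_vector p \<sigma>)"
    and indep: "\<And>x y j. j < p \<Longrightarrow> F (x(i := y)) j = F x j"
  shows "measure (\<Pi>\<^sub>M i\<in>I. gaussian_vector p \<sigma>)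
      {x\<in>space (\<Pi>\<^sub>M i\<in>I. gaussian_vector p \<sigma>).
        (\<Sum>j<p. x i j * F x j) < - \<sigma> * sqrt (\<Sum>j<p. (F x j)\<^sup>2) * \<tau>}
    \<le> exp (- (\<tau>\<^sup>2 / 2))"
proof -
  let ?N = "gaussian_vector p \<sigma>"
  interpret N: prob_space ?N
    using isotropic_gaussian_gaussian_vector[OF \<open>0 < \<sigma>\<close>] by (auto simp: isotropic_gaussian_def)
  interpret product_sigma_finite "\<lambda>_. ?N" by unfold_locales
  interpret P: prob_space "\<Pi>\<^sub>M i\<in>I. ?N" by (rule prob_space_PiM) unfold_locales
  interpret Q: prob_space "\<Pi>\<^sub>M i\<in>I - {i}. ?N" by (rule prob_space_PiM) unfold_locales
  have coord[measurable]: "(\<lambda>x. x j) \<in> borel_measurable ?N" if "j < p" for j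
    unfolding gaussian_vector_def
    using measurable_component_singleton[of j "{..<p}" "\<lambda>_. normal_measure \<sigma>"] that by simp
  have coord'[measurable]: "(\<lambda>x. x i j) \<in> borel_measurable (\<Pi>\<^sub>M i\<in>I. ?N)" if "j < p" for j
    using measurable_compose[OF measurable_component_singleton[OF \<open>i \<in> I\<close>] coord[OF that]] .
  note F[measurable]
  define S where "S = {x\<in>space (\<Pi>\<^sub>M i\<in>I. ?N).
        (\<Sum>j<p. x i j * F x j) < - \<sigma> * sqrt (\<Sum>j<p. (F x j)\<^sup>2) * \<tau>}"
  have S: "S \<in> sets (\<Pi>\<^sub>M i\<in>I. ?N)" unfolding S_def by measurable
  have I: "insert i (I - {i}) = I" using \<open>i \<in> I\<close> by auto
  have "emeasure (\<Pi>\<^sub>M i\<in>I. ?N) S = (\<integral>\<^sup>+x. indicator S x \<partial>(\<Pi>\<^sub>M i\<in>insert i (I - {i}). ?N))"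
    unfolding I using S by simp
  also have "\<dots> = (\<integral>\<^sup>+x. (\<integral>\<^sup>+y. indicator S (x(i := y)) \<partial>?N) \<partial>(\<Pi>\<^sub>M i\<in>I - {i}. ?N))"
    by (rule product_nn_integral_insert) (use \<open>finite I\<close> S in \<open>auto simp: I simp del: insert_Diff_single\<close>)
  also have "\<dots> \<le> (\<integral>\<^sup>+x. ennreal (exp (- (\<tau>\<^sup>2 / 2))) \<partial>(\<Pi>\<^sub>M i\<in>I - {i}. ?N))"
  proof (rule nn_integral_mono)
    fix x assume x: "x \<in> space (\<Pi>\<^sub>M i\<in>I - {i}. ?N)"
    have "(\<integral>\<^sup>+y. indicator S (x(i := y)) \<partial>?N) = (\<integral>\<^sup>+y. indicator
        {y\<in>space ?N. (\<Sum>j<p. y j * F x j) < - \<sigma> * sqrt (\<Sum>j<p. (F x j)\<^sup>2) * \<tau>} y \<partial>?N)"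
    proof (intro nn_integral_cong)
      fix y assume y: "y \<in> space ?N"
      have "x(i := y) \<in> space (\<Pi>\<^sub>M i\<in>I. ?N)"
        using x y \<open>i \<in> I\<close> by (auto simp: space_PiM PiE_iff extensional_def)
      then have "x(i := y) \<in> S \<longleftrightarrow> (\<Sum>j<p. y j * F x j) < - \<sigma> * sqrt (\<Sum>j<p. (F x j)\<^sup>2) * \<tau>"
        by (simp add: S_def indep)
      then show "(indicator S (x(i := y)) :: ennreal) = indicator
        {y\<in>space ?N. (\<Sum>j<p. y j * F x j) < - \<sigma> * sqrt (\<Sum>j<p. (F x j)\<^sup>2) * \<tau>} y"
        using y by (auto simp: indicator_def)
    qed
    also have "\<dots> = emeasure ?N {y\<in>space ?N. (\<Sum>j<p. y j * F x j) < - \<sigma> * sqrt (\<Sum>j<p. (F x j)\<^sup>2) * \<tau>}"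
      by (intro nn_integral_indicator) measurable
    also have "\<dots> \<le> ennreal (exp (- (\<tau>\<^sup>2 / 2)))"
      using gaussian_vector_inner_tail[OF assms(1,2), of p "F x"]
      by (simp add: N.emeasure_eq_measure)
    finally show "(\<integral>\<^sup>+y. indicator S (x(i := y)) \<partial>?N) \<le> ennreal (exp (- (\<tau>\<^sup>2 / 2)))" .
  qed
  also have "\<dots> = ennreal (exp (- (\<tau>\<^sup>2 / 2)))"
    by (simp add: Q.emeasure_space_1)
  finally show ?thesis by (simp add: S_def P.emeasure_eq_measure)
qed

section \<open>Uniform concentration of Gram matrices\<close>

text \<open>The bilinear form of a Gram matrix minus \<open>p * s\<close> times the identity, which
  is its mean when all coordinates are independent with mean 0 and variance
  \<open>s\<close>.\<close>

definition gram_dev :: "nat \<Rightarrow> real \<Rightarrow> 'i set \<Rightarrow> ('i \<Rightarrow> nat \<Rightarrow> real) \<Rightarrow> ('i \<Rightarrow> real) \<Rightarrow> ('i \<Rightarrow> real) \<Rightarrow> real" where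
  "gram_dev p s J x u v =
     (\<Sum>a<p. (\<Sum>i\<in>J. u i * x i a) * (\<Sum>i\<in>J. v i * x i a)) - real p * s * (\<Sum>i\<in>J. u i * v i)"

lemma gram_dev_sym: "gram_dev p s J x u v = gram_dev p s J x v u"
  by (simp add: gram_dev_def mult.commute)

text \<open>Displays the coefficients of \<open>v\<close>, whose signs decide how \<open>v\<close>
  is rounded.\<close>

lemma gram_dev_linear:
  "gram_dev p s J x u v = (\<Sum>i\<in>J. ((\<Sum>a<p. (\<Sum>k\<in>J. u k * x k a) * x i a) - real p * s * u i) * v i)"
  unfolding gram_dev_def left_diff_distrib sum_subtractf sum_distrib_left sum_distrib_right
  by (subst sum.swap) (simp add: mult_ac)

lemma gram_dev_scale:
  "gram_dev p s J x (\<lambda>i. c * u i) (\<lambda>i. d * v i) = c * d * gram_dev p s J x u v"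
proof -
  have "(\<Sum>i\<in>J. c * u i * f i) = c * (\<Sum>i\<in>J. u i * f i)" for c u and f :: "'a \<Rightarrow> real"
    by (simp add: sum_distrib_left mult.assoc)
  moreover have "(\<Sum>i\<in>J. c * u i * (d * v i)) = c * d * (\<Sum>i\<in>J. u i * v i)"
    by (simp add: sum_distrib_left mult_ac)
  moreover have "(\<Sum>a<p. c * f a * (d * g a)) = c * d * (\<Sum>a<p. f a * g a)" for f g
    by (simp add: sum_distrib_left mult_ac)
  ultimately show ?thesis unfolding gram_dev_def by (simp add: right_diff_distrib)
qed

text \<open>Tail bounds are available for squared norms only, that is for equal arguments.\<close>

lemma gram_dev_polarize:
  "4 * gram_dev p s J x u v = gram_dev p s J x (\<lambda>i. u i + v i) (\<lambda>i. u i + v i)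
     - gram_dev p s J x (\<lambda>i. u i - v i) (\<lambda>i. u i - v i)"
proof -
  have "(\<Sum>a<p. (\<Sum>i\<in>J. (u i + v i) * x i a) * (\<Sum>i\<in>J. (u i + v i) * x i a))
     - (\<Sum>a<p. (\<Sum>i\<in>J. (u i - v i) * x i a) * (\<Sum>i\<in>J. (u i - v i) * x i a))
     = (\<Sum>a<p. 4 * ((\<Sum>i\<in>J. u i * x i a) * (\<Sum>i\<in>J. v i * x i a)))"
    unfolding sum_subtractf[symmetric]
    by (intro sum.cong refl) (simp add: algebra_simps sum.distrib sum_subtractf)
  moreover have "(\<Sum>i\<in>J. (u i + v i) * (u i + v i)) - (\<Sum>i\<in>J. (u i - v i) * (u i - v i))
     = (\<Sum>i\<in>J. 4 * (u i * v i))"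
    unfolding sum_subtractf[symmetric] by (intro sum.cong refl) (simp add: algebra_simps)
  moreover have "4 * (C - k * R) = A - k * P - (B - k * Q)"
    if "A - B = 4 * C" "P - Q = 4 * R" for A B C P Q R k :: real
  proof -
    have "A - k * P - (B - k * Q) = (A - B) - k * (P - Q)" by (simp add: algebra_simps)
    then show ?thesis unfolding that by (simp add: algebra_simps)
  qed
  ultimately show ?thesis
    unfolding gram_dev_def sum_distrib_left[symmetric] by blast
qed

text \<open>Rounding up where the coefficient is nonnegative and down elsewhere cannot decrease a
  linear form.\<close>

lemma linear_le_rounding:
  fixes c v :: "'i \<Rightarrow> real"
  obtains z :: "'i \<Rightarrow> int" where "\<And>i. \<bar>real_of_int (z i)\<bar> \<le> \<bar>v i\<bar> + 1"
    "(\<Sum>i\<in>J. c i * v i) \<le> (\<Sum>i\<in>J. c i * real_of_int (z i))"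
proof
  define z where "z i = (if 0 \<le> c i then \<lceil>v i\<rceil> else \<lfloor>v i\<rfloor>)" for i
  show "\<bar>real_of_int (z i)\<bar> \<le> \<bar>v i\<bar> + 1" for i
    unfolding z_def by (simp; linarith)
  have "c i * v i \<le> c i * real_of_int (z i)" for i
    unfolding z_def by (auto intro: mult_left_mono mult_left_mono_neg)
  then show "(\<Sum>i\<in>J. c i * v i) \<le> (\<Sum>i\<in>J. c i * real_of_int (z i))"
    by (rule sum_mono)
qed

text \<open>The form is linear in each argument, so scaled to the ball of radius \<open>sqrt (card J)\<close> its arguments
  can be rounded to integer points one after the other without decreasing it; polarization then leaves only
  diagonal values. No net of the sphere is needed.\<close>

lemma gram_dev_bound_from_lattice:
  fixes J :: "'i set" and u v :: "'i \<Rightarrow> real"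
  assumes "finite J" "J \<noteq> {}" "0 \<le> b"
    and lattice: "\<And>w :: 'i \<Rightarrow> int. (\<Sum>i\<in>J. (w i)\<^sup>2) \<le> 16 * int (card J) \<Longrightarrow>
      \<bar>gram_dev p s J x (\<lambda>i. of_int (w i)) (\<lambda>i. of_int (w i))\<bar> \<le> b * of_int (\<Sum>i\<in>J. (w i)\<^sup>2)"
  shows "\<bar>gram_dev p s J x u v\<bar> \<le> 4 * b * sqrt (\<Sum>i\<in>J. (u i)\<^sup>2) * sqrt (\<Sum>i\<in>J. (v i)\<^sup>2)"
proof -
  define N where "N = real (card J)"
  have N: "0 < N" using assms by (simp add: N_def card_gt_0_iff)
  have ball: "gram_dev p s J x u v \<le> 4 * b * N"
    if uv: "(\<Sum>i\<in>J. (u i)\<^sup>2) \<le> N" "(\<Sum>i\<in>J. (v i)\<^sup>2) \<le> N" for u v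
  proof -
    \<comment> \<open>Rounding at most doubles the radius of the ball, because
      \<open>(\<bar>v i\<bar> + 1)\<^sup>2 \<le> 2 * (v i)\<^sup>2 + 2\<close>.\<close>
    have sq: "(\<Sum>i\<in>J. (real_of_int (z i))\<^sup>2) \<le> 4 * N"
      if "\<And>i. \<bar>real_of_int (z i)\<bar> \<le> \<bar>v i\<bar> + 1" "(\<Sum>i\<in>J. (v i)\<^sup>2) \<le> N" for v and z :: "'i \<Rightarrow> int"
    proof -
      have "(real_of_int (z i))\<^sup>2 \<le> 2 * (v i)\<^sup>2 + 2" for i
      proof -
        have "\<bar>real_of_int (z i)\<bar>\<^sup>2 \<le> (\<bar>v i\<bar> + 1)\<^sup>2" by (intro power_mono that) simp
        also have "\<dots> \<le> 2 * (v i)\<^sup>2 + 2"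
          using zero_le_power2[of "\<bar>v i\<bar> - 1"] by (simp add: power2_sum power2_diff)
        finally show ?thesis by simp
      qed
      then have "(\<Sum>i\<in>J. (real_of_int (z i))\<^sup>2) \<le> (\<Sum>i\<in>J. 2 * (v i)\<^sup>2 + 2)" by (intro sum_mono)
      also have "\<dots> = 2 * (\<Sum>i\<in>J. (v i)\<^sup>2) + 2 * N" by (simp add: sum.distrib sum_distrib_left N_def)
      finally show ?thesis using that(2) by linarith
    qed
    obtain z where z: "\<And>i. \<bar>real_of_int (z i)\<bar> \<le> \<bar>v i\<bar> + 1"
      "gram_dev p s J x u v \<le> gram_dev p s J x u (\<lambda>i. of_int (z i))"
      using linear_le_rounding[where v=v and J=J and
          c="\<lambda>i. (\<Sum>a<p. (\<Sum>k\<in>J. u k * x k a) * x i a) - real p * s * u i"]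
      unfolding gram_dev_linear by blast
    obtain y where y: "\<And>i. \<bar>real_of_int (y i)\<bar> \<le> \<bar>u i\<bar> + 1"
      "gram_dev p s J x (\<lambda>i. of_int (z i)) u \<le> gram_dev p s J x (\<lambda>i. of_int (z i)) (\<lambda>i. of_int (y i))"
      using linear_le_rounding[where v=u and J=J and
          c="\<lambda>i. (\<Sum>a<p. (\<Sum>k\<in>J. of_int (z k) * x k a) * x i a) - real p * s * of_int (z i)"]
      unfolding gram_dev_linear by blast
    have zN: "(\<Sum>i\<in>J. (real_of_int (z i))\<^sup>2) \<le> 4 * N" using sq[OF z(1) uv(2)] .
    have yN: "(\<Sum>i\<in>J. (real_of_int (y i))\<^sup>2) \<le> 4 * N" using sq[OF y(1) uv(1)] .
    \<comment> \<open>By the parallelogram law the squared norms of sum and difference add up to at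
      most \<open>16 * N\<close>. This admits each of them to the hypothesis \<open>lattice\<close>
      and bounds both error terms together.\<close>
    have par: "(\<Sum>i\<in>J. (real_of_int (z i + y i))\<^sup>2) + (\<Sum>i\<in>J. (real_of_int (z i - y i))\<^sup>2)
        = 2 * (\<Sum>i\<in>J. (real_of_int (z i))\<^sup>2) + 2 * (\<Sum>i\<in>J. (real_of_int (y i))\<^sup>2)"
      unfolding sum_distrib_left sum.distrib[symmetric]
      by (intro sum.cong refl) (simp add: power2_sum power2_diff)
    have nn: "0 \<le> (\<Sum>i\<in>J. (real_of_int (z i + y i))\<^sup>2)" "0 \<le> (\<Sum>i\<in>J. (real_of_int (z i - y i))\<^sup>2)"
      by (simp_all add: sum_nonneg)
    have le16: "(\<Sum>i\<in>J. (w i)\<^sup>2) \<le> 16 * int (card J)" if "(\<Sum>i\<in>J. (real_of_int (w i))\<^sup>2) \<le> 16 * N" for w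
    proof -
      have "real_of_int (\<Sum>i\<in>J. (w i)\<^sup>2) \<le> real_of_int (16 * int (card J))"
        using that by (simp add: N_def)
      then show ?thesis by (simp only: of_int_le_iff)
    qed
    have "4 * gram_dev p s J x u v \<le> 4 * gram_dev p s J x (\<lambda>i. of_int (z i)) (\<lambda>i. of_int (y i))"
      using z(2) y(2) gram_dev_sym[of p s J x u "\<lambda>i. of_int (z i)"] by simp
    also have "\<dots> = gram_dev p s J x (\<lambda>i. of_int (z i + y i)) (\<lambda>i. of_int (z i + y i))
     - gram_dev p s J x (\<lambda>i. of_int (z i - y i)) (\<lambda>i. of_int (z i - y i))"
      by (simp add: gram_dev_polarize)
    also have "\<dots> \<le> b * of_int (\<Sum>i\<in>J. (z i + y i)\<^sup>2) + b * of_int (\<Sum>i\<in>J. (z i - y i)\<^sup>2)"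
    proof -
      have "(\<Sum>i\<in>J. (real_of_int (z i + y i))\<^sup>2) \<le> 16 * N"
        "(\<Sum>i\<in>J. (real_of_int (z i - y i))\<^sup>2) \<le> 16 * N"
        using par nn zN yN by linarith+
      from this[THEN le16, THEN lattice] show ?thesis by linarith
    qed
    also have "\<dots> = b * ((\<Sum>i\<in>J. (real_of_int (z i + y i))\<^sup>2) + (\<Sum>i\<in>J. (real_of_int (z i - y i))\<^sup>2))"
      by (simp add: distrib_left)
    also have "\<dots> \<le> b * (16 * N)"
      unfolding par using zN yN \<open>0 \<le> b\<close> by (intro mult_left_mono) linarith+
    finally show ?thesis by (simp add: mult_ac)
  qed
  define U where "U = sqrt (\<Sum>i\<in>J. (u i)\<^sup>2)"
  define V where "V = sqrt (\<Sum>i\<in>J. (v i)\<^sup>2)"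
  have UV: "0 \<le> U" "0 \<le> V" "U\<^sup>2 = (\<Sum>i\<in>J. (u i)\<^sup>2)" "V\<^sup>2 = (\<Sum>i\<in>J. (v i)\<^sup>2)"
    by (simp_all add: U_def V_def sum_nonneg)
  show ?thesis
  proof (cases "U = 0 \<or> V = 0")
    case True
    then have "(\<forall>i\<in>J. u i = 0) \<or> (\<forall>i\<in>J. v i = 0)"
      using UV(3,4) \<open>finite J\<close> by (elim disjE) (simp_all add: sum_nonneg_eq_0_iff)
    then have "gram_dev p s J x u v = 0" by (auto simp: gram_dev_def)
    then show ?thesis using UV \<open>0 \<le> b\<close> by (simp flip: U_def V_def)
  next
    case False
    with UV have U: "0 < U" and V: "0 < V" by auto
    \<comment> \<open>The two signs of \<open>\<epsilon>\<close> give the two halves of the absolute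
      value; both arguments are scaled to norm \<open>sqrt N\<close>.\<close>
    have side: "\<epsilon> * gram_dev p s J x u v \<le> 4 * b * U * V" if "\<epsilon>\<^sup>2 = 1" for \<epsilon>
    proof -
      have "gram_dev p s J x (\<lambda>i. \<epsilon> * sqrt N / U * u i) (\<lambda>i. sqrt N / V * v i) \<le> 4 * b * N"
      proof (rule ball)
        have "(\<Sum>i\<in>J. (\<epsilon> * sqrt N / U * u i)\<^sup>2) = N / U\<^sup>2 * (\<Sum>i\<in>J. (u i)\<^sup>2)"
          unfolding sum_distrib_left using N that by (simp add: power_mult_distrib power_divide)
        then show "(\<Sum>i\<in>J. (\<epsilon> * sqrt N / U * u i)\<^sup>2) \<le> N"
          using U by (simp flip: UV(3))
        have "(\<Sum>i\<in>J. (sqrt N / V * v i)\<^sup>2) = N / V\<^sup>2 * (\<Sum>i\<in>J. (v i)\<^sup>2)"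
          unfolding sum_distrib_left using N by (simp add: power_mult_distrib power_divide)
        then show "(\<Sum>i\<in>J. (sqrt N / V * v i)\<^sup>2) \<le> N"
          using V by (simp flip: UV(4))
      qed
      then have "N * (\<epsilon> * gram_dev p s J x u v) / (U * V) \<le> 4 * b * N"
        using N unfolding gram_dev_scale by (simp add: mult_ac)
      then have "N * (\<epsilon> * gram_dev p s J x u v) \<le> N * (4 * b * U * V)"
        using U V by (simp add: field_simps)
      then show ?thesis using N by (simp only: mult_le_cancel_left_pos)
    qed
    show ?thesis using side[of 1] side[of "-1"] by (simp add: abs_le_iff flip: U_def V_def)
  qed
qed

section \<open>Lattice points in a ball and the union bound over them\<close>

lemma sum_half_powers_le: "(\<Sum>z\<in>{- int M..int M}. (1 / 2 :: real) ^ nat \<bar>z\<bar>) \<le> 3"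
proof -
  have "(\<Sum>z\<in>{- int M..int M}. (1 / 2 :: real) ^ nat \<bar>z\<bar>) = 3 - 2 * (1 / 2) ^ M"
  proof (induction M)
    case (Suc M)
    have "{- int (Suc M)..int (Suc M)} = insert (int (Suc M)) (insert (- int (Suc M)) {- int M..int M})"
      by auto
    moreover have "nat (1 + int M) = Suc M" "nat (int M + 1) = Suc M" by linarith+
    ultimately show ?case using Suc by simp
  qed simp
  then show ?thesis by simp
qed

text \<open>Integers satisfy \<open>\<bar>z\<bar> \<le> z\<^sup>2\<close>, so a point of the ball
  has l1 norm at most \<open>16 * card J\<close>. The weight 2^(16 |J|) times the product of the
  2^(-|w i|) is therefore at least 1 on the ball, and over the whole box it factorizes into one
  geometric sum per coordinate.\<close>

lemma card_lattice_points_le: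
  assumes "finite J"
  shows "real (card {w \<in> J \<rightarrow>\<^sub>E {- int M..int M}. (\<Sum>i\<in>J. (w i)\<^sup>2) \<le> 16 * int (card J)})
    \<le> exp (18 * real (card J))"
proof -
  define W where "W = {w \<in> J \<rightarrow>\<^sub>E {- int M..int M}. (\<Sum>i\<in>J. (w i)\<^sup>2) \<le> 16 * int (card J)}"
  have fin: "finite (J \<rightarrow>\<^sub>E {- int M..int M})" using assms by (intro finite_PiE) auto
  have "real (card W) = (\<Sum>w\<in>W. 1)" by simp
  also have "\<dots> \<le> (\<Sum>w\<in>W. 2 ^ (16 * card J) * (\<Prod>i\<in>J. (1 / 2) ^ nat \<bar>w i\<bar>))"
  proof (rule sum_mono)
    fix w assume w: "w \<in> W"
    have "\<bar>z\<bar> \<le> z\<^sup>2" for z :: int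
      using self_le_power[of "\<bar>z\<bar>" 2] by (cases "z = 0") auto
    then have "(\<Sum>i\<in>J. \<bar>w i\<bar>) \<le> (\<Sum>i\<in>J. (w i)\<^sup>2)" by (intro sum_mono)
    also have "\<dots> \<le> 16 * int (card J)" using w by (simp add: W_def)
    also have "(\<Sum>i\<in>J. \<bar>w i\<bar>) = int (\<Sum>i\<in>J. nat \<bar>w i\<bar>)" by simp
    finally have "(\<Sum>i\<in>J. nat \<bar>w i\<bar>) \<le> 16 * card J" by linarith
    then have "(1 / 2 :: real) ^ (16 * card J) \<le> (1 / 2) ^ (\<Sum>i\<in>J. nat \<bar>w i\<bar>)"
      by (intro power_decreasing) auto
    then have "2 ^ (16 * card J) * (1 / 2 :: real) ^ (16 * card J)
        \<le> 2 ^ (16 * card J) * (1 / 2) ^ (\<Sum>i\<in>J. nat \<bar>w i\<bar>)"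
      by (intro mult_left_mono) auto
    also have "2 ^ (16 * card J) * (1 / 2 :: real) ^ (16 * card J) = 1"
      by (simp flip: power_mult_distrib)
    finally show "1 \<le> 2 ^ (16 * card J) * (\<Prod>i\<in>J. (1 / 2 :: real) ^ nat \<bar>w i\<bar>)"
      by (simp add: power_sum)
  qed
  also have "\<dots> \<le> (\<Sum>w\<in>J \<rightarrow>\<^sub>E {- int M..int M}. 2 ^ (16 * card J) * (\<Prod>i\<in>J. (1 / 2) ^ nat \<bar>w i\<bar>))"
    by (intro sum_mono2 fin) (auto simp: W_def intro!: mult_nonneg_nonneg prod_nonneg)
  also have "\<dots> = 2 ^ (16 * card J) * (\<Prod>i\<in>J. \<Sum>z\<in>{- int M..int M}. (1 / 2) ^ nat \<bar>z\<bar>)"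
    using assms by (subst prod_sum_PiE) (auto simp: sum_distrib_left)
  also have "\<dots> \<le> 2 ^ (16 * card J) * (\<Prod>i\<in>J. 3)"
    by (intro mult_left_mono prod_mono conjI sum_half_powers_le sum_nonneg) auto
  also have "\<dots> = (2 ^ 16 * 3) ^ card J" by (simp add: power_mult flip: power_mult_distrib)
  also have "\<dots> \<le> (exp 18) ^ card J"
  proof (rule power_mono)
    \<comment> \<open>2^16 * 3 is below 2^18, hence below e^18.\<close>
    have "(2::real) \<le> exp 1" using exp_ge_add_one_self[of 1] by simp
    then have "2 ^ 18 \<le> exp (1::real) ^ 18" by (intro power_mono) auto
    then show "2 ^ 16 * 3 \<le> exp (18 :: real)" by (simp flip: exp_of_nat_mult)
  qed simp
  also have "\<dots> = exp (18 * real (card J))" by (simp add: mult.commute flip: exp_of_nat_mult)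
  finally show ?thesis unfolding W_def .
qed

text \<open>The constant is 4 * 5 * 19: rounding with polarization, the chi-square tail, and the
  level at which the union bound is taken.\<close>

definition gram_concentrated :: "nat \<Rightarrow> real \<Rightarrow> 'i set \<Rightarrow> ('i \<Rightarrow> nat \<Rightarrow> real) \<Rightarrow> bool" where
  "gram_concentrated p \<sigma> J x \<longleftrightarrow> (\<forall>u v.
      \<bar>gram_dev p (\<sigma>\<^sup>2) J x u v\<bar> \<le> 380 * \<sigma>\<^sup>2 * (real (card J) + sqrt (real p * real (card J))) *
        sqrt (\<Sum>i\<in>J. (u i)\<^sup>2) * sqrt (\<Sum>i\<in>J. (v i)\<^sup>2))"

text \<open>With N = |J| there are at most e^(18 N) lattice points, and each fails with probability
  at most 2 e^(-19 N). The conclusion speaks of an exceptional set because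
  \<open>gram_concentrated\<close> quantifies over uncountably many vectors, whereas the finite
  union \<open>B\<close> is visibly measurable.\<close>

lemma gram_concentrated_whp:
  assumes "0 < \<sigma>" "finite I" "J \<subseteq> I" "J \<noteq> {}"
  obtains B where "B \<in> sets (\<Pi>\<^sub>M i\<in>I. gaussian_vector p \<sigma>)"
    "measure (\<Pi>\<^sub>M i\<in>I. gaussian_vector p \<sigma>) B \<le> 2 * exp (- real (card J))"
    "\<And>x. x \<in> space (\<Pi>\<^sub>M i\<in>I. gaussian_vector p \<sigma>) - B \<Longrightarrow> gram_concentrated p \<sigma> J x"
proof
  let ?P = "\<Pi>\<^sub>M i\<in>I. gaussian_vector p \<sigma>"
  define N where "N = card J"
  have J: "finite J" using assms finite_subset by blast
  have N: "0 < N" using assms J by (simp add: N_def card_gt_0_iff)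
  define t where "t = 19 * real N"
  define b where "b = 5 * \<sigma>\<^sup>2 * (t + sqrt (real p * t))"
  \<comment> \<open>The box makes the set finite and loses no point of the ball, again by
    \<open>\<bar>z\<bar> \<le> z\<^sup>2\<close>.\<close>
  define W where "W = {w \<in> J \<rightarrow>\<^sub>E {- int (16 * N)..int (16 * N)}. (\<Sum>i\<in>J. (w i)\<^sup>2) \<le> 16 * int (card J)}"
  define E where "E w = {x\<in>space ?P. b * (\<Sum>i\<in>J. (real_of_int (w i))\<^sup>2) <
      \<bar>gram_dev p (\<sigma>\<^sup>2) J x (\<lambda>i. of_int (w i)) (\<lambda>i. of_int (w i))\<bar>}" for w :: "'a \<Rightarrow> int"
  define B where "B = (\<Union>w\<in>W. E w)"
  have "prob_space (gaussian_vector p \<sigma>)"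
    using isotropic_gaussian_gaussian_vector[OF \<open>0 < \<sigma>\<close>] by (auto simp: isotropic_gaussian_def)
  then interpret P: prob_space ?P by (rule prob_space_PiM)
  have W: "finite W"
  proof (rule finite_subset)
    show "W \<subseteq> J \<rightarrow>\<^sub>E {- int (16 * N)..int (16 * N)}" by (auto simp: W_def)
  qed (use J in \<open>auto intro: finite_PiE\<close>)
  have b: "0 \<le> b" by (simp add: b_def t_def)
  have coord: "(\<lambda>x. x j) \<in> borel_measurable (gaussian_vector p \<sigma>)" if "j < p" for j
    using isotropic_gaussian_gaussian_vector[OF \<open>0 < \<sigma>\<close>, of p] that by (auto simp: isotropic_gaussian_def)
  have [measurable]: "(\<lambda>x. x i j) \<in> borel_measurable ?P" if "i \<in> J" "j < p" for i j
    using that assms(3) coord by (intro measurable_compose[OF measurable_component_singleton]) auto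
  have E: "E w \<in> sets ?P" for w
    unfolding E_def gram_dev_def by measurable
  show "B \<in> sets ?P" unfolding B_def using W E by auto
  have EP: "P.prob (E w) \<le> 2 * exp (- t)" for w
  \<comment> \<open>The tail bound needs positive variance; for the zero vector the event is
    empty.\<close>
  proof (cases "\<forall>i\<in>J. w i = 0")
    case True
    then have "E w = {}" by (auto simp: E_def gram_dev_def)
    then show ?thesis by simp
  next
    case False
    \<comment> \<open>Extension by 0 turns a sum over \<open>J\<close> into one over the index set
      of the product measure.\<close>
    define w' where "w' i = (if i \<in> J then real_of_int (w i) else 0)" for i
    define s where "s = \<sigma>\<^sup>2 * (\<Sum>i\<in>I. (w' i)\<^sup>2)"
    have sums: "(\<Sum>i\<in>I. w' i * f i) = (\<Sum>i\<in>J. of_int (w i) * f i)" for f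
      using assms by (intro sum.mono_neutral_cong_right) (auto simp: w'_def)
    have s: "s = \<sigma>\<^sup>2 * (\<Sum>i\<in>J. (real_of_int (w i))\<^sup>2)"
    proof -
      have "(\<Sum>i\<in>I. (w' i)\<^sup>2) = (\<Sum>i\<in>J. of_int (w i) * w' i)"
        unfolding power2_eq_square by (rule sums)
      also have "\<dots> = (\<Sum>i\<in>J. (real_of_int (w i))\<^sup>2)"
        by (intro sum.cong) (auto simp: w'_def power2_eq_square)
      finally show ?thesis by (simp add: s_def)
    qed
    from False obtain i where "i \<in> J" "w i \<noteq> 0" by blast
    then have "0 < (\<Sum>i\<in>J. (real_of_int (w i))\<^sup>2)"
      using J by (intro sum_pos2[of J i]) auto
    then have "0 < s" using \<open>0 < \<sigma>\<close> by (simp add: s)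
    have iso: "isotropic_gaussian ?P p (\<lambda>x j. \<Sum>i\<in>I. w' i * x i j) s"
      unfolding s_def using isotropic_gaussian_gaussian_vector[OF \<open>0 < \<sigma>\<close>] assms(2)
      by (intro isotropic_gaussian_sum)
    have "P.prob {x\<in>space ?P. 5 * s * (t + sqrt (real p * t))
        < \<bar>(\<Sum>j<p. (\<Sum>i\<in>I. w' i * x i j)\<^sup>2) - real p * s\<bar>} \<le> 2 * exp (- t)"
      using isotropic_gaussian_sq_norm_tail[OF iso \<open>0 < s\<close>, of t] N by (simp add: t_def)
    also have "{x\<in>space ?P. 5 * s * (t + sqrt (real p * t))
        < \<bar>(\<Sum>j<p. (\<Sum>i\<in>I. w' i * x i j)\<^sup>2) - real p * s\<bar>} = E w"
    proof -
      have "5 * s * (t + sqrt (real p * t)) = b * (\<Sum>i\<in>J. (real_of_int (w i))\<^sup>2)"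
        by (simp add: b_def s)
      moreover have "(\<Sum>j<p. (\<Sum>i\<in>I. w' i * x i j)\<^sup>2) - real p * s
          = gram_dev p (\<sigma>\<^sup>2) J x (\<lambda>i. of_int (w i)) (\<lambda>i. of_int (w i))" for x :: "'a \<Rightarrow> nat \<Rightarrow> real"
        unfolding sums gram_dev_def s by (simp add: power2_eq_square)
      ultimately show ?thesis unfolding E_def by simp
    qed
    finally show ?thesis .
  qed
  have "P.prob B \<le> (\<Sum>w\<in>W. P.prob (E w))"
    unfolding B_def using W E by (intro P.finite_measure_subadditive_finite) auto
  also have "\<dots> \<le> (\<Sum>w\<in>W. 2 * exp (- t))" by (intro sum_mono EP)
  also have "\<dots> = real (card W) * (2 * exp (- t))" by simp
  also have "\<dots> \<le> exp (18 * real N) * (2 * exp (- t))"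
    using card_lattice_points_le[OF J, of "16 * N"] by (intro mult_right_mono) (simp_all add: W_def N_def)
  also have "\<dots> = 2 * exp (- real (card J))"
    by (simp add: t_def N_def flip: exp_add)
  finally show "P.prob B \<le> 2 * exp (- real (card J))" .
  fix x assume x: "x \<in> space ?P - B"
  show "gram_concentrated p \<sigma> J x"
    unfolding gram_concentrated_def
  proof (intro allI)
    fix u v
    have "\<bar>gram_dev p (\<sigma>\<^sup>2) J x u v\<bar> \<le> 4 * b * sqrt (\<Sum>i\<in>J. (u i)\<^sup>2) * sqrt (\<Sum>i\<in>J. (v i)\<^sup>2)"
    proof (rule gram_dev_bound_from_lattice[OF J \<open>J \<noteq> {}\<close> b])
      fix w :: "'a \<Rightarrow> int" assume w: "(\<Sum>i\<in>J. (w i)\<^sup>2) \<le> 16 * int (card J)"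
      define w' where "w' = restrict w J"
      have "\<bar>w i\<bar> \<le> int (16 * N)" if "i \<in> J" for i
      proof -
        have "\<bar>w i\<bar> \<le> (w i)\<^sup>2" using self_le_power[of "\<bar>w i\<bar>" 2] by (cases "w i = 0") auto
        also have "\<dots> \<le> (\<Sum>i\<in>J. (w i)\<^sup>2)" using that J by (intro member_le_sum) auto
        finally show ?thesis using w by (simp add: N_def)
      qed
      then have "w i \<in> {- int (16 * N)..int (16 * N)}" if "i \<in> J" for i
        using that by (fastforce simp: abs_le_iff)
      then have "w' \<in> W" using w by (auto simp: W_def w'_def simp del: atLeastAtMost_iff)
      with x have "x \<notin> E w'" by (auto simp: B_def)
      with x show "\<bar>gram_dev p (\<sigma>\<^sup>2) J x (\<lambda>i. of_int (w i)) (\<lambda>i. of_int (w i))\<bar> \<le> b * of_int (\<Sum>i\<in>J. (w i)\<^sup>2)"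
        by (simp add: E_def gram_dev_def w'_def)
    qed
    also have "\<dots> \<le> (380 * \<sigma>\<^sup>2 * (real (card J) + sqrt (real p * real (card J)))) *
          sqrt (\<Sum>i\<in>J. (u i)\<^sup>2) * sqrt (\<Sum>i\<in>J. (v i)\<^sup>2)"
    proof (intro mult_right_mono)
      have "sqrt (real p * t) = sqrt 19 * sqrt (real p * real N)"
        by (simp add: t_def flip: real_sqrt_mult)
      also have "\<dots> \<le> 19 * sqrt (real p * real N)"
        by (intro mult_right_mono) (auto simp: real_le_lsqrt)
      finally have "t + sqrt (real p * t) \<le> 19 * (real N + sqrt (real p * real N))"
        by (simp add: t_def)
      then have "20 * \<sigma>\<^sup>2 * (t + sqrt (real p * t)) \<le> 20 * \<sigma>\<^sup>2 * (19 * (real N + sqrt (real p * real N)))"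
        by (intro mult_left_mono) auto
      then show "4 * b \<le> 380 * \<sigma>\<^sup>2 * (real (card J) + sqrt (real p * real (card J)))"
        by (simp add: b_def N_def algebra_simps)
    qed (simp_all add: sum_nonneg)
    finally show "\<bar>gram_dev p (\<sigma>\<^sup>2) J x u v\<bar> \<le> 380 * \<sigma>\<^sup>2 * (real (card J) + sqrt (real p * real (card J))) *
          sqrt (\<Sum>i\<in>J. (u i)\<^sup>2) * sqrt (\<Sum>i\<in>J. (v i)\<^sup>2)" .
  qed
qed

section \<open>Optimality from a dual certificate\<close>

text \<open>Cholesky factorization by induction: removing the index \<open>a\<close> leaves the
  Schur complement, which is again positive semidefinite. The factorization serves to pair two
  positive semidefinite matrices and to read \<open>Z\<close> as a Gram matrix of vectors.\<close>

lemma psd_gram_factorization: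
  fixes Z :: "'i \<Rightarrow> 'i \<Rightarrow> real"
  assumes "finite I" "\<And>i j. i \<in> I \<Longrightarrow> j \<in> I \<Longrightarrow> Z i j = Z j i"
    and "\<And>v. 0 \<le> (\<Sum>i\<in>I. \<Sum>j\<in>I. v i * Z i j * v j)"
  shows "\<exists>(R :: nat) y. \<forall>i\<in>I. \<forall>j\<in>I. Z i j = (\<Sum>r<R. y r i * y r j)"
  using assms
proof (induction I arbitrary: Z rule: finite_induct)
  case (insert a I)
  note fin = \<open>finite I\<close> and aI = \<open>a \<notin> I\<close>
  have quad: "(\<Sum>i\<in>insert a I. \<Sum>j\<in>insert a I. v i * Z i j * v j) =
      (v a)\<^sup>2 * Z a a + 2 * v a * (\<Sum>j\<in>I. Z a j * v j) + (\<Sum>i\<in>I. \<Sum>j\<in>I. v i * Z i j * v j)" for v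
  proof -
    have "(\<Sum>i\<in>I. v i * Z i a * v a) = v a * (\<Sum>j\<in>I. Z a j * v j)"
      unfolding sum_distrib_left using insert.prems(1) by (intro sum.cong) auto
    moreover have "(\<Sum>j\<in>I. v a * Z a j * v j) = v a * (\<Sum>j\<in>I. Z a j * v j)"
      unfolding sum_distrib_left by (intro sum.cong) auto
    ultimately show ?thesis
      using fin aI by (simp add: sum.distrib power2_eq_square)
  qed
  have nonneg: "0 \<le> (v a)\<^sup>2 * Z a a + 2 * v a * (\<Sum>j\<in>I. Z a j * v j) + (\<Sum>i\<in>I. \<Sum>j\<in>I. v i * Z i j * v j)" for v
    using insert.prems(2)[of v] unfolding quad .
  have Zaa: "0 \<le> Z a a"
  proof -
    have "(\<Sum>i\<in>I. f i * (if i = a then 1 else 0)) = 0" for f :: "'i \<Rightarrow> real"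
      using aI by (intro sum.neutral) auto
    moreover have "(\<Sum>i\<in>I. \<Sum>j\<in>I. (if i = a then 1 else 0) * Z i j * (if j = a then 1 else 0)) = 0"
      using aI by (intro sum.neutral ballI) auto
    ultimately show ?thesis
      using nonneg[of "\<lambda>i. if i = a then 1 else 0"] by simp
  qed
  \<comment> \<open>A zero diagonal entry forces a zero row: otherwise the vector \<open>v\<close>
    below, with \<open>t\<close> chosen for this purpose, gives the form the value -1.\<close>
  have row: "Z a j = 0" if "Z a a = 0" "j \<in> I" for j
  proof (rule ccontr)
    assume nz: "Z a j \<noteq> 0"
    define t where "t = - (Z j j + 1) / (2 * Z a j)"
    define v where "v i = (if i = a then t else if i = j then 1 else 0)" for i
    have "j \<noteq> a" using aI that by auto
    then have vI: "v i = (if i = j then 1 else 0)" if "i \<in> I" for i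
      using that aI by (auto simp: v_def)
    have sv: "(\<Sum>i\<in>I. f i * v i) = f j" for f
    proof -
      have "(\<Sum>i\<in>I. f i * v i) = (\<Sum>i\<in>I. if i = j then f i else 0)"
        by (intro sum.cong) (auto simp: vI)
      then show ?thesis using \<open>j \<in> I\<close> fin by simp
    qed
    have "(\<Sum>i\<in>I. Z a i * v i) = Z a j" by (rule sv)
    moreover have "(\<Sum>i\<in>I. \<Sum>k\<in>I. v i * Z i k * v k) = Z j j"
      unfolding sv using sv[of "\<lambda>i. Z i j"] by (simp add: mult.commute)
    moreover have "v a = t" by (simp add: v_def)
    ultimately have "0 \<le> 2 * t * Z a j + Z j j"
      using nonneg[of v] that by simp
    moreover have "2 * t * Z a j = - (Z j j + 1)" using nz by (simp add: t_def)
    ultimately show False by linarith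
  qed
  \<comment> \<open>Schur complement. If \<open>Z a a = 0\<close>, division by zero yields 0 and
    nothing is subtracted, in accordance with \<open>row\<close>.\<close>
  define Z' where "Z' i j = Z i j - Z a i * Z a j / Z a a" for i j
  have "\<exists>(R :: nat) y. \<forall>i\<in>I. \<forall>j\<in>I. Z' i j = (\<Sum>r<R. y r i * y r j)"
  proof (rule insert.IH)
    show "Z' i j = Z' j i" if "i \<in> I" "j \<in> I" for i j
      using insert.prems(1)[of i j] that by (simp add: Z'_def mult.commute)
    fix v :: "'i \<Rightarrow> real"
    define s where "s = (\<Sum>j\<in>I. Z a j * v j)"
    \<comment> \<open>The entry at \<open>a\<close> minimizes the quadratic form of \<open>Z\<close>
      for given entries on \<open>I\<close>.\<close>
    define v' where "v' = v(a := - s / Z a a)"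
    have v': "v' i = v i" if "i \<in> I" for i using that aI by (auto simp: v'_def)
    have "0 \<le> (v' a)\<^sup>2 * Z a a + 2 * v' a * s + (\<Sum>i\<in>I. \<Sum>j\<in>I. v i * Z i j * v j)"
      using nonneg[of v'] v' by (simp add: s_def cong: sum.cong)
    also have "(v' a)\<^sup>2 * Z a a + 2 * v' a * s = - (s\<^sup>2 / Z a a)"
      by (cases "Z a a = 0") (simp_all add: v'_def power2_eq_square)
    also have "s\<^sup>2 / Z a a = (\<Sum>i\<in>I. \<Sum>j\<in>I. v i * (Z a i * Z a j / Z a a) * v j)"
      unfolding s_def power2_eq_square sum_product sum_divide_distrib
      by (intro sum.cong refl) simp
    finally have "0 \<le> - (\<Sum>i\<in>I. \<Sum>j\<in>I. v i * (Z a i * Z a j / Z a a) * v j) + (\<Sum>i\<in>I. \<Sum>j\<in>I. v i * Z i j * v j)"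
      by simp
    also have "\<dots> = (\<Sum>i\<in>I. \<Sum>j\<in>I. v i * Z' i j * v j)"
      by (simp add: Z'_def right_diff_distrib left_diff_distrib sum_subtractf)
    finally show "0 \<le> (\<Sum>i\<in>I. \<Sum>j\<in>I. v i * Z' i j * v j)" .
  qed
  then obtain R :: nat and y where y: "\<And>i j. i \<in> I \<Longrightarrow> j \<in> I \<Longrightarrow> Z' i j = (\<Sum>r<R. y r i * y r j)"
    by blast
  define y' where "y' r i = (if r = R then Z a i / sqrt (Z a a) else if i = a then 0 else y r i)" for r i
  have last: "y' R i * y' R j = Z a i * Z a j / Z a a" for i j
    using Zaa by (simp add: y'_def)
  have "Z i j = (\<Sum>r<Suc R. y' r i * y' r j)" if ij: "i \<in> insert a I" "j \<in> insert a I" for i j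
  proof (cases "i = a \<or> j = a")
    case True
    then have "(\<Sum>r<R. y' r i * y' r j) = 0" by (intro sum.neutral) (auto simp: y'_def)
    moreover have "Z i j = Z a i * Z a j / Z a a"
      using True row ij insert.prems(1)[of i j] by (cases "Z a a = 0") auto
    ultimately show ?thesis by (simp add: last)
  next
    case False
    then have "(\<Sum>r<R. y' r i * y' r j) = Z' i j"
      using ij y by (simp add: y'_def)
    then show ?thesis by (simp add: last Z'_def)
  qed
  then show ?case by blast
qed auto

section \<open>Weak duality and uniqueness\<close>

lemma sum_same_cluster:
  fixes f :: "nat \<Rightarrow> real"
  shows "(\<Sum>j<n. if c i = c j then f j else 0) = (\<Sum>j\<in>{j\<in>{..<n}. c j = c i}. f j)"
  by (subst sum.inter_filter[symmetric]) (auto intro!: sum.cong)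

lemma sum_by_clusters:
  fixes f :: "nat \<Rightarrow> real" and c :: "nat \<Rightarrow> nat"
  assumes "\<And>i. i < n \<Longrightarrow> c i < K"
  shows "(\<Sum>i<n. f i) = (\<Sum>k<K. \<Sum>i\<in>{i\<in>{..<n}. c i = k}. f i)"
  using assms by (subst sum.group) auto

text \<open>Read \<open>Z\<close> as the Gram matrix of vectors y_i. The squared distances of y_i
  and y_j, summed over ordered pairs in a common cluster, give 2 m tr Z minus twice the sum of all
  entries, that is 2 n - 2 n = 0. So the y_i are constant on clusters, each row of \<open>Z\<close>
  is constant on its own cluster, and the row sum fixes the value.\<close>

lemma cluster_matrix_unique:
  fixes Z :: "nat \<Rightarrow> nat \<Rightarrow> real" and c :: "nat \<Rightarrow> nat" and R :: nat
  assumes m: "\<And>i. i < n \<Longrightarrow> real (card {j\<in>{..<n}. c j = c i}) = m" "0 < m"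
    and sym: "\<And>i j. i < n \<Longrightarrow> j < n \<Longrightarrow> Z i j = Z j i"
    and y: "\<And>i j. i < n \<Longrightarrow> j < n \<Longrightarrow> Z i j = (\<Sum>r<R. y r i * y r j)"
    and row: "\<And>i. i < n \<Longrightarrow> (\<Sum>j<n. Z i j) = 1"
    and off: "\<And>i j. i < n \<Longrightarrow> j < n \<Longrightarrow> c i \<noteq> c j \<Longrightarrow> Z i j = 0"
    and tr: "m * (\<Sum>i<n. Z i i) = real n"
    and "i < n" "j < n"
  shows "Z i j = (if c i = c j then 1 / m else 0)"
proof -
  define D where "D i j = (\<Sum>r<R. (y r i - y r j)\<^sup>2)" for i j
  have D: "D i j = Z i i + Z j j - 2 * Z i j" if "i < n" "j < n" for i j
    using that unfolding D_def power2_diff sum.distrib sum_subtractf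
    by (simp add: y sum_distrib_left power2_eq_square mult_ac)
  have "(\<Sum>i<n. \<Sum>j<n. if c i = c j then D i j else 0)
      = (\<Sum>i<n. \<Sum>j<n. (if c i = c j then Z i i else 0) + (if c i = c j then Z j j else 0) - 2 * Z i j)"
    using off by (intro sum.cong refl) (auto simp: D)
  also have "\<dots> = (\<Sum>i<n. \<Sum>j<n. if c i = c j then Z i i else 0)
      + (\<Sum>i<n. \<Sum>j<n. if c i = c j then Z j j else 0) - 2 * (\<Sum>i<n. \<Sum>j<n. Z i j)"
    by (simp add: sum.distrib sum_subtractf sum_distrib_left)
  also have "(\<Sum>i<n. \<Sum>j<n. if c i = c j then Z j j else 0) = (\<Sum>i<n. \<Sum>j<n. if c i = c j then Z i i else 0)"
    by (subst sum.swap) (intro sum.cong refl, auto)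
  also have "(\<Sum>i<n. \<Sum>j<n. if c i = c j then Z i i else 0) = (\<Sum>i<n. m * Z i i)"
  proof (intro sum.cong refl)
    fix i assume "i \<in> {..<n}"
    then show "(\<Sum>j<n. if c i = c j then Z i i else 0) = m * Z i i"
      using m(1)[of i] by (simp add: sum_same_cluster[of c i])
  qed
  also have "\<dots> = real n" using tr by (simp add: sum_distrib_left)
  also have "(\<Sum>i<n. \<Sum>j<n. Z i j) = real n" using row by simp
  finally have "(\<Sum>i<n. \<Sum>j<n. if c i = c j then D i j else 0) = 0" by simp
  then have D0: "D i j = 0" if "i < n" "j < n" "c i = c j" for i j
  proof -
    have nn: "0 \<le> D i j" for i j by (simp add: D_def sum_nonneg)
    have "(\<Sum>j<n. if c i = c j then D i j else 0) = 0"
      by (rule sum_nonneg_0[OF _ _ \<open>(\<Sum>i<n. \<Sum>j<n. if c i = c j then D i j else 0) = 0\<close>])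
        (use that nn in \<open>auto intro!: sum_nonneg\<close>)
    from sum_nonneg_0[OF _ _ this, of j] have "(if c i = c j then D i j else 0) = 0"
      using that nn by auto
    then show ?thesis using that by auto
  qed
  have eqrow: "Z i k = Z j k" if "i < n" "j < n" "k < n" "c i = c j" for i j k
  proof -
    have "(\<Sum>r<R. (y r i - y r j)\<^sup>2) = 0" using D0[of i j] that by (simp add: D_def)
    then have "(y r i - y r j)\<^sup>2 = 0" if "r < R" for r
      by (rule sum_nonneg_0[rotated 2]) (use that in auto)
    then show ?thesis using that by (simp add: y)
  qed
  have diag: "Z i i = 1 / m" if "i < n" for i
  proof -
    have "1 = (\<Sum>k<n. Z i k)" using row that by simp
    also have "\<dots> = (\<Sum>k<n. if c i = c k then Z i i else 0)"
    proof (intro sum.cong refl)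
      fix k assume "k \<in> {..<n}"
      then show "Z i k = (if c i = c k then Z i i else 0)"
        using off[of i k] that eqrow[of k i i] sym[of i k] by auto
    qed
    also have "\<dots> = m * Z i i" using m(1)[OF that] by (simp add: sum_same_cluster[of c i])
    finally show ?thesis using m(2) by (simp add: field_simps)
  qed
  show ?thesis
    using off[of i j] diag[of i] eqrow[of j i i] sym[of i j] \<open>i < n\<close> \<open>j < n\<close> by auto
qed

text \<open>On symmetric matrices with the prescribed trace and row sums, <W, Z> + <A, Z> + <B, Z>
  is constant. At \<open>Zs\<close> the first and third terms vanish, so a competitor that is at
  least as good satisfies <W, Z> + <B, Z> \<le> 0. Both are nonnegative, hence <B, Z> = 0, and
  strict positivity of \<open>B\<close> between clusters makes \<open>Z\<close> block
  diagonal.\<close>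

lemma dual_certificate_unique:
  fixes A B W Z :: "nat \<Rightarrow> nat \<Rightarrow> real" and c :: "nat \<Rightarrow> nat" and n K :: nat and m :: real
  defines "G \<equiv> \<lambda>k. {i\<in>{..<n}. c i = k}"
  defines "Zs \<equiv> \<lambda>i j. if c i = c j then 1 / m else 0"
  assumes c: "\<And>i. i < n \<Longrightarrow> c i < K" and m: "\<And>k. k < K \<Longrightarrow> real (card (G k)) = m" "0 < m"
    and W: "\<And>i j. i < n \<Longrightarrow> j < n \<Longrightarrow>
        W i j = (if i = j then \<rho> else 0) + (\<alpha> i + \<alpha> j) / 2 - A i j - B i j"
    and Bpos: "\<And>i j. i < n \<Longrightarrow> j < n \<Longrightarrow> c i \<noteq> c j \<Longrightarrow> 0 < B i j"
    and B0: "\<And>i j. i < n \<Longrightarrow> j < n \<Longrightarrow> c i = c j \<Longrightarrow> B i j = 0"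
    and Wsym: "\<And>i j. i < n \<Longrightarrow> j < n \<Longrightarrow> W i j = W j i"
    and Wrow: "\<And>i k. i < n \<Longrightarrow> k < K \<Longrightarrow> (\<Sum>j\<in>G k. W i j) = 0"
    and Wpsd: "\<And>v. (\<And>k. k < K \<Longrightarrow> (\<Sum>i\<in>G k. v i) = 0) \<Longrightarrow> 0 \<le> (\<Sum>i<n. \<Sum>j<n. v i * W i j * v j)"
    and Zsym: "\<And>i j. i < n \<Longrightarrow> j < n \<Longrightarrow> Z i j = Z j i"
    and Zpsd: "\<And>v. 0 \<le> (\<Sum>i<n. \<Sum>j<n. v i * Z i j * v j)"
    and Zrow: "\<And>i. i < n \<Longrightarrow> (\<Sum>j<n. Z i j) = 1"
    and Ztr: "(\<Sum>i<n. Z i i) = real K"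
    and Znn: "\<And>i j. i < n \<Longrightarrow> j < n \<Longrightarrow> 0 \<le> Z i j"
    and le: "(\<Sum>i<n. \<Sum>j<n. A i j * Zs i j) \<le> (\<Sum>i<n. \<Sum>j<n. A i j * Z i j)"
    and ij: "i < n" "j < n"
  shows "Z i j = Zs i j"
proof -
  have Kmn: "real K * m = real n"
  proof -
    have "real n = (\<Sum>i<n. 1)" by simp
    also have "\<dots> = (\<Sum>k<K. \<Sum>i\<in>G k. 1)" unfolding G_def by (rule sum_by_clusters) (use c in auto)
    also have "\<dots> = real K * m" using m(1) by simp
    finally show ?thesis by simp
  qed
  \<comment> \<open>Subtracting its cluster means from \<open>v\<close> does not change the form,
    since \<open>W\<close> annihilates functions that are constant on clusters.\<close>
  have Wall: "0 \<le> (\<Sum>i<n. \<Sum>j<n. v i * W i j * v j)" for v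
  proof -
    define a where "a k = (\<Sum>i\<in>G k. v i) / m" for k
    define v' where "v' i = v i - a (c i)" for i
    have Wa: "(\<Sum>j<n. W i j * a (c j)) = 0" if "i < n" for i
    proof -
      have "(\<Sum>j<n. W i j * a (c j)) = (\<Sum>k<K. \<Sum>j\<in>G k. W i j * a (c j))"
        unfolding G_def by (rule sum_by_clusters) (use c in auto)
      also have "\<dots> = (\<Sum>k<K. a k * (\<Sum>j\<in>G k. W i j))"
        unfolding sum_distrib_left by (intro sum.cong refl) (auto simp: G_def)
      finally show ?thesis using Wrow[OF that] by simp
    qed
    have "(\<Sum>i\<in>G k. v' i) = 0" if "k < K" for k
    proof -
      have "(\<Sum>i\<in>G k. v' i) = (\<Sum>i\<in>G k. v i - a k)"
        unfolding v'_def by (intro sum.cong refl) (auto simp: G_def)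
      also have "\<dots> = (\<Sum>i\<in>G k. v i) - m * a k" using m(1)[OF that] by (simp add: sum_subtractf)
      finally show ?thesis using m(2) by (simp add: a_def)
    qed
    then have "0 \<le> (\<Sum>i<n. \<Sum>j<n. v' i * W i j * v' j)" by (rule Wpsd)
    also have "\<dots> = (\<Sum>i<n. v' i * (\<Sum>j<n. W i j * v' j))"
      by (simp add: sum_distrib_left mult.assoc)
    also have "\<dots> = (\<Sum>i<n. v' i * (\<Sum>j<n. W i j * v j))"
      using Wa by (intro sum.cong refl) (simp add: v'_def right_diff_distrib sum_subtractf)
    also have "\<dots> = (\<Sum>j<n. v j * (\<Sum>i<n. W i j * v' i))"
      unfolding sum_distrib_left by (subst sum.swap) (simp add: mult_ac)
    also have "\<dots> = (\<Sum>j<n. v j * (\<Sum>i<n. W j i * v' i))"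
      using Wsym by (intro sum.cong arg_cong2[where f="(*)"] refl) auto
    also have "\<dots> = (\<Sum>j<n. v j * (\<Sum>i<n. W j i * v i))"
      using Wa by (intro sum.cong refl) (simp add: v'_def right_diff_distrib sum_subtractf)
    also have "\<dots> = (\<Sum>i<n. \<Sum>j<n. v i * W i j * v j)"
      by (simp add: sum_distrib_left mult.assoc)
    finally show ?thesis .
  qed
  obtain R :: nat and y where y: "\<And>i j. i < n \<Longrightarrow> j < n \<Longrightarrow> Z i j = (\<Sum>r<R. y r i * y r j)"
    using psd_gram_factorization[of "{..<n}" Z] Zsym Zpsd by (auto simp: lessThan_iff Ball_def)
  \<comment> \<open><W, Z> is the sum of the quadratic form of \<open>W\<close> over the factors of
    \<open>Z\<close>.\<close>
  have WZ: "0 \<le> (\<Sum>i<n. \<Sum>j<n. W i j * Z i j)"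
  proof -
    have "(\<Sum>i<n. \<Sum>j<n. W i j * Z i j) = (\<Sum>i<n. \<Sum>j<n. \<Sum>r<R. y r i * W i j * y r j)"
      by (intro sum.cong refl) (simp add: y sum_distrib_left mult_ac)
    also have "\<dots> = (\<Sum>i<n. \<Sum>r<R. \<Sum>j<n. y r i * W i j * y r j)"
      by (intro sum.cong refl sum.swap)
    also have "\<dots> = (\<Sum>r<R. \<Sum>i<n. \<Sum>j<n. y r i * W i j * y r j)"
      by (rule sum.swap)
    also have "0 \<le> \<dots>" by (rule sum_nonneg) (rule Wall)
    finally show ?thesis .
  qed
  have pair: "(\<Sum>i<n. \<Sum>j<n. W i j * Y i j) = \<rho> * real K + (\<Sum>i<n. \<alpha> i)
        - (\<Sum>i<n. \<Sum>j<n. A i j * Y i j) - (\<Sum>i<n. \<Sum>j<n. B i j * Y i j)"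
    if Ysym: "\<And>i j. i < n \<Longrightarrow> j < n \<Longrightarrow> Y i j = Y j i" and Yrow: "\<And>i. i < n \<Longrightarrow> (\<Sum>j<n. Y i j) = 1"
      and Ytr: "(\<Sum>i<n. Y i i) = real K" for Y
  proof -
    have "(\<Sum>i<n. \<Sum>j<n. W i j * Y i j) = (\<Sum>i<n. \<Sum>j<n. (if i = j then \<rho> * Y i i else 0)
        + \<alpha> i * Y i j / 2 + \<alpha> j * Y i j / 2 - A i j * Y i j - B i j * Y i j)"
      by (intro sum.cong refl) (auto simp: W algebra_simps add_divide_distrib)
    also have "\<dots> = (\<Sum>i<n. \<Sum>j<n. if i = j then \<rho> * Y i i else 0) + (\<Sum>i<n. \<Sum>j<n. \<alpha> i * Y i j / 2)
        + (\<Sum>i<n. \<Sum>j<n. \<alpha> j * Y i j / 2)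
        - (\<Sum>i<n. \<Sum>j<n. A i j * Y i j) - (\<Sum>i<n. \<Sum>j<n. B i j * Y i j)"
      by (simp add: sum.distrib sum_subtractf)
    also have "(\<Sum>i<n. \<Sum>j<n. if i = j then \<rho> * Y i i else 0) = \<rho> * real K"
      using Ytr by (simp add: sum_distrib_left[symmetric])
    also have "(\<Sum>i<n. \<Sum>j<n. \<alpha> i * Y i j / 2) = (\<Sum>i<n. \<alpha> i / 2)"
    proof (intro sum.cong refl)
      fix i assume "i \<in> {..<n}"
      then show "(\<Sum>j<n. \<alpha> i * Y i j / 2) = \<alpha> i / 2"
        using Yrow[of i] by (simp flip: sum_distrib_left sum_divide_distrib)
    qed
    also have "(\<Sum>i<n. \<Sum>j<n. \<alpha> j * Y i j / 2) = (\<Sum>j<n. \<Sum>i<n. \<alpha> j * Y j i / 2)"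
      by (subst sum.swap) (intro sum.cong refl, simp add: Ysym)
    also have "\<dots> = (\<Sum>i<n. \<alpha> i / 2)"
    proof (intro sum.cong refl)
      fix i assume "i \<in> {..<n}"
      then show "(\<Sum>j<n. \<alpha> i * Y i j / 2) = \<alpha> i / 2"
        using Yrow[of i] by (simp flip: sum_distrib_left sum_divide_distrib)
    qed
    finally show ?thesis by (simp add: sum_divide_distrib[symmetric])
  qed
  have card': "real (card {j\<in>{..<n}. c j = c i}) = m" if "i < n" for i
    using m(1)[OF c[OF that]] by (simp add: G_def)
  have Zsrow: "(\<Sum>j<n. Zs i j) = 1" if "i < n" for i
    unfolding Zs_def sum_same_cluster[of c i] using card'[OF that] m(2) by simp
  have Zstr: "(\<Sum>i<n. Zs i i) = real K"
    using Kmn m(2) by (simp add: Zs_def field_simps)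
  have WZs: "(\<Sum>i<n. \<Sum>j<n. W i j * Zs i j) = 0"
  proof (rule sum.neutral, rule ballI)
    fix i assume "i \<in> {..<n}"
    then have i: "i < n" by simp
    have "(\<Sum>j<n. W i j * Zs i j) = (\<Sum>j<n. if c i = c j then W i j / m else 0)"
      by (intro sum.cong) (auto simp: Zs_def)
    also have "\<dots> = (\<Sum>j\<in>G (c i). W i j) / m"
      unfolding sum_same_cluster[of c i] G_def by (simp add: sum_divide_distrib)
    finally show "(\<Sum>j<n. W i j * Zs i j) = 0" using Wrow[OF i c[OF i]] by simp
  qed
  have BZs: "(\<Sum>i<n. \<Sum>j<n. B i j * Zs i j) = 0"
    using B0 by (intro sum.neutral ballI) (auto simp: Zs_def)
  have BZ: "0 \<le> B i j * Z i j" if "i < n" "j < n" for i j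
    using Bpos[OF that] B0[OF that] Znn[OF that] by (cases "c i = c j") auto
  have "(\<Sum>i<n. \<Sum>j<n. B i j * Z i j) \<le> 0"
    using pair[of Z] pair[of Zs] Zsym Zrow Ztr Zsrow Zstr WZs BZs WZ le
    by (simp add: Zs_def)
  moreover have "0 \<le> (\<Sum>i<n. \<Sum>j<n. B i j * Z i j)"
    using BZ by (intro sum_nonneg) auto
  ultimately have BZ0: "(\<Sum>i<n. \<Sum>j<n. B i j * Z i j) = 0" by simp
  have off: "Z i j = 0" if "i < n" "j < n" "c i \<noteq> c j" for i j
  proof -
    have "(\<Sum>j<n. B i j * Z i j) = 0"
      by (rule sum_nonneg_0[OF _ _ BZ0]) (use that BZ in \<open>auto intro!: sum_nonneg\<close>)
    from sum_nonneg_0[OF _ _ this, of j] have "B i j * Z i j = 0"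
      using that BZ by auto
    then show ?thesis using that Bpos[OF that] by auto
  qed
  have "m * (\<Sum>i<n. Z i i) = real n" using Kmn Ztr by (simp add: mult.commute)
  from cluster_matrix_unique[OF card' m(2) Zsym y Zrow off this ij]
  show ?thesis unfolding Zs_def by simp
qed

section \<open>The certificate of a clustered data set\<close>

text \<open>Noise outcomes are functions of the coordinate index, so inner products are taken of
  functions, of which only the first \<open>p\<close> values count.\<close>

definition dot :: "nat \<Rightarrow> (nat \<Rightarrow> real) \<Rightarrow> (nat \<Rightarrow> real) \<Rightarrow> real" where
  "dot p u v = (\<Sum>a<p. u a * v a)"

lemma dot_commute: "dot p u v = dot p v u"
  by (simp add: dot_def mult.commute)

lemma dot_sum_left: "dot p (\<lambda>a. \<Sum>i\<in>I. f i a) v = (\<Sum>i\<in>I. dot p (f i) v)"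
  unfolding dot_def sum_distrib_right by (rule sum.swap)

lemma dot_sum_right: "dot p u (\<lambda>a. \<Sum>i\<in>I. f i a) = (\<Sum>i\<in>I. dot p u (f i))"
  unfolding dot_def sum_distrib_left by (rule sum.swap)

lemma dot_add_left: "dot p (\<lambda>a. u a + u' a) v = dot p u v + dot p u' v"
  by (simp add: dot_def distrib_right sum.distrib)

lemma dot_add_right: "dot p u (\<lambda>a. v a + v' a) = dot p u v + dot p u v'"
  by (simp add: dot_def distrib_left sum.distrib)

lemma dot_diff_left: "dot p (\<lambda>a. u a - u' a) v = dot p u v - dot p u' v"
  by (simp add: dot_def left_diff_distrib sum_subtractf)

lemma dot_diff_right: "dot p u (\<lambda>a. v a - v' a) = dot p u v - dot p u v'"
  by (simp add: dot_def right_diff_distrib sum_subtractf)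

lemma dot_scale_left: "dot p (\<lambda>a. s * u a) v = s * dot p u v"
  by (simp add: dot_def sum_distrib_left mult.assoc)

lemma dot_scale_right: "dot p u (\<lambda>a. s * v a) = s * dot p u v"
  by (simp add: dot_def sum_distrib_left mult_ac)

lemmas dot_simps = dot_sum_left dot_sum_right dot_add_left dot_add_right dot_diff_left
  dot_diff_right dot_scale_left dot_scale_right

lemma dot_self_nonneg: "0 \<le> dot p u u"
  by (simp add: dot_def sum_nonneg)

locale balanced_clusters =
  fixes n K :: nat and c :: "nat \<Rightarrow> nat" and m :: real
  assumes c_less: "i < n \<Longrightarrow> c i < K"
    and card_cluster: "k < K \<Longrightarrow> real (card {i\<in>{..<n}. c i = k}) = m"
    and m_pos: "0 < m"
begin

definition cluster :: "nat \<Rightarrow> nat set" where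
  "cluster k = {i\<in>{..<n}. c i = k}"

lemma finite_cluster [simp]: "finite (cluster k)"
  by (simp add: cluster_def)

lemma card_cluster' [simp]: "k < K \<Longrightarrow> real (card (cluster k)) = m"
  using card_cluster by (simp add: cluster_def)

lemma cluster_ne: "k < K \<Longrightarrow> cluster k \<noteq> {}"
proof
  assume "k < K" "cluster k = {}"
  then have "m = 0" using card_cluster[of k] unfolding cluster_def by (simp only: card.empty of_nat_0)
  then show False using m_pos by simp
qed

lemma in_cluster: "i \<in> cluster k \<longleftrightarrow> i < n \<and> c i = k"
  by (auto simp: cluster_def)

lemma sum_clusters: "(\<Sum>i<n. f i) = (\<Sum>k<K. \<Sum>i\<in>cluster k. f i)" for f :: "nat \<Rightarrow> real"
  unfolding cluster_def by (rule sum_by_clusters) (rule c_less)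

lemma K_times_m: "real K * m = real n"
  using sum_clusters[of "\<lambda>_. 1"] by simp

end

locale clustered_data = balanced_clusters +
  fixes p :: nat and x :: "nat \<Rightarrow> nat \<Rightarrow> real"
begin

definition center :: "nat \<Rightarrow> nat \<Rightarrow> real" where
  "center k a = (\<Sum>i\<in>cluster k. x i a) / m"

text \<open>\<open>margin \<rho> i l\<close> equals $\frac m2 (|x_i - \bar x_l|^2 - |x_i - \bar x_{c(i)}|^2) - \rho$, the sum over cluster
  \<open>l\<close> that complementary slackness prescribes for row \<open>i\<close> of the dual variable \<open>B\<close>.\<close>

definition margin :: "real \<Rightarrow> nat \<Rightarrow> nat \<Rightarrow> real" where
  "margin \<rho> i l = m * (dot p (x i) (center (c i)) - dot p (x i) (center l))
     + m / 2 * (dot p (center l) (center l) - dot p (center (c i)) (center (c i))) - \<rho>"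

text \<open>Equals m^2 / 2 times the squared distance of the two empirical centers, minus m \<rho>.
  It is the sum of all entries of one block of \<open>B\<close>; its symmetry in \<open>k\<close>
  and \<open>l\<close> makes the prescribed row and column sums compatible.\<close>

definition total_margin :: "real \<Rightarrow> nat \<Rightarrow> nat \<Rightarrow> real" where
  "total_margin \<rho> k l = m\<^sup>2 / 2 * (dot p (center k) (center k) + dot p (center l) (center l)
     - 2 * dot p (center k) (center l)) - m * \<rho>"

lemma sum_dot_center: "(\<Sum>j\<in>cluster l. dot p u (x j)) = m * dot p u (center l)"
proof -
  have "(\<Sum>j\<in>cluster l. dot p u (x j)) = dot p u (\<lambda>a. \<Sum>j\<in>cluster l. x j a)"
    by (simp add: dot_sum_right)
  also have "(\<lambda>a. \<Sum>j\<in>cluster l. x j a) = (\<lambda>a. m * center l a)"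
    using m_pos by (simp add: center_def)
  finally show ?thesis by (simp add: dot_scale_right)
qed

lemma sum_center_dot: "(\<Sum>j\<in>cluster l. dot p (x j) u) = m * dot p (center l) u"
  using sum_dot_center[of u l] by (simp add: dot_commute)

lemma sum_margin: 
  assumes "k < K"
  shows "(\<Sum>i\<in>cluster k. margin \<rho> i l) = total_margin \<rho> k l"
proof -
  have "(\<Sum>i\<in>cluster k. margin \<rho> i l) = (\<Sum>i\<in>cluster k. m * (dot p (x i) (center k) - dot p (x i) (center l))
     + m / 2 * (dot p (center l) (center l) - dot p (center k) (center k)) - \<rho>)"
    by (intro sum.cong refl) (auto simp: margin_def in_cluster)
  also have "\<dots> = m * (m * dot p (center k) (center k) - m * dot p (center k) (center l))
     + m * (m / 2 * (dot p (center l) (center l) - dot p (center k) (center k))) - m * \<rho>"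
    using assms by (simp add: sum.distrib sum_subtractf sum_center_dot flip: sum_distrib_left)
  also have "\<dots> = total_margin \<rho> k l"
    by (simp add: total_margin_def power2_eq_square algebra_simps)
  finally show ?thesis .
qed

lemma total_margin_commute: "total_margin \<rho> k l = total_margin \<rho> l k"
  by (simp add: total_margin_def dot_commute)

text \<open>For \<open>v\<close> with zero cluster sums, block (k, l) of \<open>B\<close>
  contributes \<open>b k l * b l k\<close> divided by the total margin. Hypothesis
  \<open>cross\<close> and the inequality of arithmetic and geometric means bound this by S (q_k +
  q_l) / 2, where q_k is the squared norm of \<open>v\<close> on cluster k. The sum over all pairs
  is S K |v|^2, the amount that \<open>spread\<close> reserves.\<close>

theorem true_clustering_unique_optimum:
  fixes Z :: "nat \<Rightarrow> nat \<Rightarrow> real"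
  defines "Zs \<equiv> \<lambda>i j. if c i = c j then 1 / m else 0"
  assumes S: "0 \<le> S" and margin: "\<And>i l. i < n \<Longrightarrow> l < K \<Longrightarrow> l \<noteq> c i \<Longrightarrow> 0 < margin \<rho> i l"
    and cross: "\<And>k l v. k < K \<Longrightarrow> l < K \<Longrightarrow> k \<noteq> l \<Longrightarrow> (\<Sum>i\<in>cluster k. v i) = 0 \<Longrightarrow>
        (m * (\<Sum>i\<in>cluster k. v i * (dot p (x i) (center k) - dot p (x i) (center l))))\<^sup>2
          \<le> S * total_margin \<rho> k l * (\<Sum>i\<in>cluster k. (v i)\<^sup>2)"
    and spread: "\<And>v. (\<And>k. k < K \<Longrightarrow> (\<Sum>i\<in>cluster k. v i) = 0) \<Longrightarrow>
        dot p (\<lambda>a. \<Sum>i<n. v i * x i a) (\<lambda>a. \<Sum>i<n. v i * x i a) + S * real K * (\<Sum>i<n. (v i)\<^sup>2)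
          \<le> \<rho> * (\<Sum>i<n. (v i)\<^sup>2)"
    and Zsym: "\<And>i j. i < n \<Longrightarrow> j < n \<Longrightarrow> Z i j = Z j i"
    and Zpsd: "\<And>v. 0 \<le> (\<Sum>i<n. \<Sum>j<n. v i * Z i j * v j)"
    and Zrow: "\<And>i. i < n \<Longrightarrow> (\<Sum>j<n. Z i j) = 1"
    and Ztr: "(\<Sum>i<n. Z i i) = real K"
    and Znn: "\<And>i j. i < n \<Longrightarrow> j < n \<Longrightarrow> 0 \<le> Z i j"
    and le: "(\<Sum>i<n. \<Sum>j<n. dot p (x i) (x j) * Zs i j) \<le> (\<Sum>i<n. \<Sum>j<n. dot p (x i) (x j) * Z i j)"
    and ij: "i < n" "j < n"
  shows "Z i j = Zs i j"
proof -
  let ?t = "total_margin \<rho>"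
  \<comment> \<open>Solves the condition that each row of \<open>W\<close> sums to zero over its own
    cluster, where \<open>B\<close> vanishes.\<close>
  define \<alpha> where "\<alpha> i = 2 * dot p (x i) (center (c i)) - dot p (center (c i)) (center (c i)) - \<rho> / m" for i
  define B where "B i j = (if c i = c j then 0 else margin \<rho> i (c j) * margin \<rho> j (c i) / ?t (c i) (c j))" for i j
  define W where "W i j = (if i = j then \<rho> else 0) + (\<alpha> i + \<alpha> j) / 2 - dot p (x i) (x j) - B i j" for i j
  have t_pos: "0 < ?t k l" if "k < K" "l < K" "k \<noteq> l" for k l
    unfolding sum_margin[OF that(1), symmetric]
    using that cluster_ne[OF that(1)] by (intro sum_pos) (auto simp: in_cluster intro!: margin)
  have \<alpha>_sum: "(\<Sum>j\<in>cluster k. \<alpha> j) = m * dot p (center k) (center k) - \<rho>" if "k < K" for k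
  proof -
    have "(\<Sum>j\<in>cluster k. \<alpha> j) = (\<Sum>j\<in>cluster k. 2 * dot p (x j) (center k) - dot p (center k) (center k) - \<rho> / m)"
      by (intro sum.cong refl) (auto simp: \<alpha>_def in_cluster)
    also have "\<dots> = 2 * (m * dot p (center k) (center k)) - m * dot p (center k) (center k) - m * (\<rho> / m)"
      using that by (simp add: sum_subtractf sum_center_dot flip: sum_distrib_left)
    finally show ?thesis using m_pos by simp
  qed
  have \<alpha>_m: "m * \<alpha> i = 2 * (m * dot p (x i) (center (c i))) - m * dot p (center (c i)) (center (c i)) - \<rho>" for i
    using m_pos by (simp add: \<alpha>_def right_diff_distrib)
  have Wrow: "(\<Sum>j\<in>cluster l. W i j) = 0" if "i < n" "l < K" for i l
  proof -
    have "(\<Sum>j\<in>cluster l. W i j) = (\<Sum>j\<in>cluster l. if i = j then \<rho> else 0)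
        + (m * \<alpha> i + (\<Sum>j\<in>cluster l. \<alpha> j)) / 2 - m * dot p (x i) (center l) - (\<Sum>j\<in>cluster l. B i j)"
      using that by (simp add: W_def sum.distrib sum_subtractf sum_dot_center flip: sum_divide_distrib)
    also have "\<dots> = 0"
    proof (cases "l = c i")
      case True
      then have "(\<Sum>j\<in>cluster l. B i j) = 0" by (intro sum.neutral) (auto simp: B_def in_cluster)
      moreover have "(\<Sum>j\<in>cluster l. if i = j then \<rho> else 0) = \<rho>"
        using True that by (simp add: in_cluster)
      ultimately show ?thesis using \<alpha>_sum[OF that(2)] \<alpha>_m[of i] unfolding True by (simp add: diff_divide_distrib)
    next
      case False
      have "(\<Sum>j\<in>cluster l. B i j) = (\<Sum>j\<in>cluster l. margin \<rho> i l / ?t (c i) l * margin \<rho> j (c i))"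
        using False by (intro sum.cong refl) (auto simp: B_def in_cluster)
      also have "\<dots> = margin \<rho> i l / ?t (c i) l * ?t l (c i)"
        unfolding sum_margin[OF that(2), symmetric] sum_distrib_left ..
      also have "\<dots> = margin \<rho> i l"
        using t_pos[OF c_less[OF that(1)] that(2)] False total_margin_commute[of \<rho> l "c i"] by simp
      finally have "(\<Sum>j\<in>cluster l. B i j) = margin \<rho> i l" .
      moreover have "(\<Sum>j\<in>cluster l. if i = j then \<rho> else 0) = 0"
        using False that by (intro sum.neutral) (auto simp: in_cluster)
      ultimately show ?thesis using \<alpha>_sum[OF that(2)] \<alpha>_m[of i] by (simp add: margin_def algebra_simps)
    qed
    finally show ?thesis .
  qed
  have Bpos: "0 < B i j" if "i < n" "j < n" "c i \<noteq> c j" for i j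
    using that margin[of i "c j"] margin[of j "c i"] t_pos[of "c i" "c j"] c_less by (simp add: B_def)
  have Bsym: "B i j = B j i" for i j
    using total_margin_commute[of \<rho> "c i" "c j"] by (simp add: B_def mult.commute)
  have Wsym: "W i j = W j i" for i j
    using Bsym[of i j] by (simp add: W_def dot_commute)
  have Wpsd: "0 \<le> (\<Sum>i<n. \<Sum>j<n. v i * W i j * v j)" if v: "\<And>k. k < K \<Longrightarrow> (\<Sum>i\<in>cluster k. v i) = 0" for v
  proof -
    define b where "b k l = (\<Sum>i\<in>cluster k. v i * margin \<rho> i l)" for k l
    define q where "q k = (\<Sum>i\<in>cluster k. (v i)\<^sup>2)" for k
    have q: "(\<Sum>k<K. q k) = (\<Sum>i<n. (v i)\<^sup>2)" by (simp add: q_def sum_clusters)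
    have q_nn: "0 \<le> q k" for k by (simp add: q_def sum_nonneg)
    have v0: "(\<Sum>i<n. v i) = 0" using v by (simp add: sum_clusters)
    have b: "(b k l)\<^sup>2 \<le> S * ?t k l * q k" if "k < K" "l < K" "k \<noteq> l" for k l
    proof -
      \<comment> \<open>The terms of \<open>margin\<close> that do not depend on the point within
        its cluster drop out, because \<open>v\<close> sums to zero there.\<close>
      have "b k l = (\<Sum>i\<in>cluster k. m * (v i * (dot p (x i) (center k) - dot p (x i) (center l)))
          + v i * (m / 2 * (dot p (center l) (center l) - dot p (center k) (center k)) - \<rho>))"
        unfolding b_def by (intro sum.cong refl) (auto simp: margin_def in_cluster algebra_simps)
      also have "\<dots> = m * (\<Sum>i\<in>cluster k. v i * (dot p (x i) (center k) - dot p (x i) (center l)))"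
        using v[OF that(1)] by (simp add: sum.distrib flip: sum_distrib_left sum_distrib_right)
      finally show ?thesis using cross[OF that v[OF that(1)]] by (simp add: q_def)
    qed
    have vBv: "(\<Sum>i<n. \<Sum>j<n. v i * B i j * v j) \<le> S * real K * (\<Sum>i<n. (v i)\<^sup>2)"
    proof -
      have "(\<Sum>i<n. \<Sum>j<n. v i * B i j * v j)
          = (\<Sum>k<K. \<Sum>i\<in>cluster k. \<Sum>l<K. \<Sum>j\<in>cluster l. v i * B i j * v j)"
        unfolding sum_clusters ..
      also have "\<dots> = (\<Sum>k<K. \<Sum>l<K. \<Sum>i\<in>cluster k. \<Sum>j\<in>cluster l. v i * B i j * v j)"
        by (intro sum.cong refl sum.swap)
      also have "\<dots> = (\<Sum>k<K. \<Sum>l<K. if k = l then 0 else b k l * b l k / ?t k l)"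
      proof (intro sum.cong refl)
        fix k l
        show "(\<Sum>i\<in>cluster k. \<Sum>j\<in>cluster l. v i * B i j * v j) = (if k = l then 0 else b k l * b l k / ?t k l)"
        proof (cases "k = l")
          case True
          then show ?thesis by (auto simp: B_def in_cluster intro!: sum.neutral)
        next
          case False
          then show ?thesis
            unfolding b_def sum_product sum_divide_distrib
            by (auto simp: B_def in_cluster intro!: sum.cong)
        qed
      qed
      \<comment> \<open>The pairs \<open>k = l\<close> are 0 on the left and nonnegative on the
        right; including them gives the factor \<open>real K\<close> exactly.\<close>
      also have "\<dots> \<le> (\<Sum>k<K. \<Sum>l<K. S * (q k + q l) / 2)"
      proof (intro sum_mono)
        fix k l assume "k \<in> {..<K}" "l \<in> {..<K}"
        then have kl: "k < K" "l < K" by auto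
        show "(if k = l then 0 else b k l * b l k / ?t k l) \<le> S * (q k + q l) / 2"
        proof (cases "k = l")
          case False
          have t: "0 < ?t k l" using t_pos kl False by blast
          have "2 * (b k l * b l k) \<le> (b k l)\<^sup>2 + (b l k)\<^sup>2"
            using sum_squares_bound[of "b k l" "b l k"] by simp
          also have "\<dots> \<le> S * ?t k l * q k + S * ?t k l * q l"
            using b[of k l] b[of l k] kl False total_margin_commute[of \<rho> l k] by simp
          also have "\<dots> = S * (q k + q l) * ?t k l" by (simp add: algebra_simps)
          finally show ?thesis using t False by (simp add: field_simps)
        qed (use q_nn S in simp)
      qed
      also have "\<dots> = S * real K * (\<Sum>i<n. (v i)\<^sup>2)"
        by (simp add: sum.distrib distrib_left add_divide_distrib q[symmetric] sum_distrib_left sum_divide_distrib[symmetric] mult_ac)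
      finally show ?thesis .
    qed
    have cross0: "(\<Sum>i<n. \<Sum>j<n. v i * \<alpha> i * v j) = 0"
      using v0 by (simp flip: sum_distrib_left)
    have "(\<Sum>i<n. \<Sum>j<n. v i * W i j * v j) = (\<Sum>i<n. \<Sum>j<n. (if i = j then \<rho> * (v i)\<^sup>2 else 0)
        + v i * \<alpha> i * v j / 2 + v j * \<alpha> j * v i / 2 - v i * dot p (x i) (x j) * v j - v i * B i j * v j)"
      by (intro sum.cong refl) (auto simp: W_def algebra_simps power2_eq_square add_divide_distrib)
    also have "\<dots> = \<rho> * (\<Sum>i<n. (v i)\<^sup>2) + (\<Sum>i<n. \<Sum>j<n. v i * \<alpha> i * v j) / 2
        + (\<Sum>i<n. \<Sum>j<n. v j * \<alpha> j * v i) / 2 - (\<Sum>i<n. \<Sum>j<n. v i * dot p (x i) (x j) * v j)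
        - (\<Sum>i<n. \<Sum>j<n. v i * B i j * v j)"
      by (simp add: sum.distrib sum_subtractf sum_divide_distrib sum_distrib_left)
    also have "(\<Sum>i<n. \<Sum>j<n. v j * \<alpha> j * v i) = (\<Sum>i<n. \<Sum>j<n. v i * \<alpha> i * v j)"
      by (rule sum.swap)
    also have "(\<Sum>i<n. \<Sum>j<n. v i * dot p (x i) (x j) * v j)
        = dot p (\<lambda>a. \<Sum>i<n. v i * x i a) (\<lambda>a. \<Sum>i<n. v i * x i a)"
      by (simp add: dot_simps sum_distrib_left mult_ac)
    finally show ?thesis using vBv spread[OF v] cross0 by simp
  qed
  have "Z i j = (if c i = c j then 1 / m else 0)"
    by (rule dual_certificate_unique[where A="\<lambda>i j. dot p (x i) (x j)" and B=B and W=W and \<rho>=\<rho> and \<alpha>=\<alpha> and K=K and n=n])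
      (use c_less card_cluster m_pos W_def Bpos B_def Wsym Wrow Wpsd Zsym Zpsd Zrow Ztr Znn le ij in
        \<open>auto simp: cluster_def Zs_def\<close>)
  then show ?thesis by (simp add: Zs_def)
qed

end

text \<open>The assumptions \<open>gram_all\<close> to \<open>indep\<close> are the random events, the last three are inequalities between
  constants. The multiplier is \<open>\<rho> = \<sigma>\<^sup>2 * p + \<Lambda>\<close>, of which \<open>S * K\<close> is spent on the dual variable \<open>B\<close>. In
  \<open>indep\<close> the noise \<open>e i\<close> is left out of the mean of its own cluster, which makes \<open>w\<close> independent of it.\<close>

locale good_noise = balanced_clusters +
  fixes p :: nat and \<mu> e :: "nat \<Rightarrow> nat \<Rightarrow> real" and \<sigma> \<gamma> \<tau> \<Lambda> S :: real and d :: "nat \<Rightarrow> nat \<Rightarrow> nat \<Rightarrow> real"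
    and D :: "nat \<Rightarrow> nat \<Rightarrow> real"
  defines "d \<equiv> \<lambda>k l a. \<mu> k a - \<mu> l a"
    and "D \<equiv> \<lambda>k l. dot p (d k l) (d k l)"
  assumes \<sigma>: "0 < \<sigma>" and \<gamma>: "0 \<le> \<gamma>" and \<tau>: "0 \<le> \<tau>" and S: "0 \<le> S"
    and gram_all: "\<And>v. gram_dev p (\<sigma>\<^sup>2) {..<n} e v v \<le> (\<Lambda> - S * real K) * (\<Sum>i<n. (v i)\<^sup>2)"
    and gram_pair: "\<And>k l u v. k < K \<Longrightarrow> l < K \<Longrightarrow> k \<noteq> l \<Longrightarrow>
      \<bar>gram_dev p (\<sigma>\<^sup>2) (cluster k \<union> cluster l) e u v\<bar> \<le> m * \<gamma> *
        sqrt (\<Sum>i\<in>cluster k \<union> cluster l. (u i)\<^sup>2) * sqrt (\<Sum>i\<in>cluster k \<union> cluster l. (v i)\<^sup>2)"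
    and proj: "\<And>k l. k < K \<Longrightarrow> l < K \<Longrightarrow> k \<noteq> l \<Longrightarrow>
      (\<Sum>i\<in>cluster k \<union> cluster l. (dot p (e i) (d k l))\<^sup>2) \<le> 16 * \<sigma>\<^sup>2 * m * D k l"
    and indep: "\<And>i l w. i < n \<Longrightarrow> l < K \<Longrightarrow> l \<noteq> c i \<Longrightarrow>
      w = (\<lambda>a. d (c i) l a + (\<Sum>j\<in>cluster (c i) - {i}. e j a) / m - (\<Sum>j\<in>cluster l. e j a) / m) \<Longrightarrow>
      - \<sigma> * sqrt (dot p w w) * \<tau> \<le> dot p (e i) w"
    and sep_total: "\<And>k l. k < K \<Longrightarrow> l < K \<Longrightarrow> k \<noteq> l \<Longrightarrow>
      12 * \<sigma> * sqrt (D k l) + 2 * \<gamma> + 2 * \<Lambda> / m \<le> D k l / 2"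
    and sep_margin: "\<And>k l. k < K \<Longrightarrow> l < K \<Longrightarrow> k \<noteq> l \<Longrightarrow>
      2 * \<sigma> * \<tau> * sqrt (D k l + 12 * \<sigma> * sqrt (D k l) + 2 * \<sigma>\<^sup>2 * (real p / m) + 2 * \<gamma>)
        + 4 * \<gamma> + 8 * \<sigma> * sqrt (D k l) + 2 * \<Lambda> / m < D k l"
    and sep_cross: "\<And>k l. k < K \<Longrightarrow> l < K \<Longrightarrow> k \<noteq> l \<Longrightarrow>
      128 * \<sigma>\<^sup>2 * m * D k l + 16 * \<gamma>\<^sup>2 * m \<le> S * D k l"
begin

sublocale clustered_data n K c m p "\<lambda>i a. \<mu> (c i) a + e i a" ..

definition noise_mean :: "nat \<Rightarrow> nat \<Rightarrow> real" where
  "noise_mean k a = (\<Sum>i\<in>cluster k. e i a) / m"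

lemma center_eq: "k < K \<Longrightarrow> center k = (\<lambda>a. \<mu> k a + noise_mean k a)"
proof
  fix a assume "k < K"
  have "(\<Sum>i\<in>cluster k. \<mu> (c i) a + e i a) = (\<Sum>i\<in>cluster k. \<mu> k a + e i a)"
    by (intro sum.cong) (auto simp: in_cluster)
  then show "center k a = \<mu> k a + noise_mean k a"
    using \<open>k < K\<close> m_pos by (simp add: center_def noise_mean_def sum.distrib add_divide_distrib)
qed

text \<open>The noise means, their difference, single noise vectors and leave-one-out means are all
  of this form, so \<open>gram_pair\<close> and \<open>proj\<close> control them uniformly, without
  further random events.\<close>

definition noise_comb :: "nat \<Rightarrow> nat \<Rightarrow> (nat \<Rightarrow> real) \<Rightarrow> nat \<Rightarrow> real" where
  "noise_comb k l u a = (\<Sum>i\<in>cluster k \<union> cluster l. u i * e i a)"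

section \<open>Estimates for one pair of distinct clusters\<close>

context
  fixes k l assumes k: "k < K" and l: "l < K" and kl: "k \<noteq> l"
begin

lemma disj: "cluster k \<inter> cluster l = {}"
  using kl by (auto simp: in_cluster)

lemma sum_pair: "(\<Sum>i\<in>cluster k \<union> cluster l. f i) = (\<Sum>i\<in>cluster k. f i) + (\<Sum>i\<in>cluster l. f i)"
  for f :: "nat \<Rightarrow> real"
  using disj by (simp add: sum.union_disjoint)

lemma comb_gram:
  "\<bar>dot p (noise_comb k l u) (noise_comb k l v) - real p * \<sigma>\<^sup>2 * (\<Sum>i\<in>cluster k \<union> cluster l. u i * v i)\<bar>
    \<le> m * \<gamma> * sqrt (\<Sum>i\<in>cluster k \<union> cluster l. (u i)\<^sup>2) * sqrt (\<Sum>i\<in>cluster k \<union> cluster l. (v i)\<^sup>2)"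
  using gram_pair[OF k l kl, of u v] by (simp add: gram_dev_def dot_def noise_comb_def[abs_def])

text \<open>Cauchy-Schwarz in the coefficients: the one event \<open>proj\<close> bounds the
  projections of all combinations on the separation vector.\<close>

lemma comb_proj:
  assumes "(\<Sum>i\<in>cluster k \<union> cluster l. (u i)\<^sup>2) \<le> b"
  shows "\<bar>dot p (noise_comb k l u) (d k l)\<bar> \<le> 4 * \<sigma> * sqrt (D k l) * sqrt (m * b)"
proof -
  let ?J = "cluster k \<union> cluster l"
  have D: "0 \<le> D k l" by (simp add: D_def dot_self_nonneg)
  have "dot p (noise_comb k l u) (d k l) = (\<Sum>i\<in>?J. u i * dot p (e i) (d k l))"
    unfolding noise_comb_def[abs_def] dot_simps ..
  then have "(dot p (noise_comb k l u) (d k l))\<^sup>2 \<le> (\<Sum>i\<in>?J. (u i)\<^sup>2) * (\<Sum>i\<in>?J. (dot p (e i) (d k l))\<^sup>2)"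
    using Cauchy_Schwarz_ineq_sum[of u "\<lambda>i. dot p (e i) (d k l)" ?J] by simp
  also have "\<dots> \<le> b * (16 * \<sigma>\<^sup>2 * m * D k l)"
    using assms proj[OF k l kl] order_trans[OF sum_nonneg assms] by (intro mult_mono sum_nonneg) auto
  finally have "sqrt ((dot p (noise_comb k l u) (d k l))\<^sup>2) \<le> sqrt (b * (16 * \<sigma>\<^sup>2 * m * D k l))"
    by (rule real_sqrt_le_mono)
  also have "\<dots> = 4 * \<sigma> * sqrt (D k l) * sqrt (m * b)"
    using \<sigma> by (simp add: real_sqrt_mult)
  finally show ?thesis by simp
qed

lemma comb_sq:
  assumes b: "(\<Sum>i\<in>cluster k \<union> cluster l. (u i)\<^sup>2) = b"
  shows "\<bar>dot p (noise_comb k l u) (noise_comb k l u) - real p * \<sigma>\<^sup>2 * b\<bar> \<le> m * \<gamma> * b"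
proof -
  have "0 \<le> b" using b by (auto intro: sum_nonneg)
  then show ?thesis using comb_gram[of u u] b
    by (simp add: power2_eq_square mult.assoc real_sqrt_mult_self abs_of_nonneg)
qed

text \<open>The coefficient vectors of the two noise means; each has squared norm 1 / m.\<close>

definition uk :: "nat \<Rightarrow> real" where "uk i = (if c i = k then 1 / m else 0)"
definition ul :: "nat \<Rightarrow> real" where "ul i = (if c i = l then 1 / m else 0)"

lemma uk_simps: "i \<in> cluster k \<Longrightarrow> uk i = 1 / m" "i \<in> cluster l \<Longrightarrow> uk i = 0"
  using kl by (auto simp: uk_def in_cluster)

lemma ul_simps: "i \<in> cluster k \<Longrightarrow> ul i = 0" "i \<in> cluster l \<Longrightarrow> ul i = 1 / m"
  using kl by (auto simp: ul_def in_cluster)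

lemma comb_uk: "noise_comb k l uk = noise_mean k"
  unfolding noise_comb_def[abs_def] noise_mean_def[abs_def] sum_pair
  by (simp add: uk_simps sum_divide_distrib cong: sum.cong)

lemma comb_ul: "noise_comb k l ul = noise_mean l"
  unfolding noise_comb_def[abs_def] noise_mean_def[abs_def] sum_pair
  by (simp add: ul_simps sum_divide_distrib cong: sum.cong)

lemma comb_diff: "noise_comb k l (\<lambda>i. u i - v i) = (\<lambda>a. noise_comb k l u a - noise_comb k l v a)"
  by (simp add: noise_comb_def[abs_def] left_diff_distrib sum_subtractf)

lemma uk_sq: "(\<Sum>i\<in>cluster k \<union> cluster l. (uk i)\<^sup>2) = 1 / m"
  using m_pos k by (simp add: sum_pair uk_simps power_divide power2_eq_square cong: sum.cong)

lemma ul_sq: "(\<Sum>i\<in>cluster k \<union> cluster l. (ul i)\<^sup>2) = 1 / m"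
  using m_pos l by (simp add: sum_pair ul_simps power_divide power2_eq_square cong: sum.cong)

lemma diff_sq: "(\<Sum>i\<in>cluster k \<union> cluster l. (uk i - ul i)\<^sup>2) = 2 / m"
  using m_pos k l by (simp add: sum_pair uk_simps ul_simps power_divide power2_eq_square cong: sum.cong)

lemma mean_k_sq: "\<bar>dot p (noise_mean k) (noise_mean k) - \<sigma>\<^sup>2 * (real p / m)\<bar> \<le> \<gamma>"
  using comb_sq[OF uk_sq] m_pos by (simp add: comb_uk mult.commute)

lemma mean_l_sq: "\<bar>dot p (noise_mean l) (noise_mean l) - \<sigma>\<^sup>2 * (real p / m)\<bar> \<le> \<gamma>"
  using comb_sq[OF ul_sq] m_pos by (simp add: comb_ul mult.commute)

lemma mean_diff_sq:
  "2 * \<sigma>\<^sup>2 * (real p / m) - 2 * \<gamma> \<le> dot p (\<lambda>a. noise_mean k a - noise_mean l a) (\<lambda>a. noise_mean k a - noise_mean l a)"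
proof -
  have "m * \<gamma> * (2 / m) = 2 * \<gamma>" "real p * \<sigma>\<^sup>2 * (2 / m) = 2 * \<sigma>\<^sup>2 * (real p / m)" using m_pos by auto
  with comb_sq[OF diff_sq] show ?thesis
    unfolding comb_diff comb_uk comb_ul abs_le_iff by linarith
qed

lemma mean_l_proj: "\<bar>dot p (noise_mean l) (d k l)\<bar> \<le> 4 * \<sigma> * sqrt (D k l)"
  using comb_proj[OF eq_refl[OF ul_sq]] m_pos by (simp add: comb_ul)

lemma sqrt2_proj: "4 * \<sigma> * sqrt (D k l) * sqrt (m * (2 / m)) \<le> 6 * \<sigma> * sqrt (D k l)"
proof -
  have "sqrt 2 \<le> 3 / 2" by (rule real_le_lsqrt) (auto simp: power_divide)
  then have "4 * sqrt 2 \<le> 6" by simp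
  then have "4 * sqrt 2 * (\<sigma> * sqrt (D k l)) \<le> 6 * (\<sigma> * sqrt (D k l))"
    using \<sigma> by (intro mult_right_mono) (auto simp: D_def dot_self_nonneg)
  then show ?thesis using m_pos by (simp add: mult_ac)
qed

lemma mean_diff_proj: "\<bar>dot p (\<lambda>a. noise_mean k a - noise_mean l a) (d k l)\<bar> \<le> 6 * \<sigma> * sqrt (D k l)"
  using comb_proj[OF eq_refl[OF diff_sq]] sqrt2_proj unfolding comb_diff comb_uk comb_ul by linarith

text \<open>The squared distance of the noise means is about 2 \<sigma>^2 p / m and cancels the
  \<sigma>^2 p of the multiplier. The errors are \<open>12 * \<sigma> * sqrt (D k l)\<close> from
  the mixed term, \<open>2 * \<gamma>\<close> from the Gram deviation and
  \<open>2 * \<Lambda> / m\<close>; \<open>sep_total\<close> charges them to half of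
  \<open>D k l\<close>.\<close>

lemma total_margin_ge: "m\<^sup>2 * D k l / 4 \<le> total_margin (\<sigma>\<^sup>2 * real p + \<Lambda>) k l"
proof -
  let ?h = "\<lambda>a. noise_mean k a - noise_mean l a"
  have "total_margin (\<sigma>\<^sup>2 * real p + \<Lambda>) k l
      = m\<^sup>2 / 2 * (D k l + 2 * dot p ?h (d k l) + dot p ?h ?h) - m * (\<sigma>\<^sup>2 * real p + \<Lambda>)"
    unfolding total_margin_def center_eq[OF k] center_eq[OF l] D_def d_def dot_simps
    using dot_commute[of p "\<mu> k" "\<mu> l"] dot_commute[of p "\<mu> k" "noise_mean k"]
      dot_commute[of p "\<mu> k" "noise_mean l"] dot_commute[of p "\<mu> l" "noise_mean k"]
      dot_commute[of p "\<mu> l" "noise_mean l"] dot_commute[of p "noise_mean k" "noise_mean l"]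
    by (simp add: algebra_simps)
  also have "m * (\<sigma>\<^sup>2 * real p + \<Lambda>) = m\<^sup>2 / 2 * (2 * \<sigma>\<^sup>2 * (real p / m) + 2 * \<Lambda> / m)"
    using m_pos by (simp add: power2_eq_square field_simps)
  finally have "total_margin (\<sigma>\<^sup>2 * real p + \<Lambda>) k l = m\<^sup>2 / 2 *
      (D k l + 2 * dot p ?h (d k l) + dot p ?h ?h - (2 * \<sigma>\<^sup>2 * (real p / m) + 2 * \<Lambda> / m))"
    by (simp add: right_diff_distrib)
  also have "\<dots> \<ge> m\<^sup>2 / 2 * (D k l / 2)"
    using mean_diff_proj mean_diff_sq sep_total[OF k l kl] unfolding abs_le_iff
    by (intro mult_left_mono) (linarith, simp)
  finally show ?thesis by simp
qed

text \<open>Since \<open>v\<close> sums to zero over the cluster, its center disappears and a noise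
  combination against the difference of the empirical centers remains. It splits into a part along
  \<open>d k l\<close> and a part against the noise means. The expected value of the latter is a
  multiple of the sum of \<open>v\<close>, hence 0, so that only the deviation
  \<open>\<gamma>\<close> counts.\<close>

lemma cross_bound:
  assumes v: "(\<Sum>i\<in>cluster k. v i) = 0"
  shows "(m * (\<Sum>i\<in>cluster k. v i * (dot p (\<lambda>a. \<mu> (c i) a + e i a) (center k)
        - dot p (\<lambda>a. \<mu> (c i) a + e i a) (center l))))\<^sup>2
    \<le> S * total_margin (\<sigma>\<^sup>2 * real p + \<Lambda>) k l * (\<Sum>i\<in>cluster k. (v i)\<^sup>2)"
proof -
  define v' where "v' i = (if c i = k then v i else 0)" for i
  have v': "i \<in> cluster k \<Longrightarrow> v' i = v i" "i \<in> cluster l \<Longrightarrow> v' i = 0" for i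
    using kl by (auto simp: v'_def in_cluster)
  let ?f = "dot p (noise_comb k l v') (d k l)"
  let ?g = "dot p (noise_comb k l v') (noise_comb k l (\<lambda>i. uk i - ul i))"
  define V where "V = (\<Sum>i\<in>cluster k. (v i)\<^sup>2)"
  have V: "(\<Sum>i\<in>cluster k \<union> cluster l. (v' i)\<^sup>2) = V"
    by (simp add: sum_pair v' V_def cong: sum.cong)
  have V0: "0 \<le> V" by (simp add: V_def sum_nonneg)
  have D: "0 \<le> D k l" by (simp add: D_def dot_self_nonneg)
  define h where "h = (\<lambda>a. center k a - center l a)"
  have h: "h = (\<lambda>a. d k l a + (noise_mean k a - noise_mean l a))"
    unfolding h_def center_eq[OF k] center_eq[OF l] by (simp add: d_def algebra_simps)
  have comb_v: "(\<lambda>a. \<Sum>i\<in>cluster k. v i * e i a) = noise_comb k l v'"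
    by (simp add: noise_comb_def[abs_def] sum_pair v' cong: sum.cong)
  have "(\<Sum>i\<in>cluster k. v i * (dot p (\<lambda>a. \<mu> (c i) a + e i a) (center k)
        - dot p (\<lambda>a. \<mu> (c i) a + e i a) (center l))) = (\<Sum>i\<in>cluster k. v i * dot p (\<mu> k) h + v i * dot p (e i) h)"
    by (intro sum.cong refl) (auto simp: in_cluster h_def dot_simps algebra_simps)
  also have "\<dots> = dot p (\<lambda>a. \<Sum>i\<in>cluster k. v i * e i a) h"
    using v by (simp add: sum.distrib dot_simps flip: sum_distrib_right)
  also have "\<dots> = ?f + ?g"
    unfolding comb_v h comb_diff comb_uk comb_ul dot_add_right ..
  finally have eq: "(\<Sum>i\<in>cluster k. v i * (dot p (\<lambda>a. \<mu> (c i) a + e i a) (center k)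
        - dot p (\<lambda>a. \<mu> (c i) a + e i a) (center l)))
      = ?f + ?g" .
  have a: "(?f)\<^sup>2 \<le> 16 * \<sigma>\<^sup>2 * m * D k l * V"
  proof -
    have "\<bar>?f\<bar>\<^sup>2 \<le> (4 * \<sigma> * sqrt (D k l) * sqrt (m * V))\<^sup>2"
      by (intro power_mono comb_proj[OF eq_refl[OF V]]) simp
    also have "\<dots> = 16 * \<sigma>\<^sup>2 * m * D k l * V"
      using D V0 m_pos by (simp add: power_mult_distrib)
    finally show ?thesis by simp
  qed
  have "(\<Sum>i\<in>cluster k \<union> cluster l. v' i * (uk i - ul i)) = (\<Sum>i\<in>cluster k. v i * (1 / m))"
    by (simp add: sum_pair v' uk_simps ul_simps cong: sum.cong)
  also have "\<dots> = 0" using v unfolding sum_distrib_right[symmetric] by simp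
  finally have "\<bar>?g\<bar> \<le> m * \<gamma> * sqrt V * sqrt (2 / m)"
    using comb_gram[of v' "\<lambda>i. uk i - ul i"] by (simp add: V diff_sq)
  then have "\<bar>?g\<bar>\<^sup>2 \<le> (m * \<gamma> * sqrt V * sqrt (2 / m))\<^sup>2"
    by (intro power_mono) auto
  also have "\<dots> = m\<^sup>2 * \<gamma>\<^sup>2 * V * (2 / m)"
    using m_pos V0 by (simp add: power_mult_distrib)
  also have "\<dots> = 2 * \<gamma>\<^sup>2 * m * V"
    using m_pos by (simp add: power2_eq_square)
  finally have b: "(?g)\<^sup>2 \<le> 2 * \<gamma>\<^sup>2 * m * V" by simp
  have "(f + g)\<^sup>2 \<le> 2 * f\<^sup>2 + 2 * g\<^sup>2" for f g :: real
    using zero_le_power2[of "f - g"] by (simp add: power2_sum power2_diff)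
  from this[of "?f" "?g"] a b
  have "(?f + ?g)\<^sup>2
      \<le> 32 * \<sigma>\<^sup>2 * m * D k l * V + 4 * \<gamma>\<^sup>2 * m * V" by linarith
  \<comment> \<open>The factor 1 / 4 is that of \<open>total_margin_ge\<close>; it explains 128 = 4
    * 32 and 16 = 4 * 4 in \<open>sep_cross\<close>.\<close>
  also have "\<dots> = (128 * \<sigma>\<^sup>2 * m * D k l + 16 * \<gamma>\<^sup>2 * m) * (V / 4)" by (simp add: algebra_simps)
  also have "\<dots> \<le> S * D k l * (V / 4)"
    using sep_cross[OF k l kl] V0 by (intro mult_right_mono) auto
  finally have "m\<^sup>2 * (?f + ?g)\<^sup>2
      \<le> m\<^sup>2 * (S * D k l * (V / 4))" by (intro mult_left_mono) auto
  also have "\<dots> = S * V * (m\<^sup>2 * D k l / 4)" by simp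
  also have "\<dots> \<le> S * V * total_margin (\<sigma>\<^sup>2 * real p + \<Lambda>) k l"
    using S V0 by (intro mult_left_mono total_margin_ge) auto
  finally show ?thesis unfolding eq V_def by (simp add: power_mult_distrib mult_ac)
qed

text \<open>Write a and b for the noise means of clusters k and l. With the vector \<open>w\<close>
  of \<open>indep\<close>, the margin is m / 2 times D + 2 <e_i, w> + 2 |e_i|^2 / m + |b|^2 - |a|^2
  - 2 <b, d>, minus the multiplier. The term 2 |e_i|^2 / m is what leaving \<open>e i\<close> out of
  its own cluster mean sets free; its mean 2 \<sigma>^2 p / m is cancelled by the multiplier, and
  <e_i, w> is the only large fluctuation left.\<close>

lemma margin_pos:
  assumes i: "i < n" "c i = k"
  shows "0 < margin (\<sigma>\<^sup>2 * real p + \<Lambda>) i l"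
proof -
  let ?W = "D k l + 12 * \<sigma> * sqrt (D k l) + 2 * \<sigma>\<^sup>2 * (real p / m) + 2 * \<gamma>"
  let ?b = "dot p (noise_mean l) (noise_mean l) - dot p (noise_mean k) (noise_mean k)"
  have iJ: "i \<in> cluster k" "i \<notin> cluster l" using i kl by (auto simp: in_cluster)
  define u where "u j = (if j = i then 1 else 0 :: real)" for j
  have u: "(\<Sum>j\<in>cluster k \<union> cluster l. f j * u j) = f i" for f
  proof -
    have "(\<Sum>j\<in>cluster k \<union> cluster l. f j * u j) = (\<Sum>j\<in>cluster k \<union> cluster l. if j = i then f j else 0)"
      by (intro sum.cong) (auto simp: u_def)
    then show ?thesis using iJ by simp
  qed
  have u_sq: "(\<Sum>j\<in>cluster k \<union> cluster l. (u j)\<^sup>2) = 1"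
    using u[of u] by (simp add: power2_eq_square) (simp add: u_def)
  have comb_u: "noise_comb k l u = e i"
  proof
    show "noise_comb k l u a = e i a" for a
      using u[of "\<lambda>j. e j a"] by (simp add: noise_comb_def mult.commute)
  qed
  \<comment> \<open>Doubled and divided by \<open>m\<close>, this costs \<open>2 * \<gamma>\<close>;
    the squared norms of the two noise means cost \<open>\<gamma>\<close> each, whence
    \<open>4 * \<gamma>\<close> in \<open>sep_margin\<close>.\<close>
  have e_sq: "real p * \<sigma>\<^sup>2 - m * \<gamma> \<le> dot p (e i) (e i)"
    using comb_sq[OF u_sq] by (simp add: comb_u abs_le_iff)
  \<comment> \<open>The coefficients of the difference of the noise means, with the share of
    \<open>i\<close> itself removed.\<close>
  define w0 where "w0 j = uk j - ul j - u j / m" for j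
  have w0_sq: "(\<Sum>j\<in>cluster k \<union> cluster l. (w0 j)\<^sup>2) \<le> 2 / m"
    unfolding diff_sq[symmetric]
  proof (rule sum_mono)
    fix j assume "j \<in> cluster k \<union> cluster l"
    then show "(w0 j)\<^sup>2 \<le> (uk j - ul j)\<^sup>2"
      using iJ by (auto simp: w0_def u_def uk_simps ul_simps)
  qed
  define h where "h = noise_comb k l w0"
  have h: "h = (\<lambda>a. noise_mean k a - noise_mean l a - e i a / m)"
  proof -
    have "h = (\<lambda>a. noise_comb k l uk a - noise_comb k l ul a - noise_comb k l u a / m)"
      by (simp add: h_def w0_def[abs_def] noise_comb_def[abs_def] left_diff_distrib sum_subtractf sum_divide_distrib)
    then show ?thesis by (simp add: comb_uk comb_ul comb_u)
  qed
  have h_sq: "dot p h h \<le> 2 * \<sigma>\<^sup>2 * (real p / m) + 2 * \<gamma>"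
  proof -
    define b where "b = (\<Sum>j\<in>cluster k \<union> cluster l. (w0 j)\<^sup>2)"
    have "dot p h h \<le> (real p * \<sigma>\<^sup>2 + m * \<gamma>) * b"
      using comb_sq[of w0 b] by (simp add: h_def b_def abs_le_iff algebra_simps)
    also have "\<dots> \<le> (real p * \<sigma>\<^sup>2 + m * \<gamma>) * (2 / m)"
      using w0_sq \<gamma> m_pos by (intro mult_left_mono) (auto simp: b_def)
    also have "\<dots> = 2 * \<sigma>\<^sup>2 * (real p / m) + 2 * \<gamma>" using m_pos by (simp add: field_simps)
    finally show ?thesis .
  qed
  have h_proj: "\<bar>dot p h (d k l)\<bar> \<le> 6 * \<sigma> * sqrt (D k l)"
    using comb_proj[OF w0_sq] sqrt2_proj unfolding h_def by linarith
  define w where "w = (\<lambda>a. d k l a + h a)"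
  have w: "w = (\<lambda>a. d (c i) l a + (\<Sum>j\<in>cluster (c i) - {i}. e j a) / m - (\<Sum>j\<in>cluster l. e j a) / m)"
    using iJ unfolding w_def h i(2) noise_mean_def
    by (simp add: sum_diff1 diff_divide_distrib algebra_simps)
  have w_sq: "dot p w w \<le> ?W"
  proof -
    have "dot p w w = D k l + 2 * dot p h (d k l) + dot p h h"
      unfolding w_def dot_simps D_def by (simp add: dot_commute[of p "d k l" h])
    then show ?thesis using h_proj h_sq unfolding abs_le_iff by linarith
  qed
  have ew: "- (\<sigma> * \<tau> * sqrt (?W)) \<le> dot p (e i) w"
  proof -
    have "\<sigma> * \<tau> * sqrt (dot p w w) \<le> \<sigma> * \<tau> * sqrt (?W)"
      using w_sq \<sigma> \<tau> by (intro mult_left_mono) auto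
    moreover have "- (\<sigma> * \<tau> * sqrt (dot p w w)) \<le> dot p (e i) w"
      using indep[OF i(1) l _ w] i kl by (simp add: mult_ac)
    ultimately show ?thesis by linarith
  qed
  have "margin (\<sigma>\<^sup>2 * real p + \<Lambda>) i l = m / 2 * (D k l + 2 * dot p (e i) w + 2 * (dot p (e i) (e i) / m)
      + (?b)
      - 2 * dot p (noise_mean l) (d k l)) - (\<sigma>\<^sup>2 * real p + \<Lambda>)"
  proof -
    have ei: "dot p (e i) w = dot p (e i) (d k l) + dot p (e i) (noise_mean k) - dot p (e i) (noise_mean l)
        - dot p (e i) (e i) / m"
    proof -
      have "w = (\<lambda>a. d k l a + (noise_mean k a - noise_mean l a - (1 / m) * e i a))"
        by (simp add: w_def h)
      then show ?thesis by (simp only: dot_simps) simp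
    qed
    show ?thesis
      unfolding margin_def i(2) center_eq[OF k] center_eq[OF l] D_def d_def dot_simps ei
      using dot_commute[of p "\<mu> k" "\<mu> l"] dot_commute[of p "\<mu> k" "noise_mean k"]
        dot_commute[of p "\<mu> k" "noise_mean l"] dot_commute[of p "\<mu> l" "noise_mean k"]
        dot_commute[of p "\<mu> l" "noise_mean l"] dot_commute[of p "noise_mean k" "noise_mean l"]
      by (simp add: algebra_simps)
  qed
  also have "\<sigma>\<^sup>2 * real p + \<Lambda> = m / 2 * (2 * \<sigma>\<^sup>2 * (real p / m) + 2 * \<Lambda> / m)"
    using m_pos by (simp add: field_simps)
  finally have eq: "margin (\<sigma>\<^sup>2 * real p + \<Lambda>) i l = m / 2 * (D k l + 2 * dot p (e i) w + 2 * (dot p (e i) (e i) / m)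
      + (?b)
      - 2 * dot p (noise_mean l) (d k l) - (2 * \<sigma>\<^sup>2 * (real p / m) + 2 * \<Lambda> / m))"
    using \<open>\<sigma>\<^sup>2 * real p + \<Lambda> = m / 2 * (2 * \<sigma>\<^sup>2 * (real p / m) + 2 * \<Lambda> / m)\<close> by (simp only: right_diff_distrib)
  have "(real p * \<sigma>\<^sup>2 - m * \<gamma>) / m \<le> dot p (e i) (e i) / m"
    using e_sq m_pos by (intro divide_right_mono) auto
  then have "\<sigma>\<^sup>2 * (real p / m) - \<gamma> \<le> dot p (e i) (e i) / m"
    using m_pos by (simp add: diff_divide_distrib mult.commute)
  moreover have "2 * (\<sigma> * \<tau> * sqrt (?W))
        + 4 * \<gamma> + 8 * \<sigma> * sqrt (D k l) + 2 * \<Lambda> / m < D k l"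
    using sep_margin[OF k l kl] by (simp only: mult.assoc)
  ultimately have "0 < D k l + 2 * dot p (e i) w + 2 * (dot p (e i) (e i) / m)
      + (?b)
      - 2 * dot p (noise_mean l) (d k l) - (2 * \<sigma>\<^sup>2 * (real p / m) + 2 * \<Lambda> / m)"
    using ew mean_k_sq mean_l_sq mean_l_proj unfolding abs_le_iff by linarith
  then show ?thesis unfolding eq using m_pos by (intro mult_pos_pos) auto
qed

end

text \<open>Zero cluster sums remove the centers. The mean \<sigma>^2 p |v|^2 of the remaining noise
  term is matched by the first part of the multiplier, and \<open>gram_all\<close> fits its
  deviation together with \<open>S * real K\<close> into \<open>\<Lambda>\<close>.\<close>

lemma spread_bound:
  assumes "\<And>k. k < K \<Longrightarrow> (\<Sum>i\<in>cluster k. v i) = 0"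
  shows "dot p (\<lambda>a. \<Sum>i<n. v i * (\<mu> (c i) a + e i a)) (\<lambda>a. \<Sum>i<n. v i * (\<mu> (c i) a + e i a))
      + S * real K * (\<Sum>i<n. (v i)\<^sup>2) \<le> (\<sigma>\<^sup>2 * real p + \<Lambda>) * (\<Sum>i<n. (v i)\<^sup>2)"
proof -
  have "(\<Sum>i<n. v i * (\<mu> (c i) a + e i a)) = (\<Sum>i<n. v i * e i a)" for a
  proof -
    have "(\<Sum>i<n. v i * \<mu> (c i) a) = (\<Sum>k<K. \<Sum>i\<in>cluster k. v i * \<mu> k a)"
      unfolding sum_clusters by (intro sum.cong refl) (auto simp: in_cluster)
    also have "\<dots> = 0" using assms by (simp flip: sum_distrib_right)
    finally show ?thesis by (simp add: distrib_left sum.distrib)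
  qed
  moreover have "dot p (\<lambda>a. \<Sum>i<n. v i * e i a) (\<lambda>a. \<Sum>i<n. v i * e i a)
      = gram_dev p (\<sigma>\<^sup>2) {..<n} e v v + real p * \<sigma>\<^sup>2 * (\<Sum>i<n. (v i)\<^sup>2)"
    by (simp add: gram_dev_def dot_def power2_eq_square)
  ultimately show ?thesis using gram_all[of v] by (simp add: algebra_simps)
qed

theorem good_noise_unique_optimum:
  fixes Z :: "nat \<Rightarrow> nat \<Rightarrow> real"
  defines "x \<equiv> \<lambda>i a. \<mu> (c i) a + e i a" and "Zs \<equiv> \<lambda>i j. if c i = c j then 1 / m else 0"
  assumes Z: "\<And>i j. i < n \<Longrightarrow> j < n \<Longrightarrow> Z i j = Z j i"
    "\<And>v. 0 \<le> (\<Sum>i<n. \<Sum>j<n. v i * Z i j * v j)"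
    "\<And>i. i < n \<Longrightarrow> (\<Sum>j<n. Z i j) = 1"
    "(\<Sum>i<n. Z i i) = real K"
    "\<And>i j. i < n \<Longrightarrow> j < n \<Longrightarrow> 0 \<le> Z i j"
    and le: "(\<Sum>i<n. \<Sum>j<n. dot p (x i) (x j) * Zs i j) \<le> (\<Sum>i<n. \<Sum>j<n. dot p (x i) (x j) * Z i j)"
    and ij: "i < n" "j < n"
  shows "Z i j = Zs i j"
  unfolding Zs_def
proof (rule true_clustering_unique_optimum[where \<rho>="\<sigma>\<^sup>2 * real p + \<Lambda>" and S=S])
  show "0 < margin (\<sigma>\<^sup>2 * real p + \<Lambda>) i l" if "i < n" "l < K" "l \<noteq> c i" for i l
    using margin_pos[OF c_less[OF that(1)] that(2)] that by auto
qed (use S cross_bound spread_bound Z le ij in \<open>simp_all add: x_def Zs_def\<close>)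

end

section \<open>The separation inequality\<close>

text \<open>Here \<open>L\<close> is ln n, \<open>q\<close> is p / m, \<open>k\<close> is K,
  \<open>D\<close> is a squared distance of centers, \<open>g\<close> stands for
  \<open>\<gamma>\<close> and \<open>h\<close> for \<open>\<Lambda> / m\<close>. In units of
  \<open>\<theta> * D\<close>, the errors \<open>\<sigma> * sqrt D\<close>, \<open>g\<close> and
  \<open>h\<close> are at most 1 / 2, \<open>C0 / 2\<close> and \<open>C1 / 4\<close>. The weight
  \<open>2 * C0 + 6 + C1\<close> dominates every combination that occurs, so each of these is at
  most \<open>\<alpha> / 8 * D\<close>.\<close>

lemma separation_bounds:
  fixes \<alpha> \<sigma> L q D k \<theta> C0 C1 :: real
  assumes \<alpha>: "0 < \<alpha>" "\<alpha> \<le> 1 / 2" and \<sigma>: "0 < \<sigma>" and q: "0 \<le> q"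
    and D: "(1 + \<alpha>) * (4 * \<sigma>\<^sup>2 * (L + sqrt (L\<^sup>2 + L * q))) \<le> D"
    and \<theta>: "0 < \<theta>" "\<theta> * (2 * C0 + 6 + C1) \<le> \<alpha> / 8" and C: "0 \<le> C0" "0 \<le> C1"
    and L: "1 \<le> \<theta>\<^sup>2 * L" and k: "0 \<le> k" "k \<le> \<theta>\<^sup>2 * L"
  defines "g \<equiv> 2 * C0 * \<sigma>\<^sup>2 * (1 + sqrt q)" and "h \<equiv> C1 * \<sigma>\<^sup>2 * (k + sqrt (k * q))"
  shows "4 * \<sigma>\<^sup>2 * (L + sqrt (L * q)) \<le> D" "1 \<le> L"
    and "12 * \<sigma> * sqrt D + 2 * g + 2 * h \<le> D / 2"
    and "2 * \<sigma> * sqrt (2 * (1 + \<alpha> / 8) * L) * sqrt (D + 12 * \<sigma> * sqrt D + 2 * \<sigma>\<^sup>2 * q + 2 * g)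
      + 4 * g + 8 * \<sigma> * sqrt D + 2 * h < D"
proof -
  define T where "T = 4 * \<sigma>\<^sup>2 * (L + sqrt (L\<^sup>2 + L * q))"
  have "\<theta> * 6 \<le> \<theta> * (2 * C0 + 6 + C1)" using \<theta> C by (intro mult_left_mono) auto
  then have \<theta>1: "\<theta> \<le> 1" using \<theta> \<alpha> by linarith
  then have "\<theta>\<^sup>2 \<le> 1" using \<theta> by (simp add: power_le_one)
  have L0: "0 < L" using L \<theta> by (smt (verit) mult_nonneg_nonpos zero_le_power2)
  then have "\<theta>\<^sup>2 * L \<le> 1 * L" using \<open>\<theta>\<^sup>2 \<le> 1\<close> by (intro mult_right_mono) auto
  then show L1: "1 \<le> L" using L by simp
  have "0 \<le> T" using L0 q by (simp add: T_def)
  have "sqrt (L * q) \<le> sqrt (L\<^sup>2 + L * q)" by simp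
  then have "4 * \<sigma>\<^sup>2 * (L + sqrt (L * q)) \<le> T" unfolding T_def by (intro mult_left_mono) auto
  also have TD': "(1 + \<alpha>) * T \<le> D" using D by (simp add: T_def)
  have "T \<le> (1 + \<alpha>) * T" using \<open>0 \<le> T\<close> \<alpha> by (simp add: mult_right_mono distrib_right)
  then have TD: "T \<le> D" using TD' by simp
  finally show DL: "4 * \<sigma>\<^sup>2 * (L + sqrt (L * q)) \<le> D" .
  have Lq: "0 \<le> sqrt (L * q)" using L0 q by simp
  have "4 * \<sigma>\<^sup>2 * L \<le> 4 * \<sigma>\<^sup>2 * (L + sqrt (L * q))" using Lq by (intro mult_left_mono) auto
  then have D4L: "4 * \<sigma>\<^sup>2 * L \<le> D" using DL by simp
  have D0: "0 < D" using D4L L0 \<sigma> by (smt (verit) mult_pos_pos zero_less_power)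
  have sL: "1 \<le> \<theta> * sqrt L"
    using real_sqrt_le_mono[OF L] \<theta> by (simp add: real_sqrt_mult)
  have a: "\<sigma> * sqrt D \<le> \<theta> * D / 2"
  proof -
    have "2 * \<sigma> * sqrt L \<le> sqrt D"
      using real_sqrt_le_mono[OF D4L] \<sigma> by (simp add: real_sqrt_mult)
    then have "\<theta> * (2 * \<sigma> * sqrt L) \<le> \<theta> * sqrt D" using \<theta> by (intro mult_left_mono) auto
    moreover have "2 * \<sigma> * 1 \<le> 2 * \<sigma> * (\<theta> * sqrt L)" using sL \<sigma> by (intro mult_left_mono) auto
    ultimately have "2 * \<sigma> \<le> \<theta> * sqrt D" by (simp add: mult_ac)
    then have "2 * \<sigma> * sqrt D \<le> \<theta> * sqrt D * sqrt D" using D0 by (intro mult_right_mono) auto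
    then show ?thesis using D0 by (simp add: mult.assoc)
  qed
  have b: "g \<le> C0 * \<theta> * D / 2"
  proof -
    have "1 \<le> \<theta> * L"
    proof -
      have "\<theta>\<^sup>2 * L \<le> \<theta> * L" using \<theta> \<theta>1 L0 by (intro mult_right_mono) (auto simp: power2_eq_square)
      then show ?thesis using L by simp
    qed
    moreover have "1 * sqrt q \<le> (\<theta> * sqrt L) * sqrt q" using sL q by (intro mult_right_mono) auto
    ultimately have "1 + sqrt q \<le> \<theta> * (L + sqrt (L * q))" by (simp add: real_sqrt_mult distrib_left)
    then have "2 * C0 * \<sigma>\<^sup>2 * (1 + sqrt q) \<le> 2 * C0 * \<sigma>\<^sup>2 * (\<theta> * (L + sqrt (L * q)))"
      using C by (intro mult_left_mono) auto
    also have "\<dots> = C0 * \<theta> / 2 * (4 * \<sigma>\<^sup>2 * (L + sqrt (L * q)))" by simp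
    also have "\<dots> \<le> C0 * \<theta> / 2 * D" using DL C \<theta> by (intro mult_left_mono) auto
    finally show ?thesis by (simp add: g_def)
  qed
  \<comment> \<open>The square in \<open>k \<le> \<theta>\<^sup>2 * L\<close> is needed for the
    second summand of \<open>h\<close>, where only its root is gained.\<close>
  have h: "h \<le> C1 * \<theta> * D / 4"
  proof -
    have "\<theta>\<^sup>2 * L \<le> \<theta> * L" using \<theta> \<theta>1 L0 by (intro mult_right_mono) (auto simp: power2_eq_square)
    then have "k \<le> \<theta> * L" using k by simp
    moreover have "sqrt (k * q) \<le> \<theta> * sqrt (L * q)"
    proof -
      have "k * q \<le> \<theta>\<^sup>2 * L * q" using k q by (intro mult_right_mono) auto
      then have "sqrt (k * q) \<le> sqrt (\<theta>\<^sup>2 * L * q)" by (rule real_sqrt_le_mono)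
      then show ?thesis using \<theta> by (simp add: real_sqrt_mult)
    qed
    ultimately have "k + sqrt (k * q) \<le> \<theta> * (L + sqrt (L * q))" by (simp add: distrib_left)
    then have "h \<le> C1 * \<sigma>\<^sup>2 * (\<theta> * (L + sqrt (L * q)))"
      unfolding h_def using C by (intro mult_left_mono) auto
    also have "\<dots> = C1 * \<theta> / 4 * (4 * \<sigma>\<^sup>2 * (L + sqrt (L * q)))" by simp
    also have "\<dots> \<le> C1 * \<theta> / 4 * D" using DL C \<theta> by (intro mult_left_mono) auto
    finally show ?thesis by simp
  qed
  have err: "\<theta> * D * (2 * C0 + 6 + C1) \<le> \<alpha> / 8 * D"
    using mult_right_mono[OF \<theta>(2), of D] D0 by (simp add: mult_ac)
  have C\<theta>D: "0 \<le> C0 * \<theta> * D" "0 \<le> C1 * \<theta> * D" "0 \<le> \<theta> * D" using C \<theta> D0 by simp_all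
  have err': "2 * (C0 * \<theta> * D) + 6 * (\<theta> * D) + C1 * \<theta> * D \<le> \<alpha> / 8 * D"
    using err by (simp add: algebra_simps)
  have aD: "\<alpha> / 8 * D \<le> D / 16" using \<alpha> D0 by simp
  show "12 * \<sigma> * sqrt D + 2 * g + 2 * h \<le> D / 2"
    using a b h err' C\<theta>D aD D0 by linarith
  have e1: "12 * \<sigma> * sqrt D + 2 * g \<le> \<alpha> / 8 * D"
    using a b err' C\<theta>D by linarith
  have e2: "4 * g + 8 * \<sigma> * sqrt D + 2 * h \<le> \<alpha> / 8 * D"
    using a b h err' C\<theta>D by linarith
  define \<eta> where "\<eta> = \<alpha> / 8"
  have \<eta>: "0 < \<eta>" "\<eta> \<le> 1 / 16" "\<alpha> = 8 * \<eta>" using \<alpha> by (auto simp: \<eta>_def)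
  define U where "U = D + 2 * \<sigma>\<^sup>2 * q"
  have U0: "0 < U" using D0 q by (simp add: U_def add_pos_nonneg)
  \<comment> \<open>\<open>T\<close> is the positive root of T^2 = 8 \<sigma>^2 L (T + 2 \<sigma>^2
    q). As D \<ge> T, the quotient U / D is at most (T + 2 \<sigma>^2 q) / T, so \<open>D\<close>
    satisfies the quadratic inequality with the factor \<open>1 + \<alpha>\<close> to spare.\<close>
  have quad: "(1 + \<alpha>) * (8 * \<sigma>\<^sup>2 * L * U) \<le> D\<^sup>2"
  proof -
    have "T\<^sup>2 = 8 * \<sigma>\<^sup>2 * L * (T + 2 * \<sigma>\<^sup>2 * q)"
    proof -
      have "(sqrt (L\<^sup>2 + L * q))\<^sup>2 = L\<^sup>2 + L * q" using L0 q by simp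
      then show ?thesis unfolding T_def by (simp add: power2_eq_square algebra_simps)
    qed
    moreover have "0 < T" using L0 \<sigma> q by (simp add: T_def add_pos_nonneg)
    ultimately have TT: "T * T = 8 * \<sigma>\<^sup>2 * L * (T + 2 * \<sigma>\<^sup>2 * q)" by (simp add: power2_eq_square)
    have "T * (8 * \<sigma>\<^sup>2 * L * U) = 8 * \<sigma>\<^sup>2 * L * (T * D + 2 * \<sigma>\<^sup>2 * q * T)"
      by (simp add: U_def algebra_simps)
    also have "\<dots> \<le> 8 * \<sigma>\<^sup>2 * L * (T * D + 2 * \<sigma>\<^sup>2 * q * D)"
      using TD L0 q by (intro mult_left_mono add_mono order_refl) auto
    also have "\<dots> = (T * T) * D" unfolding TT by (simp add: algebra_simps)
    finally have "T * (8 * \<sigma>\<^sup>2 * L * U) \<le> T * (T * D)" by simp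
    then have "8 * \<sigma>\<^sup>2 * L * U \<le> T * D" using \<open>0 < T\<close> by (simp only: mult_le_cancel_left_pos)
    then have "(1 + \<alpha>) * (8 * \<sigma>\<^sup>2 * L * U) \<le> (1 + \<alpha>) * (T * D)" using \<alpha> by (intro mult_left_mono) auto
    also have "\<dots> = ((1 + \<alpha>) * T) * D" by simp
    also have "\<dots> \<le> D * D" using TD' D0 by (intro mult_right_mono) auto
    finally show ?thesis by (simp add: power2_eq_square)
  qed
  have "2 * \<sigma> * sqrt (2 * (1 + \<eta>) * L) * sqrt (D + 12 * \<sigma> * sqrt D + 2 * \<sigma>\<^sup>2 * q + 2 * g)
      \<le> 2 * \<sigma> * sqrt (2 * (1 + \<eta>) * L) * sqrt ((1 + \<eta>) * U)"
  proof -
    have "(1 + \<eta>) * U = D + \<eta> * D + 2 * \<sigma>\<^sup>2 * q + \<eta> * (2 * \<sigma>\<^sup>2 * q)" by (simp add: U_def algebra_simps)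
    moreover have "0 \<le> \<eta> * (2 * \<sigma>\<^sup>2 * q)" using \<eta> q by simp
    ultimately have "D + 12 * \<sigma> * sqrt D + 2 * \<sigma>\<^sup>2 * q + 2 * g \<le> (1 + \<eta>) * U"
      using e1 unfolding \<eta>_def[symmetric] by linarith
    then show ?thesis using \<sigma> L0 \<eta> by (intro mult_left_mono) auto
  qed
  \<comment> \<open>One factor \<open>1 + \<eta>\<close> on the left belongs to the union bound, the
    other to the error in the radicand, and \<open>\<eta> * D\<close> is kept for the linear errors.
    With \<open>\<alpha> = 8 * \<eta>\<close> this is affordable, because (1 - \<eta>)^2 (1 + 8
    \<eta>) exceeds (1 + \<eta>)^2 by \<eta> (4 - 16 \<eta> + 8 \<eta>^2).\<close>
  also have "\<dots> < (1 - \<eta>) * D"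
  proof (rule power2_less_imp_less)
    have "(2 * \<sigma> * sqrt (2 * (1 + \<eta>) * L) * sqrt ((1 + \<eta>) * U))\<^sup>2 = (1 + \<eta>)\<^sup>2 * (8 * \<sigma>\<^sup>2 * L * U)"
      using \<eta> L0 U0 by (simp add: power_mult_distrib) (simp add: power2_eq_square)
    also have "\<dots> < ((1 - \<eta>)\<^sup>2 * (1 + \<alpha>)) * (8 * \<sigma>\<^sup>2 * L * U)"
    proof (rule mult_strict_right_mono)
      have "0 < \<eta> * (4 - 16 * \<eta> + 8 * \<eta>\<^sup>2)"
        using \<eta> by (intro mult_pos_pos add_pos_nonneg) auto
      also have "\<dots> = (1 - \<eta>)\<^sup>2 * (1 + \<alpha>) - (1 + \<eta>)\<^sup>2 + \<eta>\<^sup>2 * 0"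
        by (simp add: \<eta>(3) power2_eq_square algebra_simps)
      finally show "(1 + \<eta>)\<^sup>2 < (1 - \<eta>)\<^sup>2 * (1 + \<alpha>)" by simp
      show "0 < 8 * \<sigma>\<^sup>2 * L * U" using \<sigma> L0 U0 by simp
    qed
    also have "\<dots> \<le> (1 - \<eta>)\<^sup>2 * D\<^sup>2"
      using quad by (simp only: mult.assoc) (intro mult_left_mono, auto)
    finally show "(2 * \<sigma> * sqrt (2 * (1 + \<eta>) * L) * sqrt ((1 + \<eta>) * U))\<^sup>2 < ((1 - \<eta>) * D)\<^sup>2"
      by (simp add: power_mult_distrib)
  qed (use \<eta> D0 in auto)
  finally have "2 * \<sigma> * sqrt (2 * (1 + \<eta>) * L) * sqrt (D + 12 * \<sigma> * sqrt D + 2 * \<sigma>\<^sup>2 * q + 2 * g) < D - \<eta> * D"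
    by (simp add: left_diff_distrib)
  then show "2 * \<sigma> * sqrt (2 * (1 + \<alpha> / 8) * L) * sqrt (D + 12 * \<sigma> * sqrt D + 2 * \<sigma>\<^sup>2 * q + 2 * g)
      + 4 * g + 8 * \<sigma> * sqrt D + 2 * h < D"
    using e2 unfolding \<eta>_def[symmetric] by linarith
qed

text \<open>\<open>S\<close> is shaped so that, for k m = n and q = p / m, the product
  \<open>S * k\<close> has the order \<sigma>^2 (n + sqrt (n p)) of the Gram error. The term with
  \<open>g\<^sup>2\<close> fits because 4 \<sigma>^2 q \<le> sqrt (q / k) D, which follows from D
  \<ge> 4 \<sigma>^2 sqrt (L q) and k \<le> L.\<close>

lemma cross_term_bound:
  fixes \<sigma> L q D m k C0 :: real
  assumes \<sigma>: "0 < \<sigma>" and q: "0 \<le> q" and m: "0 < m" and k: "0 < k" "k \<le> L" and L: "1 \<le> L"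
    and D: "4 * \<sigma>\<^sup>2 * (L + sqrt (L * q)) \<le> D"
  defines "g \<equiv> 2 * C0 * \<sigma>\<^sup>2 * (1 + sqrt q)"
  defines "S \<equiv> \<sigma>\<^sup>2 * (128 + 32 * C0\<^sup>2) * m * (1 + sqrt (q / k))"
  shows "128 * \<sigma>\<^sup>2 * m * D + 16 * g\<^sup>2 * m \<le> S * D"
proof -
  have D1: "4 * \<sigma>\<^sup>2 \<le> D"
  proof -
    have "4 * \<sigma>\<^sup>2 * 1 \<le> 4 * \<sigma>\<^sup>2 * (L + sqrt (L * q))" using L q by (intro mult_left_mono) (auto simp: add_increasing2)
    then show ?thesis using D by simp
  qed
  have "0 \<le> D" using D1 by (smt (verit) zero_le_power2)
  have D2: "4 * \<sigma>\<^sup>2 * q \<le> sqrt (q / k) * D"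
  proof -
    have "sqrt (q / k) * sqrt (k * q) = q" using k q by (simp add: real_sqrt_mult real_sqrt_divide)
    then have "4 * \<sigma>\<^sup>2 * q = sqrt (q / k) * (4 * \<sigma>\<^sup>2 * sqrt (k * q))" by (metis mult.left_commute)
    also have "\<dots> \<le> sqrt (q / k) * (4 * \<sigma>\<^sup>2 * (L + sqrt (L * q)))"
    proof -
      have "sqrt (k * q) \<le> sqrt (L * q)" using k q by (intro real_sqrt_le_mono mult_right_mono) auto
      then have "sqrt (k * q) \<le> L + sqrt (L * q)" using L by linarith
      then show ?thesis using k q by (intro mult_left_mono) auto
    qed
    also have "\<dots> \<le> sqrt (q / k) * D" using D k q by (intro mult_left_mono) auto
    finally show ?thesis .
  qed
  have "(1 + sqrt q)\<^sup>2 \<le> 2 * (1 + q)"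
    using zero_le_power2[of "1 - sqrt q"] q by (simp add: power2_sum power2_diff)
  then have "16 * (4 * C0\<^sup>2 * \<sigma>\<^sup>2 * \<sigma>\<^sup>2) * (1 + sqrt q)\<^sup>2 \<le> 16 * (4 * C0\<^sup>2 * \<sigma>\<^sup>2 * \<sigma>\<^sup>2) * (2 * (1 + q))"
    by (intro mult_left_mono) auto
  also have "16 * (4 * C0\<^sup>2 * \<sigma>\<^sup>2 * \<sigma>\<^sup>2) * (1 + sqrt q)\<^sup>2 = 16 * g\<^sup>2"
    by (simp add: g_def power_mult_distrib power2_eq_square)
  also have "16 * (4 * C0\<^sup>2 * \<sigma>\<^sup>2 * \<sigma>\<^sup>2) * (2 * (1 + q)) = 32 * C0\<^sup>2 * \<sigma>\<^sup>2 * (4 * \<sigma>\<^sup>2 + 4 * \<sigma>\<^sup>2 * q)"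
    by (simp add: algebra_simps)
  also have "\<dots> \<le> 32 * C0\<^sup>2 * \<sigma>\<^sup>2 * (D + sqrt (q / k) * D)"
    using D1 D2 by (intro mult_left_mono) auto
  finally have "16 * g\<^sup>2 \<le> 32 * C0\<^sup>2 * \<sigma>\<^sup>2 * (D + sqrt (q / k) * D)" .
  moreover have "128 * \<sigma>\<^sup>2 * D \<le> 128 * \<sigma>\<^sup>2 * (D + sqrt (q / k) * D)"
    using \<open>0 \<le> D\<close> q k by (intro mult_left_mono) auto
  ultimately have "m * (128 * \<sigma>\<^sup>2 * D + 16 * g\<^sup>2)
      \<le> m * (128 * \<sigma>\<^sup>2 * (D + sqrt (q / k) * D) + 32 * C0\<^sup>2 * \<sigma>\<^sup>2 * (D + sqrt (q / k) * D))"
    using m by (intro mult_left_mono) auto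
  then show ?thesis by (simp add: S_def algebra_simps)
qed

section \<open>Measurability of exact recovery\<close>

text \<open>One point is picked from every set of a countable basis that meets
  \<open>S\<close>.\<close>

lemma countable_dense_subset:
  fixes S :: "'a::second_countable_topology set"
  obtains D where "countable D" "D \<subseteq> S" "S \<subseteq> closure D"
proof -
  obtain B :: "'a set set" where B: "countable B" "topological_basis B"
    using ex_countable_basis by blast
  define D where "D = (\<lambda>U. SOME x. x \<in> U \<inter> S) ` {U \<in> B. U \<inter> S \<noteq> {}}"
  have pick: "(SOME x. x \<in> U \<inter> S) \<in> U \<inter> S" if "U \<inter> S \<noteq> {}" for U
    using that by (metis ex_in_conv someI_ex)
  have "countable D" using B(1) by (simp add: D_def)
  moreover have "D \<subseteq> S" using pick by (auto simp: D_def)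
  moreover have "S \<subseteq> closure D"
  proof
    fix x assume "x \<in> S"
    show "x \<in> closure D"
      unfolding closure_iff_nhds_not_empty
    proof (intro allI impI)
      fix A V assume "V \<subseteq> A" "open V" "x \<in> V"
      from topological_basisE[OF B(2) \<open>open V\<close> \<open>x \<in> V\<close>] obtain U where
        U: "U \<in> B" "x \<in> U" "U \<subseteq> V" by blast
      then have ne: "U \<inter> S \<noteq> {}" using \<open>x \<in> S\<close> by auto
      then have "(SOME x. x \<in> U \<inter> S) \<in> D" using U by (auto simp: D_def)
      with pick[OF ne] U \<open>V \<subseteq> A\<close> show "D \<inter> A \<noteq> {}" by blast
    qed
  qed
  ultimately show ?thesis by (rule that)
qed

text \<open>A probability bound is void for a non-measurable event, whose measure is 0 by convention. By
  compactness the maximizer is unique iff the gap is bounded away from 0 outside every ball around it, which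
  can be tested on countable dense subsets.\<close>

lemma unique_maximizer_measurable:
  fixes F :: "('i::countable \<Rightarrow> real) set" and A :: "'a \<Rightarrow> 'i \<Rightarrow> real"
  assumes "compact F" "finite I" and [measurable]: "\<And>i. i \<in> I \<Longrightarrow> (\<lambda>\<omega>. A \<omega> i) \<in> borel_measurable M"
  shows "{\<omega>\<in>space M. \<forall>z\<in>F. z \<noteq> z0 \<longrightarrow> (\<Sum>i\<in>I. A \<omega> i * z i) < (\<Sum>i\<in>I. A \<omega> i * z0 i)} \<in> sets M"
proof -
  define \<phi> where "\<phi> \<omega> z = (\<Sum>i\<in>I. A \<omega> i * z i) - (\<Sum>i\<in>I. A \<omega> i * z0 i)" for \<omega> z
  \<comment> \<open>\<open>F\<close> without an open ball about \<open>z0\<close>; these compact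
    sets exhaust \<open>F\<close> minus \<open>z0\<close>.\<close>
  define Fr where "Fr r = F \<inter> {z. 1 / real (Suc r) \<le> dist z z0}" for r
  have "closed {z. 1 / real (Suc r) \<le> dist z z0}" for r
    by (intro closed_Collect_le continuous_intros)
  then have comp: "compact (Fr r)" for r
    unfolding Fr_def using \<open>compact F\<close> by (rule compact_Int_closed[rotated])
  have cont: "continuous_on UNIV (\<phi> \<omega>)" for \<omega>
    unfolding \<phi>_def[abs_def] by (intro continuous_intros continuous_on_product_coordinates)
  have "\<exists>D. countable D \<and> D \<subseteq> Fr r \<and> Fr r \<subseteq> closure D" for r
    by (rule countable_dense_subset[of "Fr r"]) blast
  then obtain D where D: "\<And>r. countable (D r)" "\<And>r. D r \<subseteq> Fr r" "\<And>r. Fr r \<subseteq> closure (D r)"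
    by metis
  \<comment> \<open>From left to right, the maximum over the compact set \<open>Fr r\<close> is
    attained and negative. From right to left, the bound extends from \<open>D r\<close> to its
    closure because it is not strict.\<close>
  have eq: "(\<forall>z\<in>F. z \<noteq> z0 \<longrightarrow> \<phi> \<omega> z < 0) \<longleftrightarrow> (\<forall>r. \<exists>s. \<forall>z\<in>D r. \<phi> \<omega> z \<le> - (1 / real (Suc s)))" for \<omega>
  proof
    assume L: "\<forall>z\<in>F. z \<noteq> z0 \<longrightarrow> \<phi> \<omega> z < 0"
    show "\<forall>r. \<exists>s. \<forall>z\<in>D r. \<phi> \<omega> z \<le> - (1 / real (Suc s))"
    proof
      fix r
      show "\<exists>s. \<forall>z\<in>D r. \<phi> \<omega> z \<le> - (1 / real (Suc s))"
      proof (cases "Fr r = {}")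
        case True
        then show ?thesis using D(2)[of r] by auto
      next
        case False
        obtain y where y: "y \<in> Fr r" "\<And>z. z \<in> Fr r \<Longrightarrow> \<phi> \<omega> z \<le> \<phi> \<omega> y"
          using continuous_attains_sup[OF comp False continuous_on_subset[OF cont subset_UNIV]] by blast
        have "y \<noteq> z0" using y(1) by (auto simp: Fr_def)
        then have "0 < - \<phi> \<omega> y" using L y(1) by (auto simp: Fr_def)
        then obtain s where "inverse (real (Suc s)) < - \<phi> \<omega> y" using reals_Archimedean by blast
        then have "\<forall>z\<in>D r. \<phi> \<omega> z \<le> - (1 / real (Suc s))"
          using y(2) D(2)[of r] by (fastforce simp: inverse_eq_divide)
        then show ?thesis by blast
      qed
    qed
  next
    assume R: "\<forall>r. \<exists>s. \<forall>z\<in>D r. \<phi> \<omega> z \<le> - (1 / real (Suc s))"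
    show "\<forall>z\<in>F. z \<noteq> z0 \<longrightarrow> \<phi> \<omega> z < 0"
    proof (intro ballI impI)
      fix z assume z: "z \<in> F" "z \<noteq> z0"
      then obtain r where "inverse (real (Suc r)) < dist z z0"
        using reals_Archimedean[of "dist z z0"] by auto
      then have "z \<in> Fr r" using z by (simp add: Fr_def inverse_eq_divide)
      then have zD: "z \<in> closure (D r)" using D(3) by blast
      obtain s where s: "\<forall>z\<in>D r. \<phi> \<omega> z \<le> - (1 / real (Suc s))" using R by blast
      have "closed {z. \<phi> \<omega> z \<le> - (1 / real (Suc s))}"
        by (intro closed_Collect_le cont continuous_on_const)
      then have "closure (D r) \<subseteq> {z. \<phi> \<omega> z \<le> - (1 / real (Suc s))}"
        using s by (intro closure_minimal) auto
      then have "\<phi> \<omega> z \<le> - (1 / real (Suc s))" using zD by blast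
      also have "\<dots> < 0" by simp
      finally show "\<phi> \<omega> z < 0" .
    qed
  qed
  have "(\<lambda>\<omega>. \<phi> \<omega> z) \<in> borel_measurable M" for z
    unfolding \<phi>_def by measurable
  then have "{\<omega>\<in>space M. \<forall>r. \<exists>s. \<forall>z\<in>D r. \<phi> \<omega> z \<le> - (1 / real (Suc s))} \<in> sets M"
    using D(1) by (intro sets.sets_Collect_countable_All sets.sets_Collect_countable_Ex
        sets.sets_Collect_countable_Ball) (auto simp: borel_measurable_iff_le)
  then show ?thesis unfolding eq[symmetric] by (simp add: \<phi>_def)
qed

section \<open>The feasible set as a compact set of functions\<close>

definition feasible_fun :: "nat \<Rightarrow> nat \<Rightarrow> (nat \<Rightarrow> nat \<Rightarrow> real) \<Rightarrow> bool" where
  "feasible_fun n K z \<longleftrightarrow> (\<forall>v. 0 \<le> (\<Sum>i<n. \<Sum>j<n. v i * z i j * v j)) \<and>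
     (\<forall>i<n. \<forall>j<n. z i j = z j i) \<and> (\<Sum>i<n. z i i) = real K \<and>
     (\<forall>i<n. (\<Sum>j<n. z i j) = 1) \<and> (\<forall>i<n. \<forall>j<n. 0 \<le> z i j)"

lemma pos_semidef_iff:
  assumes "Z \<in> carrier_mat n n"
  shows "pos_semidef n Z \<longleftrightarrow> (\<forall>v. 0 \<le> (\<Sum>i<n. \<Sum>j<n. v i * Z $$ (i, j) * v j))"
proof -
  have quad: "v \<bullet> (Z *\<^sub>v v) = (\<Sum>i<n. \<Sum>j<n. v $ i * Z $$ (i, j) * v $ j)" if "v \<in> carrier_vec n" for v
    using assms that by (simp add: scalar_prod_def atLeast0LessThan sum_distrib_left mult.assoc)
  show ?thesis
  proof
    assume *: "pos_semidef n Z"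
    show "\<forall>v. 0 \<le> (\<Sum>i<n. \<Sum>j<n. v i * Z $$ (i, j) * v j)"
    proof
      fix v :: "nat \<Rightarrow> real"
      have "0 \<le> vec n v \<bullet> (Z *\<^sub>v vec n v)" using * by (simp add: pos_semidef_def)
      then show "0 \<le> (\<Sum>i<n. \<Sum>j<n. v i * Z $$ (i, j) * v j)" by (simp add: quad)
    qed
  next
    assume "\<forall>v. 0 \<le> (\<Sum>i<n. \<Sum>j<n. v i * Z $$ (i, j) * v j)"
    then show "pos_semidef n Z" by (simp add: pos_semidef_def quad)
  qed
qed

lemma sdp_feasible_iff:
  assumes Z: "Z \<in> carrier_mat n n"
  shows "Z \<in> sdp_feasible n K \<longleftrightarrow> feasible_fun n K (\<lambda>i j. Z $$ (i, j))"
proof -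
  have "transpose_mat Z = Z \<longleftrightarrow> (\<forall>i<n. \<forall>j<n. Z $$ (i, j) = Z $$ (j, i))"
  proof
    assume "transpose_mat Z = Z"
    then show "\<forall>i<n. \<forall>j<n. Z $$ (i, j) = Z $$ (j, i)"
      using Z by (metis carrier_matD index_transpose_mat(1))
  qed (use Z in \<open>auto intro!: eq_matI\<close>)
  moreover have "mat_trace Z = (\<Sum>i<n. Z $$ (i, i))" using Z by (simp add: mat_trace_def)
  moreover have "Z *\<^sub>v all_ones n = all_ones n \<longleftrightarrow> (\<forall>i<n. (\<Sum>j<n. Z $$ (i, j)) = 1)"
  proof -
    have row: "(Z *\<^sub>v all_ones n) $ i = (\<Sum>j<n. Z $$ (i, j))" if "i < n" for i
      using Z that by (simp add: all_ones_def scalar_prod_def atLeast0LessThan)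
    have one: "all_ones n $ i = 1" if "i < n" for i using that by (simp add: all_ones_def)
    show ?thesis
    proof
      assume "Z *\<^sub>v all_ones n = all_ones n"
      then show "\<forall>i<n. (\<Sum>j<n. Z $$ (i, j)) = 1" using row one by metis
    next
      assume "\<forall>i<n. (\<Sum>j<n. Z $$ (i, j)) = 1"
      then show "Z *\<^sub>v all_ones n = all_ones n"
        using Z row one by (intro eq_vecI) (auto simp: all_ones_def)
    qed
  qed
  ultimately show ?thesis
    using Z by (auto simp: sdp_feasible_def feasible_fun_def pos_semidef_iff)
qed

lemma mat_inner_eq:
  assumes "A \<in> carrier_mat n n" "Z \<in> carrier_mat n n"
  shows "mat_inner A Z = (\<Sum>i<n. \<Sum>j<n. A $$ (i, j) * Z $$ (i, j))"
  using assms unfolding mat_inner_def mat_trace_def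
  by (subst sum.swap) (simp add: scalar_prod_def atLeast0LessThan)

text \<open>Matrices as functions on all pairs of indices, the type that carries the product topology.\<close>

definition feasible_set :: "nat \<Rightarrow> nat \<Rightarrow> (nat \<times> nat \<Rightarrow> real) set" where
  "feasible_set n K = {f. feasible_fun n K (\<lambda>i j. f (i, j)) \<and>
     (\<forall>i j. \<not> (i < n \<and> j < n) \<longrightarrow> f (i, j) = 0)}"

text \<open>Nonnegative entries with row sums 1 lie in [0, 1], so this is a closed subset of a
  product of compact intervals.\<close>

lemma compact_feasible_set: "compact (feasible_set n K)"
proof -
  have [continuous_intros]: "continuous_on UNIV (\<lambda>f :: nat \<times> nat \<Rightarrow> real. f ij)" for ij
    by (rule continuous_on_product_coordinates)
  have "closed (feasible_set n K)"
    unfolding feasible_set_def feasible_fun_def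
    by (intro closed_Collect_conj closed_Collect_all closed_Collect_imp closed_Collect_le closed_Collect_eq
        continuous_intros open_Collect_const)
  moreover have "compact (PiE UNIV (\<lambda>_ :: nat \<times> nat. {0..1 :: real}))"
    using compactin_PiE[of "\<lambda>_. euclidean" "UNIV :: (nat \<times> nat) set" "\<lambda>_. {0..1 :: real}"]
    by (simp add: euclidean_product_topology)
  ultimately have "compact (PiE UNIV (\<lambda>_ :: nat \<times> nat. {0..1 :: real}) \<inter> feasible_set n K)"
    by (rule compact_Int_closed[rotated])
  moreover have "feasible_set n K \<subseteq> PiE UNIV (\<lambda>_. {0..1})"
  proof
    fix f assume f: "f \<in> feasible_set n K"
    have "f (i, j) \<in> {0..1}" for i j
    proof (cases "i < n \<and> j < n")
      case True
      then have nn: "\<And>j. j < n \<Longrightarrow> 0 \<le> f (i, j)" and row: "(\<Sum>j<n. f (i, j)) = 1"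
        using f by (auto simp: feasible_set_def feasible_fun_def)
      have "f (i, j) \<le> (\<Sum>j<n. f (i, j))"
        using nn True by (intro member_le_sum) auto
      then show ?thesis using nn row True by auto
    qed (use f in \<open>auto simp: feasible_set_def\<close>)
    then show "f \<in> PiE UNIV (\<lambda>_. {0..1})" by auto
  qed
  ultimately show ?thesis by (simp add: Int_absorb1)
qed

section \<open>Exact recovery as strict optimality over functions\<close>

locale gmm_partition =
  fixes n K :: nat and G :: "nat \<Rightarrow> nat set" and m :: real
  assumes partition: "is_partition n K G" and card_G: "\<And>k. k < K \<Longrightarrow> real (card (G k)) = m" and m0: "0 < m"
begin

lemma cluster_of_eq: "k < K \<Longrightarrow> i \<in> G k \<Longrightarrow> cluster_of K G i = k"
  unfolding cluster_of_def using partition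
  by (intro the_equality) (auto simp: is_partition_def disjoint_family_on_def)

lemma G_subset: "k < K \<Longrightarrow> i \<in> G k \<Longrightarrow> i < n"
  using partition by (auto simp: is_partition_def)

lemma cluster_of_in: "i < n \<Longrightarrow> cluster_of K G i < K \<and> i \<in> G (cluster_of K G i)"
proof -
  assume "i < n"
  then have "i \<in> (\<Union>k<K. G k)" using partition by (auto simp: is_partition_def)
  then obtain k where "k < K" "i \<in> G k" by auto
  then show ?thesis using cluster_of_eq by auto
qed

lemma cluster_set: "k < K \<Longrightarrow> {i\<in>{..<n}. cluster_of K G i = k} = G k"
  using cluster_of_in cluster_of_eq G_subset by auto

sublocale balanced_clusters n K "cluster_of K G" m
  using cluster_of_in cluster_set card_G m0 by unfold_locales auto

abbreviation "c \<equiv> cluster_of K G"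

lemma true_membership_index:
  "i < n \<Longrightarrow> j < n \<Longrightarrow> true_membership n K G $$ (i, j) = (if c i = c j then 1 / m else 0)"
proof -
  assume ij: "i < n" "j < n"
  have "(\<exists>k<K. i \<in> G k \<and> j \<in> G k) \<longleftrightarrow> c i = c j"
    using cluster_of_in[OF ij(1)] cluster_of_in[OF ij(2)] cluster_of_eq by metis
  moreover have "real (card (G (c i))) = m" using card_G cluster_of_in[OF ij(1)] by simp
  ultimately show ?thesis using ij by (auto simp: true_membership_def)
qed

lemma true_membership_carrier: "true_membership n K G \<in> carrier_mat n n"
  by (simp add: true_membership_def)

lemma feasible_true_membership: "true_membership n K G \<in> sdp_feasible n K"
  unfolding sdp_feasible_iff[OF true_membership_carrier] feasible_fun_def
proof (intro conjI allI impI)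
  let ?Z = "\<lambda>i j. true_membership n K G $$ (i, j)"
  fix v :: "nat \<Rightarrow> real"
  have "(\<Sum>i<n. \<Sum>j<n. v i * ?Z i j * v j) = (\<Sum>i<n. \<Sum>j<n. if c i = c j then v i * v j / m else 0)"
    by (intro sum.cong refl) (auto simp: true_membership_index)
  also have "\<dots> = (\<Sum>i<n. \<Sum>j\<in>cluster (c i). v i * v j / m)"
    unfolding cluster_def by (intro sum.cong refl sum_same_cluster)
  also have "\<dots> = (\<Sum>k<K. \<Sum>i\<in>cluster k. \<Sum>j\<in>cluster k. v i * v j / m)"
    unfolding sum_clusters by (intro sum.cong refl) (auto simp: in_cluster)
  also have "\<dots> = (\<Sum>k<K. (\<Sum>i\<in>cluster k. v i)\<^sup>2 / m)"
    by (simp add: power2_eq_square sum_product sum_divide_distrib)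
  also have "0 \<le> \<dots>" using m0 by (intro sum_nonneg) auto
  finally show "0 \<le> (\<Sum>i<n. \<Sum>j<n. v i * ?Z i j * v j)" .
next
  show "(\<Sum>i<n. true_membership n K G $$ (i, i)) = real K"
    using K_times_m m0 by (simp add: true_membership_index field_simps)
next
  fix i assume i: "i < n"
  have "(\<Sum>j<n. true_membership n K G $$ (i, j)) = (\<Sum>j<n. if c i = c j then 1 / m else 0)"
    using i by (intro sum.cong refl) (auto simp: true_membership_index)
  also have "\<dots> = (\<Sum>j\<in>cluster (c i). 1 / m)"
    unfolding cluster_def by (rule sum_same_cluster)
  also have "\<dots> = 1" using c_less[OF i] m0 by simp
  finally show "(\<Sum>j<n. true_membership n K G $$ (i, j)) = 1" .
qed (use m0 in \<open>auto simp: true_membership_index\<close>)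

definition data :: "(nat \<Rightarrow> real vec) \<Rightarrow> (nat \<Rightarrow> nat \<Rightarrow> real) \<Rightarrow> nat \<Rightarrow> nat \<Rightarrow> real" where
  "data \<mu> e i a = \<mu> (c i) $ a + e i a"

lemma gram_index:
  assumes "\<forall>k<K. \<mu> k \<in> carrier_vec p" "i < n" "j < n"
  shows "(transpose_mat (gmm_data n p K G \<mu> e) * gmm_data n p K G \<mu> e) $$ (i, j)
    = dot p (data \<mu> e i) (data \<mu> e j)"
proof -
  let ?X = "gmm_data n p K G \<mu> e"
  have X: "?X \<in> carrier_mat p n" by (simp add: gmm_data_def mat_of_cols_def)
  have idx: "?X $$ (a, i) = data \<mu> e i a" if "a < p" "i < n" for a i
    using that assms(1) c_less[OF that(2)] by (auto simp: gmm_data_def mat_of_cols_def data_def)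
  have "(transpose_mat ?X * ?X) $$ (i, j) = (\<Sum>a<p. ?X $$ (a, i) * ?X $$ (a, j))"
    using X assms(2,3) by (simp add: scalar_prod_def atLeast0LessThan)
  then show ?thesis using assms(2,3) by (simp add: dot_def idx)
qed

text \<open>Puts recovery into the form of a strict gap, which suits both the measurability lemma
  and the dual certificate. The maps \<open>enc\<close> and \<open>dec\<close> identify matrices
  with functions supported on the index square.\<close>

lemma exact_recovery_iff:
  assumes \<mu>: "\<forall>k<K. \<mu> k \<in> carrier_vec p"
  defines "f0 \<equiv> \<lambda>(i, j). if i < n \<and> j < n then true_membership n K G $$ (i, j) else 0"
  shows "exact_recovery n K G (gmm_data n p K G \<mu> e) \<longleftrightarrow>
    (\<forall>f \<in> feasible_set n K.
      f \<noteq> f0 \<longrightarrow> (\<Sum>ij\<in>{..<n} \<times> {..<n}. dot p (data \<mu> e (fst ij)) (data \<mu> e (snd ij)) * f ij)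
        < (\<Sum>ij\<in>{..<n} \<times> {..<n}. dot p (data \<mu> e (fst ij)) (data \<mu> e (snd ij)) * f0 ij))"
    (is "_ \<longleftrightarrow> (\<forall>f\<in>?F. f \<noteq> f0 \<longrightarrow> ?\<phi> f < ?\<phi> f0)")
proof -
  let ?X = "gmm_data n p K G \<mu> e"
  let ?A = "transpose_mat ?X * ?X"
  define enc where "enc Z = (\<lambda>(i, j). if i < n \<and> j < n then Z $$ (i, j) else 0 :: real)" for Z
  define dec where "dec f = mat n n f" for f :: "nat \<times> nat \<Rightarrow> real"
  have A: "?A \<in> carrier_mat n n" 
  proof -
    have "?X \<in> carrier_mat p n" by (simp add: gmm_data_def mat_of_cols_def)
    then show ?thesis by auto
  qed
  have inner: "mat_inner ?A Z = ?\<phi> (enc Z)" if "Z \<in> carrier_mat n n" for Z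
  proof -
    have "mat_inner ?A Z = (\<Sum>i<n. \<Sum>j<n. dot p (data \<mu> e i) (data \<mu> e j) * enc Z (i, j))"
      unfolding mat_inner_eq[OF A that]
    proof (intro sum.cong refl)
      fix i j assume "i \<in> {..<n}" "j \<in> {..<n}"
      then have ij: "i < n" "j < n" by auto
      have "enc Z (i, j) = Z $$ (i, j)" using ij by (simp add: enc_def)
      then show "?A $$ (i, j) * Z $$ (i, j) = dot p (data \<mu> e i) (data \<mu> e j) * enc Z (i, j)"
        unfolding gram_index[OF \<mu> ij] by simp
    qed
    also have "\<dots> = ?\<phi> (enc Z)"
      unfolding sum.cartesian_product by (intro sum.cong refl) (auto split: prod.splits)
    finally show ?thesis .
  qed
  have carrier: "Z \<in> carrier_mat n n" if "Z \<in> sdp_feasible n K" for Z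
    using that by (simp add: sdp_feasible_def)
  have cong: "feasible_fun n K z \<longleftrightarrow> feasible_fun n K z'" if "\<And>i j. i < n \<Longrightarrow> j < n \<Longrightarrow> z i j = z' i j" for z z'
  proof -
    have "(\<Sum>i<n. \<Sum>j<n. v i * z i j * v j) = (\<Sum>i<n. \<Sum>j<n. v i * z' i j * v j)" for v
      by (intro sum.cong refl) (simp add: that)
    moreover have "(\<Sum>i<n. z i i) = (\<Sum>i<n. z' i i)"
      by (intro sum.cong refl) (simp add: that)
    moreover have "(\<Sum>j<n. z i j) = (\<Sum>j<n. z' i j)" if "i < n" for i
      by (intro sum.cong refl) (simp add: that \<open>\<And>i j. i < n \<Longrightarrow> j < n \<Longrightarrow> z i j = z' i j\<close>)
    ultimately show ?thesis unfolding feasible_fun_def using that by auto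
  qed
  have encF: "enc Z \<in> ?F" if "Z \<in> sdp_feasible n K" for Z
  proof -
    have "feasible_fun n K (\<lambda>i j. Z $$ (i, j))" using that sdp_feasible_iff[OF carrier[OF that]] by simp
    then have "feasible_fun n K (\<lambda>i j. enc Z (i, j))"
      using cong[of "\<lambda>i j. Z $$ (i, j)" "\<lambda>i j. enc Z (i, j)"] by (simp add: enc_def)
    then show ?thesis by (auto simp: enc_def feasible_set_def)
  qed
  have decF: "dec f \<in> sdp_feasible n K" if "f \<in> ?F" for f
  proof -
    have "dec f \<in> carrier_mat n n" by (simp add: dec_def)
    moreover have "feasible_fun n K (\<lambda>i j. dec f $$ (i, j))"
      using that cong[of "\<lambda>i j. f (i, j)" "\<lambda>i j. dec f $$ (i, j)"] by (simp add: dec_def feasible_set_def)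
    ultimately show ?thesis by (simp add: sdp_feasible_iff)
  qed
  have enc_dec: "enc (dec f) = f" if "f \<in> ?F" for f
    using that by (auto simp: enc_def dec_def feasible_set_def)
  have enc_inj: "Z = Z'" if "enc Z = enc Z'" "Z \<in> carrier_mat n n" "Z' \<in> carrier_mat n n" for Z Z'
  proof (rule eq_matI)
    fix i j assume "i < dim_row Z'" "j < dim_col Z'"
    then show "Z $$ (i, j) = Z' $$ (i, j)"
      using that(2,3) fun_cong[OF that(1), of "(i, j)"] unfolding enc_def by auto
  qed (use that in auto)
  let ?T = "true_membership n K G"
  have T: "?T \<in> sdp_feasible n K" by (rule feasible_true_membership)
  have encT: "enc ?T = f0" by (simp add: enc_def f0_def)
  show ?thesis
  proof
    assume ex: "exact_recovery n K G ?X"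
    then have sol: "Z \<in> sdp_solutions n K ?X \<longleftrightarrow> Z = ?T" for Z by (simp add: exact_recovery_def)
    then have Tmax: "\<And>Z. Z \<in> sdp_feasible n K \<Longrightarrow> mat_inner ?A Z \<le> mat_inner ?A ?T"
      by (auto simp: sdp_solutions_def is_arg_max_def not_less)
    show "\<forall>f\<in>?F. f \<noteq> f0 \<longrightarrow> ?\<phi> f < ?\<phi> f0"
    proof (intro ballI impI)
      fix f assume f: "f \<in> ?F" "f \<noteq> f0"
      have "dec f \<noteq> ?T" using f(2) enc_dec[OF f(1)] encT by auto
      then have "dec f \<notin> sdp_solutions n K ?X" using sol by simp
      \<comment> \<open>Failure of optimality yields some better \<open>Z\<close>, not necessarily
        the true matrix; \<open>Tmax\<close> compares those two.\<close>
      then obtain Z where "Z \<in> sdp_feasible n K" "mat_inner ?A (dec f) < mat_inner ?A Z"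
        using decF[OF f(1)] by (auto simp: sdp_solutions_def is_arg_max_def)
      with Tmax[of Z] have "mat_inner ?A (dec f) < mat_inner ?A ?T" by linarith
      then show "?\<phi> f < ?\<phi> f0"
        using inner[OF carrier[OF decF[OF f(1)]]] inner[OF carrier[OF T]] enc_dec[OF f(1)] encT by simp
    qed
  next
    assume max: "\<forall>f\<in>?F. f \<noteq> f0 \<longrightarrow> ?\<phi> f < ?\<phi> f0"
    have less: "mat_inner ?A Z < mat_inner ?A ?T" if "Z \<in> sdp_feasible n K" "Z \<noteq> ?T" for Z
    proof -
      have "enc Z \<noteq> f0" using enc_inj[of Z ?T] that carrier T encT by auto
      then have "?\<phi> (enc Z) < ?\<phi> f0" using max encF[OF that(1)] by blast
      then show ?thesis using inner[OF carrier[OF that(1)]] inner[OF carrier[OF T]] encT by simp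
    qed
    then have "Z \<in> sdp_solutions n K ?X \<longleftrightarrow> Z = ?T" for Z
      using T less_asym[of "mat_inner ?A ?T"] less_irrefl[of "mat_inner ?A ?T"]
      unfolding sdp_solutions_def is_arg_max_def mem_Collect_eq by metis
    then show "exact_recovery n K G ?X" by (auto simp: exact_recovery_def)
  qed
qed

lemma exact_recovery_measurable:
  assumes \<mu>: "\<forall>k<K. \<mu> k \<in> carrier_vec p" and "0 < \<sigma>"
  shows "{e\<in>space (gaussian_noise n p \<sigma>). exact_recovery n K G (gmm_data n p K G \<mu> e)}
    \<in> sets (gaussian_noise n p \<sigma>)"
  unfolding exact_recovery_iff[OF \<mu>]
proof (rule unique_maximizer_measurable)
  show "compact (feasible_set n K)"
    by (rule compact_feasible_set)
  have coord: "(\<lambda>x. x j) \<in> borel_measurable (gaussian_vector p \<sigma>)" if "j < p" for j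
    using isotropic_gaussian_gaussian_vector[OF \<open>0 < \<sigma>\<close>, of p] that by (auto simp: isotropic_gaussian_def)
  have [measurable]: "(\<lambda>e. e i a) \<in> borel_measurable (gaussian_noise n p \<sigma>)" if "i < n" "a < p" for i a
    unfolding gaussian_noise_def using that coord
    by (intro measurable_compose[OF measurable_component_singleton]) auto
  fix ij assume "ij \<in> {..<n} \<times> {..<n}"
  then have "fst ij < n" "snd ij < n" by auto
  then show "(\<lambda>e. dot p (data \<mu> e (fst ij)) (data \<mu> e (snd ij))) \<in> borel_measurable (gaussian_noise n p \<sigma>)"
    unfolding dot_def data_def by measurable
qed auto

end

section \<open>Probability of exact recovery\<close>

text \<open>A Gaussian vector is itself a product of one-dimensional normal laws, so its projection
  is a linear combination covered by \<open>isotropic_gaussian_sum\<close>.\<close>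

lemma isotropic_gaussian_inner:
  assumes "0 < \<sigma>"
  shows "isotropic_gaussian (gaussian_vector p \<sigma>) 1 (\<lambda>x _. dot p x d) (\<sigma>\<^sup>2 * dot p d d)"
proof -
  have "isotropic_gaussian (gaussian_vector p \<sigma>) 1 (\<lambda>x _. \<Sum>a<p. d a * x a) (\<sigma>\<^sup>2 * (\<Sum>a<p. (d a)\<^sup>2))"
    unfolding gaussian_vector_def
    by (intro isotropic_gaussian_sum isotropic_gaussian_normal_measure assms) simp
  then show ?thesis by (simp add: dot_def power2_eq_square mult.commute)
qed

lemma (in prob_space) prob_UN_le:
  assumes "finite I" "\<And>i. i \<in> I \<Longrightarrow> B i \<in> events" "\<And>i. i \<in> I \<Longrightarrow> prob (B i) \<le> b"
  shows "prob (\<Union>i\<in>I. B i) \<le> real (card I) * b"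
proof -
  have "prob (\<Union>i\<in>I. B i) \<le> (\<Sum>i\<in>I. prob (B i))"
    using assms by (intro finite_measure_subadditive_finite) auto
  also have "\<dots> \<le> (\<Sum>i\<in>I. b)" using assms by (intro sum_mono) auto
  finally show ?thesis by simp
qed

text \<open>All three terms are O(1 / L). In the last one the factor n cancels, and K exp (-
  \<delta> L) with K \<le> L remains.\<close>

lemma failure_probability_bound:
  fixes L K m n \<delta> :: real
  assumes \<delta>: "0 < \<delta>" and L: "54 \<le> L" and n: "n = exp L" and K: "0 < K" "K \<le> L" and m: "K * m = n"
  shows "2 * exp (- n) + K\<^sup>2 * (3 * exp (- (2 * m))) + n * K * exp (- ((1 + \<delta>) * L)) \<le> (5 + 4 / \<delta>\<^sup>2) / L"
proof -
  have inv: "exp (- x) \<le> 1 / y" if "y \<le> exp x" "0 < y" for x y :: real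
    using that by (simp add: exp_minus inverse_eq_divide frac_le)
  have "L \<le> exp L" using exp_ge_add_one_self[of L] by linarith
  then have "L \<le> exp n" using exp_ge_add_one_self[of n] unfolding n by linarith
  then have a: "exp (- n) \<le> 1 / L" using L by (intro inv) auto
  \<comment> \<open>From n \<ge> (L / 3)^3 and L \<ge> 54 follows n \<ge> 2 L^2, hence m = n / K
    \<ge> 2 L.\<close>
  have "L / 3 \<le> exp (L / 3)" using exp_ge_add_one_self[of "L / 3"] by linarith
  then have "(L / 3) ^ 3 \<le> exp (L / 3) ^ 3" using L by (intro power_mono) auto
  also have "\<dots> = n" by (simp add: n flip: exp_of_nat_mult)
  finally have "L * (L * L) \<le> 27 * n" by (simp add: power3_eq_cube)
  moreover have "54 * (L * L) \<le> L * (L * L)" using L by (intro mult_right_mono) auto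
  ultimately have "2 * L * L \<le> n" by simp
  moreover have "n \<le> L * m"
  proof -
    have "0 < m" using m K n by (metis exp_gt_zero zero_less_mult_pos)
    then show ?thesis using m K by (metis mult_right_mono less_imp_le)
  qed
  ultimately have "L * (2 * L) \<le> L * m" by simp
  then have m2: "2 * L \<le> m" using L by simp
  have "L ^ 4 \<le> exp L ^ 4" using L \<open>L \<le> exp L\<close> by (intro power_mono) auto
  also have "\<dots> = exp (4 * L)" by (simp flip: exp_of_nat_mult)
  also have "\<dots> \<le> exp (2 * m)" using m2 by simp
  finally have "exp (- (2 * m)) \<le> 1 / L ^ 4" using L by (intro inv) auto
  moreover have "K\<^sup>2 \<le> L\<^sup>2" using K by (intro power_mono) auto
  ultimately have "K\<^sup>2 * (3 * exp (- (2 * m))) \<le> L\<^sup>2 * (3 * (1 / L ^ 4))"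
    by (intro mult_mono) auto
  also have "\<dots> = 3 / L * (1 / L)" using L by (simp add: eval_nat_numeral field_simps)
  also have "\<dots> \<le> 3 / L * 1" using L by (intro mult_left_mono) auto
  finally have b: "K\<^sup>2 * (3 * exp (- (2 * m))) \<le> 3 / L" by simp
  \<comment> \<open>Squaring provides one factor \<open>L\<close> to absorb \<open>K\<close> and one
    for the decay.\<close>
  have "\<delta> * L / 2 \<le> exp (\<delta> * L / 2)" using exp_ge_add_one_self[of "\<delta> * L / 2"] by linarith
  then have "(\<delta> * L / 2)\<^sup>2 \<le> (exp (\<delta> * L / 2))\<^sup>2" using L \<delta> by (intro power_mono) auto
  also have "\<dots> = exp (\<delta> * L)" by (simp flip: exp_double)
  finally have "exp (- (\<delta> * L)) \<le> 1 / (\<delta> * L / 2)\<^sup>2" using L \<delta> by (intro inv) auto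
  then have "K * exp (- (\<delta> * L)) \<le> L * (1 / (\<delta> * L / 2)\<^sup>2)" using K by (intro mult_mono) auto
  also have "\<dots> = 4 / \<delta>\<^sup>2 / L" using L \<delta> by (simp add: power2_eq_square field_simps)
  also have "K * exp (- (\<delta> * L)) = n * K * exp (- ((1 + \<delta>) * L))"
  proof -
    have "exp (- (\<delta> * L)) = n * exp (- ((1 + \<delta>) * L))"
      unfolding n by (simp add: algebra_simps flip: exp_add)
    then show ?thesis by simp
  qed
  finally have "n * K * exp (- ((1 + \<delta>) * L)) \<le> 4 / \<delta>\<^sup>2 / L" .
  with a b show ?thesis by (simp add: add_divide_distrib)
qed

section \<open>Union bound over the bad events\<close>

context gmm_partition
begin

lemma good_noise_exact_recovery:
  assumes \<mu>: "\<forall>k<K. \<mu> k \<in> carrier_vec p"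
    and good: "good_noise n K c m p (\<lambda>k a. \<mu> k $ a) e \<sigma> \<gamma> \<tau> \<Lambda> S"
  shows "exact_recovery n K G (gmm_data n p K G \<mu> e)"
  unfolding exact_recovery_iff[OF \<mu>]
proof (intro ballI impI)
  define f0 where "f0 = (\<lambda>(i, j). if i < n \<and> j < n then true_membership n K G $$ (i, j) else 0)"
  let ?\<phi> = "\<lambda>f. \<Sum>ij\<in>{..<n} \<times> {..<n}. dot p (data \<mu> e (fst ij)) (data \<mu> e (snd ij)) * f ij"
  fix f assume f: "f \<in> feasible_set n K"
    and ne: "f \<noteq> (\<lambda>(i, j). if i < n \<and> j < n then true_membership n K G $$ (i, j) else 0)"
  have \<phi>: "?\<phi> f = (\<Sum>i<n. \<Sum>j<n. dot p (\<lambda>a. \<mu> (c i) $ a + e i a) (\<lambda>a. \<mu> (c j) $ a + e j a) * f (i, j))" for f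
    unfolding sum.cartesian_product data_def[abs_def] by (intro sum.cong refl) (auto split: prod.splits)
  have "?\<phi> f < ?\<phi> f0"
  proof (rule ccontr)
    assume "\<not> ?\<phi> f < ?\<phi> f0"
    then have "?\<phi> f0 \<le> ?\<phi> f" by simp
    moreover have "?\<phi> f0 = (\<Sum>i<n. \<Sum>j<n. dot p (\<lambda>a. \<mu> (c i) $ a + e i a) (\<lambda>a. \<mu> (c j) $ a + e j a)
        * (if c i = c j then 1 / m else 0))"
      unfolding \<phi> by (intro sum.cong refl) (simp add: f0_def true_membership_index)
    ultimately have le: "(\<Sum>i<n. \<Sum>j<n. dot p (\<lambda>a. \<mu> (c i) $ a + e i a) (\<lambda>a. \<mu> (c j) $ a + e j a)
        * (if c i = c j then 1 / m else 0))
      \<le> (\<Sum>i<n. \<Sum>j<n. dot p (\<lambda>a. \<mu> (c i) $ a + e i a) (\<lambda>a. \<mu> (c j) $ a + e j a) * f (i, j))"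
      unfolding \<phi> by simp
    have "f (i, j) = (if c i = c j then 1 / m else 0)" if "i < n" "j < n" for i j
      by (rule good_noise.good_noise_unique_optimum[OF good, where Z="\<lambda>i j. f (i, j)"])
        (use f le that in \<open>auto simp: feasible_set_def feasible_fun_def\<close>)
    then have "f = f0" using f by (auto simp: f0_def true_membership_index feasible_set_def)
    then show False using ne by (simp add: f0_def)
  qed
  then show "?\<phi> f < ?\<phi> (\<lambda>(i, j). if i < n \<and> j < n then true_membership n K G $$ (i, j) else 0)"
    unfolding f0_def .
qed

text \<open>\<open>C0\<close> is the constant of \<open>gram_concentrated\<close>. In
  \<open>C1\<close> the summand \<open>C0\<close> pays for the Gram error on all points and the rest
  for \<open>S * real K\<close>, so that \<open>\<Lambda> = m * h\<close> covers both.\<close>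

lemma exact_recovery_probability:
  fixes \<alpha> \<theta> \<sigma> :: real and \<mu> :: "nat \<Rightarrow> real vec" and p :: nat
  defines "L \<equiv> ln (real n)" and "q \<equiv> real p / m"
  defines "C0 \<equiv> 380 :: real"
  defines "C1 \<equiv> C0 + 128 + 32 * C0\<^sup>2"
  assumes K: "2 \<le> K" and \<sigma>: "0 < \<sigma>" and \<mu>: "\<forall>k<K. \<mu> k \<in> carrier_vec p"
    and \<alpha>: "0 < \<alpha>" "\<alpha> \<le> 1 / 2"
    and \<theta>: "0 < \<theta>" "\<theta> * (2 * C0 + 6 + C1) \<le> \<alpha> / 8"
    and L: "1 \<le> \<theta>\<^sup>2 * L" and KL: "real K \<le> \<theta>\<^sup>2 * L"
    and sep: "\<And>k l. k < K \<Longrightarrow> l < K \<Longrightarrow> k \<noteq> l \<Longrightarrow>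
      (1 + \<alpha>) * (4 * \<sigma>\<^sup>2 * (L + sqrt (L\<^sup>2 + L * q))) \<le> (\<mu> k - \<mu> l) \<bullet> (\<mu> k - \<mu> l)"
  shows "\<P>(e in gaussian_noise n p \<sigma>. exact_recovery n K G (gmm_data n p K G \<mu> e))
    \<ge> 1 - (2 * exp (- real n) + (real K)\<^sup>2 * (3 * exp (- (2 * m))) + real n * real K * exp (- ((1 + \<alpha> / 8) * L)))"
proof -
  let ?N = "gaussian_vector p \<sigma>"
  let ?M = "gaussian_noise n p \<sigma>"
  let ?J = "\<lambda>kl. cluster (fst kl) \<union> cluster (snd kl)"
  define \<nu> where "\<nu> k a = \<mu> k $ a" for k a
  define d where "d k l a = \<nu> k a - \<nu> l a" for k l a
  define D where "D k l = dot p (d k l) (d k l)" for k l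
  \<comment> \<open>The factor 2 accounts for the \<open>2 * m\<close> points in a pair of
    clusters.\<close>
  define g where "g = 2 * C0 * \<sigma>\<^sup>2 * (1 + sqrt q)"
  define h where "h = C1 * \<sigma>\<^sup>2 * (real K + sqrt (real K * q))"
  define S where "S = \<sigma>\<^sup>2 * (128 + 32 * C0\<^sup>2) * m * (1 + sqrt (q / real K))"
  \<comment> \<open>The Gaussian tail exp (- \<tau>^2 / 2) becomes n^(-(1 + \<alpha> / 8)), which
    outweighs the at most n K pairs \<open>(i, l)\<close>.\<close>
  define \<tau> where "\<tau> = sqrt (2 * (1 + \<alpha> / 8) * L)"
  have K0: "0 < real K" using K by simp
  have q: "0 \<le> q" using m0 by (simp add: q_def)
  have pm: "real p = m * q" using m0 by (simp add: q_def)
  have C0: "0 \<le> C0" "0 \<le> C1" by (simp_all add: C0_def C1_def)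
  have Dsep: "(1 + \<alpha>) * (4 * \<sigma>\<^sup>2 * (L + sqrt (L\<^sup>2 + L * q))) \<le> D k l" if "k < K" "l < K" "k \<noteq> l" for k l
  proof -
    have "D k l = (\<mu> k - \<mu> l) \<bullet> (\<mu> k - \<mu> l)"
    proof -
      have "\<mu> k \<in> carrier_vec p" "\<mu> l \<in> carrier_vec p" using \<mu> that by auto
      then show ?thesis
        by (simp add: D_def d_def[abs_def] \<nu>_def dot_def scalar_prod_def atLeast0LessThan)
    qed
    then show ?thesis using sep[OF that] by simp
  qed
  note bounds = separation_bounds[OF \<alpha> \<sigma> q Dsep \<theta> C0 L order.strict_implies_order[OF K0] KL]
  have KL': "real K \<le> L" and L1: "1 \<le> L"
  proof -
    show L1: "1 \<le> L" using bounds(2)[of 0 1] K by simp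
    have "\<theta> * 6 \<le> \<theta> * (2 * C0 + 6 + C1)" using \<theta> C0 by (intro mult_left_mono) auto
    then have "\<theta> \<le> 1" using \<theta> \<alpha> by linarith
    then have "\<theta>\<^sup>2 * L \<le> 1 * L" using \<theta> L1 by (intro mult_right_mono) (auto simp: power_le_one)
    then show "real K \<le> L" using KL by simp
  qed
  have D_pos: "0 < D k l" if "k < K" "l < K" "k \<noteq> l" for k l
  proof -
    have "0 < 4 * \<sigma>\<^sup>2 * (L + sqrt (L * q))" using \<sigma> L1 q by (intro mult_pos_pos add_pos_nonneg) auto
    then show ?thesis using bounds(1)[OF that] by linarith
  qed
  have \<tau>: "0 \<le> \<tau>" "\<tau>\<^sup>2 / 2 = (1 + \<alpha> / 8) * L" using L1 \<alpha> by (auto simp: \<tau>_def)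
  have "prob_space ?N"
    using isotropic_gaussian_gaussian_vector[OF \<sigma>] by (auto simp: isotropic_gaussian_def)
  then interpret P: prob_space ?M unfolding gaussian_noise_def by (rule prob_space_PiM)
  have coord: "(\<lambda>x. x j) \<in> borel_measurable ?N" if "j < p" for j
    using isotropic_gaussian_gaussian_vector[OF \<sigma>, of p] that by (auto simp: isotropic_gaussian_def)
  have noise_meas: "(\<lambda>e. e i a) \<in> borel_measurable ?M" if "i < n" "a < p" for i a
    unfolding gaussian_noise_def using that coord
    by (intro measurable_compose[OF measurable_component_singleton]) auto
  have "0 < real n" unfolding K_times_m[symmetric] using K0 m0 by (rule mult_pos_pos)
  then have n0: "0 < n" by simp
  have pair_subset: "cluster k \<union> cluster l \<subseteq> {..<n}" for k l by (auto simp: in_cluster)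
  have pair_card: "real (card (cluster k \<union> cluster l)) = 2 * m" if "k < K" "l < K" "k \<noteq> l" for k l
  proof -
    have "cluster k \<inter> cluster l = {}" using that by (auto simp: in_cluster)
    then show ?thesis using that by (simp add: card_Un_disjoint)
  qed
  obtain B0 where B0: "B0 \<in> P.events" "P.prob B0 \<le> 2 * exp (- real n)"
    "\<And>e. e \<in> space ?M - B0 \<Longrightarrow> gram_concentrated p \<sigma> {..<n} e"
    using gram_concentrated_whp[OF \<sigma>, of "{..<n}" "{..<n}" p] n0 unfolding gaussian_noise_def[symmetric] by auto
  define pairs where "pairs = {(k, l). k < K \<and> l < K \<and> k \<noteq> l}"
  have pairs: "finite pairs" "real (card pairs) \<le> (real K)\<^sup>2"
  proof -
    have sub: "pairs \<subseteq> {..<K} \<times> {..<K}" by (auto simp: pairs_def)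
    then show "finite pairs" by (rule finite_subset) simp
    have "card pairs \<le> K * K" using card_mono[OF _ sub] by simp
    then show "real (card pairs) \<le> (real K)\<^sup>2"
      unfolding power2_eq_square by (metis of_nat_le_iff of_nat_mult)
  qed
  have "\<exists>B. B \<in> P.events \<and> P.prob B \<le> 2 * exp (- (2 * m)) \<and>
      (\<forall>e\<in>space ?M - B. gram_concentrated p \<sigma> (?J kl) e)" if "kl \<in> pairs" for kl
  proof -
    from that have kl: "fst kl < K" "snd kl < K" "fst kl \<noteq> snd kl" by (auto simp: pairs_def)
    have ne: "?J kl \<noteq> {}" using cluster_ne[OF kl(1)] by auto
    obtain B where B: "B \<in> P.events" "P.prob B \<le> 2 * exp (- real (card (?J kl)))"
      "\<And>e. e \<in> space ?M - B \<Longrightarrow> gram_concentrated p \<sigma> (?J kl) e"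
      by (rule gram_concentrated_whp[OF \<sigma> finite_lessThan pair_subset ne, of p,
            folded gaussian_noise_def], rule that)
    then show ?thesis unfolding pair_card[OF kl] by blast
  qed
  then obtain Bp where Bp: "\<And>kl. kl \<in> pairs \<Longrightarrow> Bp kl \<in> P.events"
    "\<And>kl. kl \<in> pairs \<Longrightarrow> P.prob (Bp kl) \<le> 2 * exp (- (2 * m))"
    "\<And>kl e. kl \<in> pairs \<Longrightarrow> e \<in> space ?M - Bp kl \<Longrightarrow> gram_concentrated p \<sigma> (?J kl) e"
    by metis
  let ?d = "\<lambda>kl. d (fst kl) (snd kl)"
  \<comment> \<open>The projections are \<open>2 * m\<close> Gaussians of variance \<sigma>^2 D, and
    the tail bound allows 8 times the sum of the variances.\<close>
  define Bq where "Bq kl = {e\<in>space ?M. 16 * \<sigma>\<^sup>2 * m * D (fst kl) (snd kl) <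
      (\<Sum>i\<in>?J kl. (dot p (e i) (?d kl))\<^sup>2)}" for kl
  have Bq_meas: "Bq kl \<in> P.events" for kl
  proof -
    have "(\<lambda>e. dot p (e i) (?d kl)) \<in> borel_measurable ?M"
      if "i \<in> ?J kl" for i
      unfolding dot_def using that pair_subset[of "fst kl" "snd kl"]
      by (intro borel_measurable_sum borel_measurable_times noise_meas borel_measurable_const) auto
    then show ?thesis
      unfolding Bq_def
      by (intro borel_measurable_less borel_measurable_const borel_measurable_sum borel_measurable_power)
  qed
  have Bq: "P.prob (Bq kl) \<le> exp (- (2 * m))" if "kl \<in> pairs" for kl
  proof -
    from that have kl: "fst kl < K" "snd kl < K" "fst kl \<noteq> snd kl" by (auto simp: pairs_def)
    have "0 < \<sigma>\<^sup>2 * dot p (?d kl) (?d kl)"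
      using D_pos[OF kl] \<sigma> by (simp add: D_def)
    note tail = isotropic_gaussian_sum_squares_tail[OF finite_lessThan pair_subset[of "fst kl" "snd kl"]
        isotropic_gaussian_inner[OF \<sigma>] this, unfolded pair_card[OF kl]]
    have eq: "8 * (\<sigma>\<^sup>2 * dot p (?d kl) (?d kl)) * (2 * m)
        = 16 * \<sigma>\<^sup>2 * m * D (fst kl) (snd kl)" by (simp add: D_def)
    show ?thesis using tail unfolding eq Bq_def gaussian_noise_def .
  qed
  define F where "F i l e = (\<lambda>a. d (c i) l a + (\<Sum>j\<in>cluster (c i) - {i}. e j a) / m
      - (\<Sum>j\<in>cluster l. e j a) / m)" for i l and e :: "nat \<Rightarrow> nat \<Rightarrow> real"
  let ?F = "\<lambda>il. F (fst il) (snd il)"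
  define Br where "Br il = {e\<in>space ?M. (\<Sum>a<p. e (fst il) a * ?F il e a)
      < - \<sigma> * sqrt (\<Sum>a<p. (?F il e a)\<^sup>2) * \<tau>}" for il
  define others where "others = {(i, l). i < n \<and> l < K \<and> l \<noteq> c i}"
  have others: "finite others" "real (card others) \<le> real n * real K"
  proof -
    have sub: "others \<subseteq> {..<n} \<times> {..<K}" by (auto simp: others_def)
    then show "finite others" by (rule finite_subset) simp
    have "card others \<le> n * K" using card_mono[OF _ sub] by simp
    then show "real (card others) \<le> real n * real K" by (metis of_nat_le_iff of_nat_mult)
  qed
  have F_meas: "(\<lambda>e. F i l e a) \<in> borel_measurable ?M" if "a < p" for i l a
  proof -
    have "(\<lambda>e. e j a) \<in> borel_measurable ?M" if "j \<in> cluster k" for j k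
      using that \<open>a < p\<close> noise_meas[of j a] by (auto simp: in_cluster)
    then show ?thesis unfolding F_def
      by (intro borel_measurable_diff borel_measurable_add borel_measurable_const borel_measurable_divide
          borel_measurable_sum) auto
  qed
  have Br_meas: "Br il \<in> P.events" if "il \<in> others" for il
  proof -
    have "fst il < n" using that by (auto simp: others_def)
    then show ?thesis
      unfolding Br_def
      by (intro borel_measurable_less borel_measurable_sum borel_measurable_times borel_measurable_const
          measurable_compose[OF _ borel_measurable_sqrt] borel_measurable_power F_meas noise_meas) auto
  qed
  have Br: "P.prob (Br il) \<le> exp (- ((1 + \<alpha> / 8) * L))" if "il \<in> others" for il
  proof -
    from that have il: "fst il < n" "snd il < K" "snd il \<noteq> c (fst il)" by (auto simp: others_def)
    \<comment> \<open>Neither sum contains \<open>e (fst il)\<close>: it is removed from the sum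
      over its own cluster, and the other cluster is a different one.\<close>
    have "?F il (e(fst il := y)) a = ?F il e a" for e y a
    proof -
      have "fst il \<notin> cluster (snd il)" using il by (auto simp: in_cluster)
      then have "(\<Sum>j\<in>cluster (snd il). (e(fst il := y)) j a) = (\<Sum>j\<in>cluster (snd il). e j a)"
        by (intro sum.cong) auto
      moreover have "(\<Sum>j\<in>cluster (c (fst il)) - {fst il}. (e(fst il := y)) j a)
          = (\<Sum>j\<in>cluster (c (fst il)) - {fst il}. e j a)"
        by (intro sum.cong) auto
      ultimately show ?thesis by (simp add: F_def)
    qed
    then show ?thesis
      using PiM_gaussian_vector_inner_tail[OF \<sigma> \<tau>(1) finite_lessThan, of "fst il" n p "?F il"]
        F_meas il(1) unfolding gaussian_noise_def[symmetric] Br_def \<tau>(2) by simp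
  qed
  \<comment> \<open>Gram deviation on all points, Gram deviation and projections for each pair of
    clusters, and the inner products of \<open>indep\<close>.\<close>
  define Bad where "Bad = B0 \<union> ((\<Union>kl\<in>pairs. Bp kl) \<union> (\<Union>kl\<in>pairs. Bq kl)) \<union> (\<Union>il\<in>others. Br il)"
  have meas: "(\<Union>kl\<in>pairs. Bp kl) \<in> P.events" "(\<Union>kl\<in>pairs. Bq kl) \<in> P.events" "(\<Union>il\<in>others. Br il) \<in> P.events"
    using pairs others Bp(1) Bq_meas Br_meas by auto
  have Bad_meas: "Bad \<in> P.events" unfolding Bad_def using B0(1) meas by auto
  have "P.prob Bad \<le> P.prob B0 + (P.prob (\<Union>kl\<in>pairs. Bp kl) + P.prob (\<Union>kl\<in>pairs. Bq kl)) + P.prob (\<Union>il\<in>others. Br il)"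
    unfolding Bad_def
    by (intro order_trans[OF measure_Un_le] add_mono order_refl sets.Un B0(1) meas)
  also have "\<dots> \<le> 2 * exp (- real n) + ((real K)\<^sup>2 * (2 * exp (- (2 * m))) + (real K)\<^sup>2 * exp (- (2 * m)))
      + real n * real K * exp (- ((1 + \<alpha> / 8) * L))"
  proof (intro add_mono B0(2))
    show "P.prob (\<Union>kl\<in>pairs. Bp kl) \<le> (real K)\<^sup>2 * (2 * exp (- (2 * m)))"
      by (rule order_trans[OF P.prob_UN_le[OF pairs(1) Bp(1) Bp(2)]]) (use pairs in \<open>auto intro: mult_right_mono\<close>)
    show "P.prob (\<Union>kl\<in>pairs. Bq kl) \<le> (real K)\<^sup>2 * exp (- (2 * m))"
      by (rule order_trans[OF P.prob_UN_le[OF pairs(1) Bq_meas Bq]]) (use pairs in \<open>auto intro: mult_right_mono\<close>)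
    show "P.prob (\<Union>il\<in>others. Br il) \<le> real n * real K * exp (- ((1 + \<alpha> / 8) * L))"
      by (rule order_trans[OF P.prob_UN_le[OF others(1) Br_meas Br]]) (use others in \<open>auto intro: mult_right_mono\<close>)
  qed
  finally have Bad_prob: "P.prob Bad \<le> 2 * exp (- real n) + (real K)\<^sup>2 * (3 * exp (- (2 * m)))
      + real n * real K * exp (- ((1 + \<alpha> / 8) * L))" by simp
  have spq: "sqrt (real p * real n) = m * sqrt (real K * q)"
  proof -
    have "real p * real n = m\<^sup>2 * (real K * q)" by (simp add: pm power2_eq_square mult_ac flip: K_times_m)
    then show ?thesis using m0 by (simp add: real_sqrt_mult)
  qed
  have SK: "S * real K = \<sigma>\<^sup>2 * (128 + 32 * C0\<^sup>2) * (real n + sqrt (real p * real n))"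
  proof -
    have Kq: "real K * sqrt (q / real K) = sqrt (real K * q)"
      using K0 by (simp add: real_sqrt_divide real_sqrt_mult field_simps)
    have "m * (1 + sqrt (q / real K)) * real K = real K * m + m * (real K * sqrt (q / real K))"
      by (simp add: algebra_simps)
    also have "\<dots> = real n + sqrt (real p * real n)"
      unfolding Kq spq K_times_m ..
    finally have "m * (1 + sqrt (q / real K)) * real K = real n + sqrt (real p * real n)" .
    then show ?thesis unfolding S_def by (simp only: mult.assoc)
  qed
  have good: "good_noise n K c m p (\<lambda>k a. \<mu> k $ a) e \<sigma> g \<tau> (m * h) S" if e: "e \<in> space ?M - Bad" for e
  proof unfold_locales
    show "0 < \<sigma>" by fact
    show "0 \<le> g" using C0 q by (simp add: g_def)
    show "0 \<le> \<tau>" by fact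
    show "0 \<le> S" using m0 q K0 by (simp add: S_def)
    show "gram_dev p (\<sigma>\<^sup>2) {..<n} e v v \<le> (m * h - S * real K) * (\<Sum>i<n. (v i)\<^sup>2)" for v
    proof -
      have "m * h = C1 * \<sigma>\<^sup>2 * (real n + sqrt (real p * real n))"
        unfolding spq h_def using K_times_m by (simp add: algebra_simps)
      then have "m * h - S * real K = 380 * \<sigma>\<^sup>2 * (real n + sqrt (real p * real n))"
        unfolding SK C1_def C0_def by (simp add: algebra_simps)
      moreover have "\<bar>gram_dev p (\<sigma>\<^sup>2) {..<n} e v v\<bar> \<le>
          380 * \<sigma>\<^sup>2 * (real n + sqrt (real p * real n)) * (\<Sum>i<n. (v i)\<^sup>2)"
        using B0(3)[of e, unfolded gram_concentrated_def, rule_format, of v v] e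
        by (simp add: Bad_def mult.assoc abs_of_nonneg sum_nonneg)
      ultimately show ?thesis by (simp add: abs_le_iff)
    qed
    fix k l assume k: "k < K" and l: "l < K" and kl: "k \<noteq> l"
    then have klp: "(k, l) \<in> pairs" by (auto simp: pairs_def)
    let ?kl = "\<lambda>a. \<mu> k $ a - \<mu> l $ a"
    let ?n = "\<lambda>w. sqrt (\<Sum>i\<in>cluster k \<union> cluster l. (w i)\<^sup>2)"
    have d_eq: "?kl = d k l" by (simp add: d_def[abs_def] \<nu>_def)
    show "\<bar>gram_dev p (\<sigma>\<^sup>2) (cluster k \<union> cluster l) e u v\<bar> \<le> m * g *
        ?n u * ?n v" for u v
    proof -
      have "e \<in> space ?M - Bp (k, l)" using e klp by (auto simp: Bad_def)
      with Bp(3)[OF klp this] pair_card[OF k l kl]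
      have "\<bar>gram_dev p (\<sigma>\<^sup>2) (cluster k \<union> cluster l) e u v\<bar> \<le>
        380 * \<sigma>\<^sup>2 * (2 * m + sqrt (real p * (2 * m))) * ?n u * ?n v"
        by (simp add: gram_concentrated_def)
      also have "\<dots> \<le> m * g * ?n u * ?n v"
      proof (intro mult_right_mono)
        have "sqrt (real p * (2 * m)) \<le> sqrt ((2 * m)\<^sup>2 * q)"
          using q m0 by (intro real_sqrt_le_mono) (simp add: pm power2_eq_square)
        then have "sqrt (real p * (2 * m)) \<le> 2 * m * sqrt q" using m0 by (simp add: real_sqrt_mult)
        then have "380 * \<sigma>\<^sup>2 * (2 * m + sqrt (real p * (2 * m))) \<le> 380 * \<sigma>\<^sup>2 * (2 * m + 2 * m * sqrt q)"
          by (intro mult_left_mono) auto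
        then show "380 * \<sigma>\<^sup>2 * (2 * m + sqrt (real p * (2 * m))) \<le> m * g"
          by (simp add: g_def C0_def algebra_simps)
      qed (auto intro: sum_nonneg)
      finally show ?thesis .
    qed
    show "(\<Sum>i\<in>cluster k \<union> cluster l. (dot p (e i) ?kl)\<^sup>2)
        \<le> 16 * \<sigma>\<^sup>2 * m * dot p ?kl ?kl"
    proof -
      have "e \<in> space ?M" "e \<notin> Bq (k, l)" using e klp by (auto simp: Bad_def)
      then show ?thesis unfolding d_eq by (simp add: Bq_def D_def not_less)
    qed
    have mh: "2 * (m * h) / m = 2 * h" using m0 by simp
    show "12 * \<sigma> * sqrt (dot p ?kl ?kl) + 2 * g + 2 * (m * h) / m
        \<le> dot p ?kl ?kl / 2"
      unfolding d_eq mh using bounds(3)[OF k l kl] by (simp only: D_def g_def h_def)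
    show "2 * \<sigma> * \<tau> * sqrt (dot p ?kl ?kl
          + 12 * \<sigma> * sqrt (dot p ?kl ?kl)
          + 2 * \<sigma>\<^sup>2 * (real p / m) + 2 * g) + 4 * g
          + 8 * \<sigma> * sqrt (dot p ?kl ?kl) + 2 * (m * h) / m
        < dot p ?kl ?kl"
      unfolding d_eq mh using bounds(4)[OF k l kl] by (simp only: D_def g_def h_def \<tau>_def q_def)
    show "128 * \<sigma>\<^sup>2 * m * dot p ?kl ?kl + 16 * g\<^sup>2 * m
        \<le> S * dot p ?kl ?kl"
      unfolding d_eq using cross_term_bound[OF \<sigma> q m0 K0 KL' L1 bounds(1)[OF k l kl], of C0]
      by (simp only: D_def g_def S_def)
  next
    fix i l w assume i: "i < n" and l: "l < K" "l \<noteq> c i"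
      and w: "w = (\<lambda>a. \<mu> (c i) $ a - \<mu> l $ a + (\<Sum>j\<in>cluster (c i) - {i}. e j a) / m - (\<Sum>j\<in>cluster l. e j a) / m)"
    have "w = F i l e" by (simp add: w F_def d_def \<nu>_def)
    moreover have "e \<in> space ?M" "e \<notin> Br (i, l)" using e i l by (auto simp: Bad_def others_def)
    ultimately show "- \<sigma> * sqrt (dot p w w) * \<tau> \<le> dot p (e i) w"
      by (simp add: Br_def dot_def power2_eq_square not_less)
  qed
  have "space ?M - Bad \<subseteq> {e\<in>space ?M. exact_recovery n K G (gmm_data n p K G \<mu> e)}"
    using good_noise_exact_recovery[OF \<mu> good] by auto
  then have "P.prob (space ?M - Bad) \<le> P.prob {e\<in>space ?M. exact_recovery n K G (gmm_data n p K G \<mu> e)}"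
    by (intro P.finite_measure_mono exact_recovery_measurable[OF \<mu> \<sigma>])
  moreover have "P.prob (space ?M - Bad) = 1 - P.prob Bad"
    using Bad_meas by (rule P.prob_compl)
  ultimately show ?thesis using Bad_prob by linarith
qed

end

section \<open>Choice of the constants\<close>

theorem corollary2p2:
  fixes \<alpha> :: real
  assumes "\<alpha> > 0"
  shows "\<exists>C\<^sub>1 C\<^sub>2 c\<^sub>3 :: real. C\<^sub>1 > 0 \<and> C\<^sub>2 > 0 \<and> c\<^sub>3 > 0 \<and>
    (\<forall>(n :: nat) (p :: nat) (K :: nat) (\<sigma> :: real)
        (G :: nat \<Rightarrow> nat set) (\<mu> :: nat \<Rightarrow> real vec).
      3 \<le> n \<longrightarrow> 2 \<le> K \<longrightarrow> K \<le> n \<longrightarrow> 0 < \<sigma> \<longrightarrow>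
      is_partition n K G \<longrightarrow>
      (\<forall>k<K. \<mu> k \<in> carrier_vec p) \<longrightarrow>
      (\<forall>k<K. real (card (G k)) = real n / real K) \<longrightarrow>
      real K \<le> C\<^sub>1 * ln (real n) / ln (ln (real n)) \<longrightarrow>
      min_sq_separation K \<mu> \<ge> (1 + \<alpha>) * sq_threshold n p K \<sigma> \<longrightarrow>
      \<P>(\<epsilon> in gaussian_noise n p \<sigma>. exact_recovery n K G (gmm_data n p K G \<mu> \<epsilon>))
        \<ge> 1 - C\<^sub>2 * ln (real n) powr (- c\<^sub>3))"
proof -
  \<comment> \<open>Lowering \<alpha> weakens the separation that is used and brings it into the
    range of \<open>separation_bounds\<close>.\<close>
  define \<beta> where "\<beta> = min \<alpha> (1 / 2)"
  have \<beta>: "0 < \<beta>" "\<beta> \<le> 1 / 2" "\<beta> \<le> \<alpha>" using assms by (auto simp: \<beta>_def)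
  \<comment> \<open>The weight \<open>2 * C0 + 6 + C1\<close> of \<open>separation_bounds\<close> at
    \<open>C0 = 380\<close>.\<close>
  define C where "C = (2 * 380 + 6 + (380 + 128 + 32 * 380\<^sup>2) :: real)"
  define \<theta> where "\<theta> = \<beta> / 8 / C"
  have \<theta>: "0 < \<theta>" "\<theta> * C \<le> \<beta> / 8" using \<beta> by (auto simp: \<theta>_def C_def)
  have \<theta>1: "\<theta>\<^sup>2 \<le> 1"
  proof -
    have "\<theta> * 1 \<le> \<theta> * C" using \<theta> by (intro mult_left_mono) (auto simp: C_def)
    then have "\<theta> \<le> 1" using \<theta> \<beta> by linarith
    then show ?thesis using \<theta> by (simp add: power_le_one)
  qed
  \<comment> \<open>54 is the bound required by \<open>failure_probability_bound\<close>, and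
    \<open>1 / \<theta>\<^sup>2\<close> ensures \<open>1 \<le> \<theta>\<^sup>2 * L\<close>.\<close>
  define L0 where "L0 = max 54 (1 / \<theta>\<^sup>2)"
  define C2 where "C2 = max L0 (5 + 4 / (\<beta> / 8)\<^sup>2)"
  have C2: "0 < C2" "L0 \<le> C2" "5 + 4 / (\<beta> / 8)\<^sup>2 \<le> C2" by (auto simp: C2_def L0_def)
  show ?thesis
  proof (rule exI[of _ "\<theta>\<^sup>2"], rule exI[of _ C2], rule exI[of _ 1], intro conjI allI impI)
    show "0 < \<theta>\<^sup>2" "0 < C2" "0 < (1 :: real)" using \<theta> C2 by auto
    fix n p K :: nat and \<sigma> :: real and G :: "nat \<Rightarrow> nat set" and \<mu> :: "nat \<Rightarrow> real vec"
    assume n: "3 \<le> n" and K: "2 \<le> K" "K \<le> n" and \<sigma>: "0 < \<sigma>" and part: "is_partition n K G"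
      and \<mu>: "\<forall>k<K. \<mu> k \<in> carrier_vec p" and card: "\<forall>k<K. real (card (G k)) = real n / real K"
      and KL: "real K \<le> \<theta>\<^sup>2 * ln (real n) / ln (ln (real n))"
      and sep: "(1 + \<alpha>) * sq_threshold n p K \<sigma> \<le> min_sq_separation K \<mu>"
    define L where "L = ln (real n)"
    define m where "m = real n / real K"
    define q where "q = real p / m"
    have L0: "0 < L" using n by (simp add: L_def)
    have powr: "L powr (- 1) = 1 / L" using L0 by (simp add: powr_minus_divide)
    let ?P = "\<P>(\<epsilon> in gaussian_noise n p \<sigma>. exact_recovery n K G (gmm_data n p K G \<mu> \<epsilon>))"
    have "1 - C2 / L \<le> ?P"
    proof (cases "L0 \<le> L")
      \<comment> \<open>For small n the constant \<open>C2\<close>, being at least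
        \<open>L0\<close>, makes the claimed lower bound nonpositive.\<close>
      case False
      then have "1 \<le> C2 / L" using C2 L0 by simp
      then have "1 - C2 / L \<le> 0" by simp
      then show ?thesis using measure_nonneg by (rule order_trans)
    next
      case True
      have m0: "0 < m" using n K by (simp add: m_def)
      interpret gmm_partition n K G m
        using part card m0 by unfold_locales (auto simp: m_def)
      have L54: "54 \<le> L" and \<theta>L: "1 \<le> \<theta>\<^sup>2 * L"
        using True \<theta> by (auto simp: L0_def field_simps)
      \<comment> \<open>Then the hypothesis on the number of clusters implies K \<le> \<theta>^2
        L.\<close>
      have "1 \<le> ln L"
      proof -
        have "exp 1 \<le> L" using exp_le L54 by linarith
        then show ?thesis using L0 by (simp add: ln_ge_iff)
      qed
      then have "\<theta>\<^sup>2 * L / ln L \<le> \<theta>\<^sup>2 * L" using \<theta>L by (simp add: divide_le_eq_1 mult_le_cancel_left1 pos_divide_le_eq)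
      then have KL': "real K \<le> \<theta>\<^sup>2 * L" using KL by (simp add: L_def)
      moreover have "\<theta>\<^sup>2 * L \<le> 1 * L" using \<theta>1 L0 by (intro mult_right_mono) auto
      ultimately have KL1: "real K \<le> L" by simp
      \<comment> \<open>K p / (n L) equals q / L; moving the outer factor \<open>L\<close> under the
        root gives the form used in \<open>separation_bounds\<close>.\<close>
      have thr: "sq_threshold n p K \<sigma> = 4 * \<sigma>\<^sup>2 * (L + sqrt (L\<^sup>2 + L * q))"
      proof -
        have "real K * real p / (real n * L) = q / L" by (simp add: q_def m_def)
        moreover have "L * sqrt (1 + q / L) = sqrt (L\<^sup>2 * (1 + q / L))" using L0 by (simp add: real_sqrt_mult)
        moreover have "L\<^sup>2 * (1 + q / L) = L\<^sup>2 + L * q" using L0 by (simp add: power2_eq_square algebra_simps)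
        ultimately show ?thesis unfolding sq_threshold_def L_def[symmetric] by (simp add: algebra_simps)
      qed
      have q0: "0 \<le> q" using m0 by (simp add: q_def)
      have sep': "(1 + \<beta>) * (4 * \<sigma>\<^sup>2 * (L + sqrt (L\<^sup>2 + L * q))) \<le> (\<mu> k - \<mu> l) \<bullet> (\<mu> k - \<mu> l)"
        if "k < K" "l < K" "k \<noteq> l" for k l
      proof -
        have fin: "finite {(\<mu> k - \<mu> l) \<bullet> (\<mu> k - \<mu> l) | k l. k < K \<and> l < K \<and> k \<noteq> l}"
          by (rule finite_subset[of _ "(\<lambda>(k, l). (\<mu> k - \<mu> l) \<bullet> (\<mu> k - \<mu> l)) ` ({..<K} \<times> {..<K})"]) auto
        have "(1 + \<beta>) * (4 * \<sigma>\<^sup>2 * (L + sqrt (L\<^sup>2 + L * q))) \<le> (1 + \<alpha>) * (4 * \<sigma>\<^sup>2 * (L + sqrt (L\<^sup>2 + L * q)))"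
          using \<beta> L0 q0 by (intro mult_right_mono) auto
        also have "\<dots> \<le> min_sq_separation K \<mu>" using sep unfolding thr .
        also have "\<dots> \<le> (\<mu> k - \<mu> l) \<bullet> (\<mu> k - \<mu> l)"
          unfolding min_sq_separation_def using that by (intro Min_le fin) blast
        finally show ?thesis .
      qed
      have "1 - (2 * exp (- real n) + (real K)\<^sup>2 * (3 * exp (- (2 * m))) + real n * real K * exp (- ((1 + \<beta> / 8) * L))) \<le> ?P"
        unfolding L_def
        by (rule exact_recovery_probability[OF K(1) \<sigma> \<mu> \<beta>(1,2) \<theta>(1)])
          (use \<theta>(2) \<theta>L KL' sep' in \<open>auto simp: C_def L_def q_def\<close>)
      moreover have "2 * exp (- real n) + (real K)\<^sup>2 * (3 * exp (- (2 * m))) + real n * real K * exp (- ((1 + \<beta> / 8) * L))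
          \<le> (5 + 4 / (\<beta> / 8)\<^sup>2) / L"
        by (rule failure_probability_bound) (use \<beta> L54 n K KL1 in \<open>auto simp: L_def m_def\<close>)
      moreover have "(5 + 4 / (\<beta> / 8)\<^sup>2) / L \<le> C2 / L"
        using C2(3) L0 by (intro divide_right_mono) auto
      ultimately show ?thesis by linarith
    qed
    then show "1 - C2 * ln (real n) powr (- 1) \<le> ?P"
      using powr by (simp add: L_def)
  qed
qed

end
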